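(* Let $F : [0,\infty) \to [0,\infty)$. (1) $F \circ \Lambda$ is a one-sided Pólya frequency function for every one-sided Pólya frequency function $\Lambda$ if and only if there is $c > 0$ such that $F(x) = cx$ for all $x \geq 0$. (2) $F \circ K$ is a one-sided totally non-negative Lebesgue-measurable Toeplitz kernel on $\mathbb{R} \times \mathbb{R}$ for every such kernel $K$ if and only if either $F \equiv 0$ or there is $c > 0$ such that $F(x) = cx$ for all $x \geq 0$ or $F(x) = c\,\mathbf{1}_{x>0}$ for all $x \geq 0$. (3) $F \circ \mathbf{a} = (F(a_n))_{n \in \mathbb{Z}}$ is a one-sided Pólya frequency sequence for every one-sided Pólya frequency sequence $\mathbf{a} = (a_n)_{n \in \mathbb{Z}}$ if and only if either $F \equiv 0$ or there is $c > 0$ such that $F(x) = cx$ for all $x \geq 0$.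
   Context: A kernel $K : S \times S \to \mathbb{R}$ with $S \subseteq \mathbb{R}$ is totally non-negative if $\det(K(x_i,y_j))_{i,j=1}^n \geq 0$ for all $n \in \mathbb{N}$ and all $x_1 < \cdots < x_n$, $y_1 < \cdots < y_n$ in $S$. A Toeplitz kernel on $\mathbb{R} \times \mathbb{R}$ has the form $T_f(x,y) = f(x-y)$ with $f : \mathbb{R} \to \mathbb{R}$; it is measurable when $f$ is Lebesgue measurable. A Pólya frequency function is a Lebesgue integrable function $\Lambda : \mathbb{R} \to [0,\infty)$, non-zero at two or more points, with $T_\Lambda$ totally non-negative. A Pólya frequency sequence is a real sequence $(a_n)_{n \in \mathbb{Z}}$ such that the kernel $\mathbb{Z} \times \mathbb{Z} \to \mathbb{R}$, $(i,j) \mapsto a_{i-j}$, is totally non-negative. A function $f : \mathbb{R} \to \mathbb{R}$ is one-sided if there is $x_0 \in \mathbb{R}$ such that $f(x) = 0$ for all $x < x_0$ or $f(x) = 0$ for all $x > x_0$; likewise for sequences indexed by $\mathbb{Z}$. A Toeplitz kernel is one-sided if the associated function $f$ is. $\mathbf{1}_{x>0}$ equals $1$ for $x>0$ and $0$ for $x=0$. *)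

theory Defs
  imports "HOL-Analysis.Analysis" "Jordan_Normal_Form.Determinant"
begin

text \<open>
  Kernels on \<open>S \<times> S\<close> are rendered as total curried functions, of which only the values on \<open>S\<close>
  matter. The index type is an arbitrary linear order, so that the real line and the integers are
  treated uniformly. The constants \<open>det\<close> and \<open>mat\<close> are the ones of Jordan_Normal_Form, whose matrix
  dimensions are natural numbers rather than types. The case \<open>n = 0\<close> is vacuous, since the empty
  determinant is 1.
\<close>

definition totally_nonneg_on :: "'a::linorder set \<Rightarrow> ('a \<Rightarrow> 'a \<Rightarrow> real) \<Rightarrow> bool" where
  "totally_nonneg_on S K \<longleftrightarrow>
     (\<forall>n::nat. \<forall>x y. x \<in> {..<n} \<rightarrow> S \<and> y \<in> {..<n} \<rightarrow> S \<and>
        strict_mono_on {..<n} x \<and> strict_mono_on {..<n} y \<longrightarrow>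
        Determinant.det (Matrix.mat n n (\<lambda>(i, j). K (x i) (y j))) \<ge> 0)"

definition toeplitz :: "('a::minus \<Rightarrow> real) \<Rightarrow> 'a \<Rightarrow> 'a \<Rightarrow> real" where
  "toeplitz f = (\<lambda>x y. f (x - y))"

definition one_sided :: "('a::linorder \<Rightarrow> real) \<Rightarrow> bool" where
  "one_sided f \<longleftrightarrow> (\<exists>x0. (\<forall>x<x0. f x = 0) \<or> (\<forall>x>x0. f x = 0))"

definition polya_frequency_function :: "(real \<Rightarrow> real) \<Rightarrow> bool" where
  "polya_frequency_function \<Lambda> \<longleftrightarrow>
     (\<forall>x. \<Lambda> x \<ge> 0) \<and> integrable lebesgue \<Lambda> \<and>
     (\<exists>x y. x \<noteq> y \<and> \<Lambda> x \<noteq> 0 \<and> \<Lambda> y \<noteq> 0) \<and>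
     totally_nonneg_on UNIV (toeplitz \<Lambda>)"

definition polya_frequency_sequence :: "(int \<Rightarrow> real) \<Rightarrow> bool" where
  "polya_frequency_sequence a \<longleftrightarrow> totally_nonneg_on UNIV (toeplitz a)"

text \<open>
  The function \<open>f\<close> below is unique, namely \<open>f = (\<lambda>x. K x 0)\<close>.
\<close>

definition one_sided_measurable_toeplitz_kernel :: "(real \<Rightarrow> real \<Rightarrow> real) \<Rightarrow> bool" where
  "one_sided_measurable_toeplitz_kernel K \<longleftrightarrow>
     (\<exists>f. K = toeplitz f \<and> f \<in> borel_measurable lebesgue \<and> one_sided f)"

end

(*
Each of the three hypotheses forces F 0 = 0 and makes k |-> F (L (h k)) a Polya frequency sequence for
every one-sided Polya frequency function L and every h > 0. Minors of order 2 and 3 for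
L = exp (-x) and L = exp (-e x) (1 - exp (-x)) show that F is nondecreasing, that log (F (exp t)) is
concave, and that F is either constant on (0, oo), or positive and strictly increasing there; to exclude
that F vanishes near 0 one needs that no totally non-negative Toeplitz kernel comes from a function
with compact support that is positive at two points.

For strictly increasing F fix c > 0. The minors of order n of f (x - y) with x - y -> oo recover the
signs in the exponential expansion of f at infinity. For f (x) = F (c (1 - exp (-x))) and n = 3 this gives
F (c - w) >= F c - F'(c-) w. For f (x) = F (c (1 - 3 exp (-2 x) + 2 exp (-3 x))) and n = 4 it gives the
opposite inequality. Hence F is affine on (0, c], and log-concavity makes it linear.

The statement on compact supports also identifies the supports of one-sided totally non-negative
functions, which are empty, points or rays, so that the indicator of the support is totally
non-negative. It is proved by sampling on fine grids: by variation diminution the generating polynomial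
of a finite Polya frequency sequence with m + 1 terms has only real roots, so that the variance of the
sequence is at most m / 4, while log-concavity makes it of order m ^ 2.
*)

theory Submission
  imports Defs "HOL-Real_Asymp.Real_Asymp" "Jordan_Normal_Form.Char_Poly"
begin

section \<open>Determinants of real matrices given by functions\<close>

text \<open>Functions such as 1 - exp (-x) are not integrable, so they enter only with a damping
  factor exp (- \<epsilon> x), and that factor is removed by a limit \<epsilon> -> 0. The limit
  needs continuity of F, which is why log-concavity is extracted before any differential
  information. Such minors are read as follows. If f has a positive limit f0 at infinity, sending
  one row and one column to infinity turns a minor of order n + 1 of f into one of order n of f0 -
  f. After rescaling by an exponential this can be repeated: every round strips one term of the
  expansion, costs one order, and reverses the sign of what is left. A base function with one
  exponential and one with two therefore bound the same remainder of F from opposite sides. This is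
  how equality arises with nothing more than a one-sided first derivative of F.\<close>

definition fdet :: "nat \<Rightarrow> (nat \<Rightarrow> nat \<Rightarrow> real) \<Rightarrow> real" where
  "fdet n A = Determinant.det (Matrix.mat n n (\<lambda>(i, j). A i j))"

lemma fdet_leibniz:
  "fdet n A = (\<Sum>p | p permutes {0..<n}. of_int (sign p) * (\<Prod>i = 0..<n. A i (p i)))"
proof -
  have "A i (p i) = Matrix.mat n n (\<lambda>(i, j). A i j) $$ (i, p i)"
    if "p permutes {0..<n}" "i \<in> {0..<n}" for p i
    using that permutes_in_image[of p "{0..<n}" i] by simp
  then show ?thesis
    unfolding fdet_def by (subst det_def'[of _ n]) (auto intro!: sum.cong prod.cong)
qed

lemma fdet_cong:
  assumes "\<And>i j. i < n \<Longrightarrow> j < n \<Longrightarrow> A i j = B i j"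
  shows "fdet n A = fdet n B"
  unfolding fdet_def by (rule arg_cong[of _ _ Determinant.det]) (rule eq_matI, use assms in auto)

lemma fdet_tendsto:
  assumes "\<And>i j. i < n \<Longrightarrow> j < n \<Longrightarrow> ((\<lambda>t. A t i j) \<longlongrightarrow> B i j) F"
  shows "((\<lambda>t. fdet n (A t)) \<longlongrightarrow> fdet n B) F"
  unfolding fdet_leibniz
proof (intro tendsto_sum tendsto_mult tendsto_const tendsto_prod)
  fix p i assume "p \<in> {p. p permutes {0..<n}}" "i \<in> {0..<n}"
  then show "((\<lambda>t. A t i (p i)) \<longlongrightarrow> B i (p i)) F"
    using permutes_in_image[of p "{0..<n}" i] by (intro assms) auto
qed

lemma fdet_transpose: "fdet n (\<lambda>i j. A j i) = fdet n A"
proof -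
  have "Matrix.mat n n (\<lambda>(i, j). A j i) = transpose_mat (Matrix.mat n n (\<lambda>(i, j). A i j))"
    by (rule eq_matI) auto
  then show ?thesis unfolding fdet_def by (simp add: det_transpose[of _ n])
qed

lemma fdet_identical_rows:
  assumes "i < n" "k < n" "i \<noteq> k" "\<And>j. j < n \<Longrightarrow> A i j = A k j"
  shows "fdet n A = 0"
  unfolding fdet_def
  by (rule det_identical_rows[of _ n i k]) (use assms in \<open>auto simp: Matrix.row_def\<close>)

lemma fdet_identical_cols:
  assumes "j < n" "k < n" "j \<noteq> k" "\<And>i. i < n \<Longrightarrow> A i j = A i k"
  shows "fdet n A = 0"
  by (subst fdet_transpose[symmetric], rule fdet_identical_rows[of j n k]) (use assms in auto)

lemma fdet_scale:
  "fdet n (\<lambda>i j. r i * c j * A i j) = (\<Prod>i = 0..<n. r i) * (\<Prod>j = 0..<n. c j) * fdet n A"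
proof -
  have "(\<Prod>i = 0..<n. r i * c (p i) * A i (p i))
      = (\<Prod>i = 0..<n. r i) * (\<Prod>j = 0..<n. c j) * (\<Prod>i = 0..<n. A i (p i))"
    if "p permutes {0..<n}" for p
    using prod.permute[OF that, of c] by (simp add: prod.distrib comp_def)
  then show ?thesis
    unfolding fdet_leibniz sum_distrib_left by (intro sum.cong) (simp_all add: mult.left_commute)
qed

text \<open>Multilinearity in the rows, each row having its own index set. When these sets follow
  one another in order, this does the work of the Cauchy-Binet formula.\<close>

lemma fdet_row_sum:
  assumes "\<And>i. i < n \<Longrightarrow> finite (T i)"
  shows "fdet n (\<lambda>i j. \<Sum>t\<in>T i. w i t * B t j)
       = (\<Sum>\<tau>\<in>Pi\<^sub>E {0..<n} T. (\<Prod>i = 0..<n. w i (\<tau> i)) * fdet n (\<lambda>i j. B (\<tau> i) j))"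
proof -
  have "fdet n (\<lambda>i j. \<Sum>t\<in>T i. w i t * B t j) = (\<Sum>p | p permutes {0..<n}. of_int (sign p) *
      (\<Sum>\<tau>\<in>Pi\<^sub>E {0..<n} T. \<Prod>i = 0..<n. w i (\<tau> i) * B (\<tau> i) (p i)))"
    unfolding fdet_leibniz
  proof (intro sum.cong refl arg_cong2[where f = times])
    fix p :: "nat \<Rightarrow> nat"
    show "(\<Prod>i = 0..<n. \<Sum>t\<in>T i. w i t * B t (p i))
        = (\<Sum>\<tau>\<in>Pi\<^sub>E {0..<n} T. \<Prod>i = 0..<n. w i (\<tau> i) * B (\<tau> i) (p i))"
      by (rule prod_sum_PiE) (use assms in auto)
  qed
  also have "\<dots> = (\<Sum>\<tau>\<in>Pi\<^sub>E {0..<n} T. \<Sum>p | p permutes {0..<n}. of_int (sign p) *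
      (\<Prod>i = 0..<n. w i (\<tau> i) * B (\<tau> i) (p i)))"
    by (simp only: sum_distrib_left) (rule sum.swap)
  also have "\<dots> = (\<Sum>\<tau>\<in>Pi\<^sub>E {0..<n} T. (\<Prod>i = 0..<n. w i (\<tau> i)) * fdet n (\<lambda>i j. B (\<tau> i) j))"
    unfolding fdet_leibniz by (simp add: sum_distrib_left prod.distrib mult_ac)
  finally show ?thesis .
qed

lemma fdet_mult:
  "fdet n (\<lambda>i k. \<Sum>j<n. L i j * A j k) = fdet n L * fdet n A"
proof -
  have "Matrix.mat n n (\<lambda>(i, k). \<Sum>j<n. L i j * A j k)
      = Matrix.mat n n (\<lambda>(i, j). L i j) * Matrix.mat n n (\<lambda>(i, j). A i j)"
    by (rule eq_matI) (auto simp: scalar_prod_def atLeast0LessThan)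
  then show ?thesis
    unfolding fdet_def using det_mult[of "Matrix.mat n n (\<lambda>(i, j). L i j)" n "Matrix.mat n n (\<lambda>(i, j). A i j)"]
    by simp
qed

lemma fdet_unit_lower:
  assumes "\<And>i j. i < j \<Longrightarrow> j < n \<Longrightarrow> L i j = 0" "\<And>i. i < n \<Longrightarrow> L i i = 1"
  shows "fdet n L = 1"
proof -
  have "fdet n L = prod_list (diag_mat (Matrix.mat n n (\<lambda>(i, j). L i j)))"
    unfolding fdet_def by (rule det_lower_triangular[of n]) (use assms in auto)
  also have "\<dots> = prod_list (map (\<lambda>_. 1) [0..<n])"
    unfolding diag_mat_def by (rule arg_cong[of _ _ prod_list]) (use assms in auto)
  also have "\<dots> = 1" by (induction n) auto
  finally show ?thesis .
qed

lemma fdet_unit_upper: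
  assumes "\<And>i j. j < i \<Longrightarrow> i < n \<Longrightarrow> L i j = 0" "\<And>i. i < n \<Longrightarrow> L i i = 1"
  shows "fdet n L = 1"
  by (subst fdet_transpose[symmetric], rule fdet_unit_lower) (use assms in auto)

text \<open>The row operation is left multiplication by a unit lower bidiagonal matrix. In row 0 the
  truncated index \<open>0 - 1\<close> is \<open>0\<close> again, and \<open>c 0 = 0\<close> leaves
  that row unchanged.\<close>

lemma fdet_sub_prev_row:
  assumes "c 0 = 0"
  shows "fdet n (\<lambda>i j. A i j - c i * A (i - 1) j) = fdet n A"
proof -
  define L :: "nat \<Rightarrow> nat \<Rightarrow> real"
    where "L i j = (if i = j then 1 else if i = Suc j then - c i else 0)" for i j
  have "(\<Sum>j<n. L i j * A j k) = A i k - c i * A (i - 1) k" if "i < n" for i k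
  proof (cases i)
    case 0
    have "(\<Sum>j<n. L i j * A j k) = (\<Sum>j<n. if j = i then A j k else 0)"
      by (rule sum.cong) (auto simp: L_def 0)
    then show ?thesis using that assms 0 by simp
  next
    case (Suc m)
    have "(\<Sum>j<n. L i j * A j k)
        = (\<Sum>j<n. (if j = i then A j k else 0) + (if j = m then - c i * A j k else 0))"
      by (rule sum.cong) (auto simp: L_def Suc)
    then show ?thesis using that Suc by (simp add: sum.distrib)
  qed
  then have "fdet n (\<lambda>i j. A i j - c i * A (i - 1) j) = fdet n (\<lambda>i k. \<Sum>j<n. L i j * A j k)"
    by (intro fdet_cong) auto
  also have "\<dots> = fdet n A"
    unfolding fdet_mult by (subst fdet_unit_lower) (auto simp: L_def)
  finally show ?thesis .
qed

lemma fdet_laplace_row: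
  assumes "i < n"
  shows "fdet n A = (\<Sum>j<n. A i j * ((-1) ^ (i + j) *
     fdet (n - 1) (\<lambda>a b. A (if a < i then a else Suc a) (if b < j then b else Suc b))))"
proof -
  have "cofactor (Matrix.mat n n (\<lambda>(i, j). A i j)) i j = (-1) ^ (i + j) *
     fdet (n - 1) (\<lambda>a b. A (if a < i then a else Suc a) (if b < j then b else Suc b))" if "j < n" for j
    unfolding cofactor_def fdet_def
    by (intro arg_cong2[where f = times] refl arg_cong[of _ _ Determinant.det] eq_matI)
       (use that assms in \<open>auto simp: mat_delete_def\<close>)
  then show ?thesis
    using assms unfolding fdet_def
    by (subst laplace_expansion_row[of _ n i]) (auto intro!: sum.cong)
qed

lemma fdet_laplace_col:
  assumes "j < n"
  shows "fdet n A = (\<Sum>i<n. A i j * ((-1) ^ (i + j) *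
     fdet (n - 1) (\<lambda>a b. A (if a < i then a else Suc a) (if b < j then b else Suc b))))"
proof -
  have "fdet n A = fdet n (\<lambda>a b. A b a)" by (rule fdet_transpose[symmetric])
  also have "\<dots> = (\<Sum>i<n. A i j * ((-1) ^ (j + i) *
     fdet (n - 1) (\<lambda>a b. A (if b < i then b else Suc b) (if a < j then a else Suc a))))"
    by (rule fdet_laplace_row[OF assms])
  also have "\<dots> = (\<Sum>i<n. A i j * ((-1) ^ (i + j) *
     fdet (n - 1) (\<lambda>a b. A (if a < i then a else Suc a) (if b < j then b else Suc b))))"
  proof -
    have "fdet (n - 1) (\<lambda>a b. A (if b < i then b else Suc b) (if a < j then a else Suc a))
        = fdet (n - 1) (\<lambda>a b. A (if a < i then a else Suc a) (if b < j then b else Suc b))" for i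
      by (rule fdet_transpose)
    then show ?thesis by (simp add: add.commute)
  qed
  finally show ?thesis .
qed

lemma fdet_1: "fdet 1 A = A 0 0"
  by (subst fdet_laplace_row[of 0]) (auto simp: fdet_def)

lemma fdet_2: "fdet 2 A = A 0 0 * A 1 1 - A 0 1 * A 1 0"
  by (subst fdet_laplace_row[of 0]) (auto simp: numeral_2_eq_2 fdet_1[unfolded One_nat_def])

lemma fdet_3: "fdet 3 A = A 0 0 * (A 1 1 * A 2 2 - A 1 2 * A 2 1)
    - A 0 1 * (A 1 0 * A 2 2 - A 1 2 * A 2 0) + A 0 2 * (A 1 0 * A 2 1 - A 1 1 * A 2 0)"
  by (subst fdet_laplace_row[of 0])
     (auto simp: numeral_3_eq_3 fdet_2[unfolded numeral_2_eq_2] numeral_2_eq_2 algebra_simps)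

text \<open>Strict growth gives \<open>i \<le> p i\<close>, and a permutation preserves the sum, so
  none of these inequalities can be strict.\<close>

lemma permutes_strict_mono_eq:
  fixes p :: "nat \<Rightarrow> nat"
  assumes p: "p permutes {0..<n}" and mono: "\<And>i j. i < j \<Longrightarrow> j < n \<Longrightarrow> p i < p j" and i: "i < n"
  shows "p i = i"
proof -
  have lower: "i \<le> p i" if "i < n" for i
    using that
  proof (induction i)
    case (Suc i)
    then show ?case using mono[of i "Suc i"] by auto
  qed simp
  have "(\<Sum>i = 0..<n. p i) = (\<Sum>i = 0..<n. i)"
    using sum.permute[OF p, of id] by (simp add: comp_def)
  show ?thesis
  proof (rule ccontr)
    assume "p i \<noteq> i"
    then have "(\<Sum>i = 0..<n. i) < (\<Sum>i = 0..<n. p i)"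
      using i lower by (intro sum_strict_mono_ex1) (auto intro!: bexI[of _ i] simp: less_le)
    with \<open>_ = _\<close> show False by simp
  qed
qed

text \<open>Only the identity permutation can contribute to the Leibniz formula.\<close>

lemma fdet_monotone_matching_nonneg:
  assumes "\<And>i j i' j'. P i j \<Longrightarrow> P i' j' \<Longrightarrow> i < i' \<Longrightarrow> j < j'"
  shows "0 \<le> fdet n (\<lambda>i j. if P i j then 1 else 0)"
  unfolding fdet_leibniz
proof (intro sum_nonneg)
  fix p assume "p \<in> {p. p permutes {0..<n}}"
  then have p: "p permutes {0..<n}" by simp
  show "0 \<le> real_of_int (sign p) * (\<Prod>i = 0..<n. if P i (p i) then 1 else 0)"
  proof (cases "\<forall>i<n. P i (p i)")
    case True
    have "p i = i" if "i < n" for i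
      by (rule permutes_strict_mono_eq[OF p _ that]) (use True assms in \<open>meson less_trans\<close>)
    then have "p = id"
      using p by (metis atLeastLessThan_iff eq_id_iff permutes_not_in not_le zero_le)
    then show ?thesis by (auto intro!: prod_nonneg)
  next
    case False
    then have zero: "(\<Prod>i = 0..<n. if P i (p i) then 1 else 0) = (0::real)"
      by (auto simp: prod_zero_iff)
    show ?thesis unfolding zero by simp
  qed
qed

section \<open>Total non-negativity\<close>

abbreviation tn :: "('a::linorder \<Rightarrow> 'a \<Rightarrow> real) \<Rightarrow> bool" where
  "tn \<equiv> totally_nonneg_on UNIV"

lemma tn_iff:
  "tn K \<longleftrightarrow> (\<forall>n x y. strict_mono_on {..<n} x \<longrightarrow> strict_mono_on {..<n} y \<longrightarrow>
     0 \<le> fdet n (\<lambda>i j. K (x i) (y j)))"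
  unfolding totally_nonneg_on_def fdet_def by auto

lemma tnD:
  assumes "tn K" "\<And>i j. i < j \<Longrightarrow> j < n \<Longrightarrow> x i < x j" "\<And>i j. i < j \<Longrightarrow> j < n \<Longrightarrow> y i < y j"
  shows "0 \<le> fdet n (\<lambda>i j. K (x i) (y j))"
  using assms unfolding tn_iff by (auto simp: strict_mono_on_def)

lemma tnI:
  assumes "\<And>n x y. (\<And>i j. i < j \<Longrightarrow> j < n \<Longrightarrow> x i < x j) \<Longrightarrow>
     (\<And>i j. i < j \<Longrightarrow> j < n \<Longrightarrow> y i < y j) \<Longrightarrow> 0 \<le> fdet n (\<lambda>i j. K (x i) (y j))"
  shows "tn K"
  using assms unfolding tn_iff by (auto simp: strict_mono_on_def)

lemma tn_nonneg:
  assumes "tn K"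
  shows "0 \<le> K x y"
  using tnD[OF assms, of 1 "\<lambda>_. x" "\<lambda>_. y"] by (simp add: fdet_1[unfolded One_nat_def])

lemma tn_minor2:
  assumes "tn K" "x < x'" "y < y'"
  shows "K x y' * K x' y \<le> K x y * K x' y'"
  using tnD[OF assms(1), of 2 "\<lambda>i. if i = 0 then x else x'" "\<lambda>i. if i = 0 then y else y'"] assms(2,3)
  by (simp add: fdet_2)

lemma tn_transpose:
  assumes "tn K"
  shows "tn (\<lambda>x y. K y x)"
proof (rule tnI)
  fix n :: nat and x y assume "\<And>i j. i < j \<Longrightarrow> j < n \<Longrightarrow> x i < (x j :: 'a)" "\<And>i j. i < j \<Longrightarrow> j < n \<Longrightarrow> y i < (y j :: 'a)"
  then have "0 \<le> fdet n (\<lambda>i j. K (y i) (x j))" by (intro tnD[OF assms])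
  then show "0 \<le> fdet n (\<lambda>i j. K (y j) (x i))"
    by (subst fdet_transpose[symmetric]) simp
qed

text \<open>Weak monotonicity suffices: a repeated point repeats a row or a column, and the minor
  vanishes. This is what later allows reparametrisation by floors.\<close>

lemma tn_comp_mono:
  assumes "tn K" "mono \<phi>" "mono \<psi>"
  shows "tn (\<lambda>x y. K (\<phi> x) (\<psi> y))"
proof (rule tnI)
  fix n :: nat and x y
  assume x: "\<And>i j. i < j \<Longrightarrow> j < n \<Longrightarrow> x i < (x j :: 'b)"
    and y: "\<And>i j. i < j \<Longrightarrow> j < n \<Longrightarrow> y i < (y j :: 'b)"
  have le: "\<phi> (x i) \<le> \<phi> (x j)" "\<psi> (y i) \<le> \<psi> (y j)" if "i < j" "j < n" for i j
    using that monoD[OF assms(2)] monoD[OF assms(3)] x y by (simp_all add: less_imp_le)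
  consider "\<exists>i j. i < j \<and> j < n \<and> \<phi> (x i) = \<phi> (x j)" | "\<exists>i j. i < j \<and> j < n \<and> \<psi> (y i) = \<psi> (y j)"
    | "\<forall>i j. i < j \<longrightarrow> j < n \<longrightarrow> \<phi> (x i) < \<phi> (x j) \<and> \<psi> (y i) < \<psi> (y j)"
    using le by (meson order_le_less)
  then show "0 \<le> fdet n (\<lambda>i j. K (\<phi> (x i)) (\<psi> (y j)))"
  proof cases
    case 1
    then obtain i j where "i < j" "j < n" "\<phi> (x i) = \<phi> (x j)" by blast
    then have "fdet n (\<lambda>i j. K (\<phi> (x i)) (\<psi> (y j))) = 0"
      by (intro fdet_identical_rows[of i n j]) auto
    then show ?thesis by simp
  next
    case 2
    then obtain i j where "i < j" "j < n" "\<psi> (y i) = \<psi> (y j)" by blast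
    then have "fdet n (\<lambda>i j. K (\<phi> (x i)) (\<psi> (y j))) = 0"
      by (intro fdet_identical_cols[of i n j]) auto
    then show ?thesis by simp
  next
    case 3
    then show ?thesis by (intro tnD[OF assms(1)]) auto
  qed
qed

lemma tn_scale:
  assumes "tn K" "\<And>x. 0 \<le> r x" "\<And>y. 0 \<le> c y"
  shows "tn (\<lambda>x y. r x * c y * K x y)"
proof (rule tnI)
  fix n :: nat and x y
  assume "\<And>i j. i < j \<Longrightarrow> j < n \<Longrightarrow> x i < (x j :: 'a)" "\<And>i j. i < j \<Longrightarrow> j < n \<Longrightarrow> y i < (y j :: 'a)"
  then have "0 \<le> fdet n (\<lambda>i j. K (x i) (y j))" by (intro tnD[OF assms(1)])
  then show "0 \<le> fdet n (\<lambda>i j. r (x i) * c (y j) * K (x i) (y j))"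
    by (subst fdet_scale) (auto intro!: mult_nonneg_nonneg prod_nonneg assms(2,3))
qed

lemma tn_cmult: "tn K \<Longrightarrow> 0 \<le> c \<Longrightarrow> tn (\<lambda>x y. c * K x y)"
  using tn_scale[of K "\<lambda>_. c" "\<lambda>_. 1"] by simp

lemma tn_limit:
  assumes "\<And>m::nat. tn (K m)" "\<And>x y. (\<lambda>m. K m x y) \<longlonglongrightarrow> L x y"
  shows "tn L"
proof (rule tnI)
  fix n :: nat and x y
  assume "\<And>i j. i < j \<Longrightarrow> j < n \<Longrightarrow> x i < (x j :: 'a)" "\<And>i j. i < j \<Longrightarrow> j < n \<Longrightarrow> y i < (y j :: 'a)"
  then have "0 \<le> fdet n (\<lambda>i j. K m (x i) (y j))" for m by (intro tnD[OF assms(1)])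
  moreover have "(\<lambda>m. fdet n (\<lambda>i j. K m (x i) (y j))) \<longlonglongrightarrow> fdet n (\<lambda>i j. L (x i) (y j))"
    by (intro fdet_tendsto assms(2))
  ultimately show "0 \<le> fdet n (\<lambda>i j. L (x i) (y j))"
    by (intro LIMSEQ_le_const) auto
qed

lemma tn_toeplitz_reflect:
  fixes f :: "'a::{ab_group_add, linorder} \<Rightarrow> real"
  assumes "tn (toeplitz f)"
  shows "tn (toeplitz (\<lambda>x. f (- x)))"
  using tn_transpose[OF assms] by (simp add: toeplitz_def)

lemma tn_toeplitz_shift:
  fixes f :: "'a::linordered_idom \<Rightarrow> real"
  assumes "tn (toeplitz f)"
  shows "tn (toeplitz (\<lambda>x. f (x + s)))"
  using tn_comp_mono[OF assms, of "\<lambda>x. x + s" id]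
  by (simp add: toeplitz_def mono_def algebra_simps)

lemma tn_toeplitz_grid:
  assumes "tn (toeplitz f)" "0 \<le> h"
  shows "tn (toeplitz (\<lambda>k::int. f (h * real_of_int k)))"
proof -
  have "mono (\<lambda>k::int. h * real_of_int k)" using assms(2) by (intro monoI mult_left_mono) auto
  from tn_comp_mono[OF assms(1) this this] show ?thesis
    by (simp add: toeplitz_def right_diff_distrib)
qed

lemma tn_toeplitz_twist_int:
  fixes a :: "int \<Rightarrow> real"
  assumes "tn (toeplitz a)" "0 < r"
  shows "tn (toeplitz (\<lambda>k. r powi k * a k))"
proof -
  have "tn (\<lambda>x y. r powi x * r powi (- y) * toeplitz a x y)"
    using assms by (intro tn_scale) auto
  then show ?thesis
    using assms(2) by (simp add: toeplitz_def power_int_diff power_int_minus divide_inverse)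
qed

lemma tn_toeplitz_twist:
  assumes "tn (toeplitz f)"
  shows "tn (toeplitz (\<lambda>x::real. exp (c * x) * f x))"
proof -
  have "tn (\<lambda>x y. exp (c * x) * exp (- c * y) * toeplitz f x y)"
    using assms by (intro tn_scale) auto
  then show ?thesis
    by (simp add: toeplitz_def right_diff_distrib flip: exp_add)
qed

text \<open>Wright's form of log-concavity, read off from a single minor of order 2. It involves no
  midpoints and so serves the integers and the real line alike.\<close>

lemma tn_toeplitz_wright:
  fixes f :: "'a::linordered_idom \<Rightarrow> real"
  assumes "tn (toeplitz f)" "u \<le> v" "v \<le> z"
  shows "f u * f z \<le> f v * f (u + z - v)"
proof (cases "u = v \<or> v = z")
  case True
  then show ?thesis by auto
next
  case False
  then show ?thesis
    using tn_minor2[OF assms(1), of u "u + z - v" "u - v" 0] assms(2,3)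
    by (auto simp: toeplitz_def less_le algebra_simps)
qed

section \<open>Examples of totally non-negative Toeplitz kernels\<close>

text \<open>Expanding the rows by linearity leaves only minors of the original kernel: a choice of
  row indices that is not strictly increasing repeats a row.\<close>

lemma tn_row_sum:
  fixes K :: "'a::linorder \<Rightarrow> 'a \<Rightarrow> real"
  assumes "tn K" "\<And>i. i < n \<Longrightarrow> finite (T i)" "\<And>i t. i < n \<Longrightarrow> t \<in> T i \<Longrightarrow> 0 \<le> w i t"
    and T: "\<And>i j s t. i < j \<Longrightarrow> j < n \<Longrightarrow> s \<in> T i \<Longrightarrow> t \<in> T j \<Longrightarrow> s \<le> t"
    and y: "\<And>i j. i < j \<Longrightarrow> j < n \<Longrightarrow> y i < y j"
  shows "0 \<le> fdet n (\<lambda>i j. \<Sum>t\<in>T i. w i t * K t (y j))"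
proof -
  have "0 \<le> (\<Prod>i = 0..<n. w i (\<tau> i)) * fdet n (\<lambda>i j. K (\<tau> i) (y j))"
    if \<tau>: "\<tau> \<in> Pi\<^sub>E {0..<n} T" for \<tau>
  proof (intro mult_nonneg_nonneg prod_nonneg)
    show "0 \<le> fdet n (\<lambda>i j. K (\<tau> i) (y j))"
    proof (cases "\<forall>i j. i < j \<longrightarrow> j < n \<longrightarrow> \<tau> i < \<tau> j")
      case True
      then show ?thesis by (intro tnD[OF assms(1)] y) auto
    next
      case False
      then obtain i j where ij: "i < j" "j < n" "\<not> \<tau> i < \<tau> j" by blast
      moreover have "\<tau> i \<le> \<tau> j" using ij \<tau> by (intro T[OF ij(1,2)]) (auto simp: PiE_def Pi_def)
      ultimately have "fdet n (\<lambda>i j. K (\<tau> i) (y j)) = 0"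
        by (intro fdet_identical_rows[of i n j]) auto
      then show ?thesis by simp
    qed
  qed (use \<tau> assms(3) in \<open>auto simp: PiE_def Pi_def\<close>)
  then show ?thesis
    by (subst fdet_row_sum) (auto intro!: sum_nonneg assms(2))
qed

section \<open>Convolution with geometric and binomial sequences\<close>

lemma geometric_recurrence:
  fixes f g :: "int \<Rightarrow> real"
  assumes rec: "\<And>k. g k = \<alpha> * g (k - 1) + f k"
  shows "g (x + int d) = \<alpha> ^ d * g x + (\<Sum>t\<in>{x<..x + int d}. \<alpha> ^ nat (x + int d - t) * f t)"
proof (induction d)
  case (Suc d)
  have "{x<..x + int (Suc d)} = insert (x + int (Suc d)) {x<..x + int d}" by auto
  moreover have "(\<Sum>t\<in>{x<..x + int d}. \<alpha> ^ nat (x + int (Suc d) - t) * f t)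
      = \<alpha> * (\<Sum>t\<in>{x<..x + int d}. \<alpha> ^ nat (x + int d - t) * f t)"
    unfolding sum_distrib_left
  proof (rule sum.cong)
    fix t assume "t \<in> {x<..x + int d}"
    then have "nat (x + int (Suc d) - t) = Suc (nat (x + int d - t))" by auto
    then show "\<alpha> ^ nat (x + int (Suc d) - t) * f t = \<alpha> * (\<alpha> ^ nat (x + int d - t) * f t)"
      by simp
  qed simp
  ultimately show ?case
    using rec[of "x + int (Suc d)"] Suc by (simp add: algebra_simps)
qed simp

text \<open>The value of \<open>g\<close> at \<open>x i\<close> is a sum over all indices below, and
  these sets overlap for different rows. Subtracting the right multiple of the previous row leaves
  only the indices between \<open>x (i - 1)\<close> and \<open>x i\<close>; the row sets are then
  disjoint and ordered, and \<open>tn_row_sum\<close> applies.\<close>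

lemma tn_geometric_convolution:
  fixes f g :: "int \<Rightarrow> real"
  assumes "tn (toeplitz f)" "0 \<le> \<alpha>" "\<And>k. k < 0 \<Longrightarrow> g k = 0"
    and rec: "\<And>k. g k = \<alpha> * g (k - 1) + f k"
  shows "tn (toeplitz g)"
proof (rule tnI)
  fix n :: nat and x y
  assume x: "\<And>i j. i < j \<Longrightarrow> j < n \<Longrightarrow> x i < (x j :: int)"
    and y: "\<And>i j. i < j \<Longrightarrow> j < n \<Longrightarrow> y i < (y j :: int)"
  \<comment> \<open>\<open>X 0\<close> lies below \<open>y 0\<close> and hence below every
    \<open>y j\<close>, so that \<open>g (X 0 - y j) = 0\<close> and the first row also becomes a
    finite sum.\<close>
  define X where "X i = (if i = 0 then min (x 0) (y 0) - 1 else x (i - 1))" for i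
  define c where "c i = (if i = 0 then 0 else \<alpha> ^ nat (x i - x (i - 1)))" for i
  have row: "g (x i - y j) - c i * g (x (i - 1) - y j)
      = (\<Sum>t\<in>{X i<..x i}. \<alpha> ^ nat (x i - t) * toeplitz f t (y j))" if "i < n" "j < n" for i j
  proof -
    have le: "X i \<le> x i" using x[of "i - 1" i] that by (auto simp: X_def)
    have "g (X 0 - y j) = 0"
      using y[of 0 j] that by (cases "j = 0") (auto intro!: assms(3) simp: X_def)
    then have "c i * g (x (i - 1) - y j) = \<alpha> ^ nat (x i - X i) * g (X i - y j)"
      by (auto simp: c_def X_def)
    moreover have "g (t - y j) = \<alpha> * g (t - 1 - y j) + f (t - y j)" for t
      using rec[of "t - y j"] by (simp add: diff_diff_eq add.commute)
    from geometric_recurrence[of "\<lambda>t. g (t - y j)", OF this, of "X i" "nat (x i - X i)"]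
    have "g (x i - y j) = \<alpha> ^ nat (x i - X i) * g (X i - y j)
        + (\<Sum>t\<in>{X i<..x i}. \<alpha> ^ nat (x i - t) * f (t - y j))"
      using le by simp
    ultimately show ?thesis by (simp add: toeplitz_def)
  qed
  have "c 0 = 0" by (simp add: c_def)
  then have "fdet n (\<lambda>i j. toeplitz g (x i) (y j))
      = fdet n (\<lambda>i j. toeplitz g (x i) (y j) - c i * toeplitz g (x (i - 1)) (y j))"
    by (rule fdet_sub_prev_row[of c n "\<lambda>i j. toeplitz g (x i) (y j)", symmetric])
  also have "\<dots> = fdet n (\<lambda>i j. \<Sum>t\<in>{X i<..x i}. \<alpha> ^ nat (x i - t) * toeplitz f t (y j))"
  proof (rule fdet_cong)
    fix i j assume "i < n" "j < n"
    then show "toeplitz g (x i) (y j) - c i * toeplitz g (x (i - 1)) (y j)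
        = (\<Sum>t\<in>{X i<..x i}. \<alpha> ^ nat (x i - t) * toeplitz f t (y j))"
      unfolding toeplitz_def[of g] by (rule row)
  qed
  also have "0 \<le> \<dots>"
  proof (rule tn_row_sum[OF assms(1), where T = "\<lambda>i. {X i<..x i}" and w = "\<lambda>i t. \<alpha> ^ nat (x i - t)" and y = y])
    fix i j s t assume "i < j" "j < n" "s \<in> {X i<..x i}" "t \<in> {X j<..x j}"
    moreover have "x i \<le> x (j - 1)"
      using x[of i "j - 1"] \<open>i < j\<close> \<open>j < n\<close> by (cases "i = j - 1") (auto intro: less_imp_le)
    ultimately show "s \<le> t" by (auto simp: X_def split: if_splits)
  qed (use assms(2) y in auto)
  finally show "0 \<le> fdet n (\<lambda>i j. toeplitz g (x i) (y j))" .
qed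

text \<open>The row sets \<open>{x i - 1, x i}\<close> of neighbouring rows may share an end point;
  this is covered because \<open>tn_row_sum\<close> asks only for \<open>s \<le> t\<close>.\<close>

lemma tn_binomial_convolution:
  fixes f :: "int \<Rightarrow> real"
  assumes "tn (toeplitz f)" "0 \<le> \<beta>"
  shows "tn (toeplitz (\<lambda>k. f k + \<beta> * f (k - 1)))"
proof (rule tnI)
  fix n :: nat and x y
  assume x: "\<And>i j. i < j \<Longrightarrow> j < n \<Longrightarrow> x i < (x j :: int)"
    and y: "\<And>i j. i < j \<Longrightarrow> j < n \<Longrightarrow> y i < (y j :: int)"
  have "fdet n (\<lambda>i j. toeplitz (\<lambda>k. f k + \<beta> * f (k - 1)) (x i) (y j))
      = fdet n (\<lambda>i j. \<Sum>t\<in>{x i - 1, x i}. (if t = x i then 1 else \<beta>) * toeplitz f t (y j))"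
    by (rule fdet_cong) (simp add: toeplitz_def algebra_simps)
  also have "0 \<le> \<dots>"
    by (rule tn_row_sum[OF assms(1), where T = "\<lambda>i. {x i - 1, x i}" and w = "\<lambda>i t. if t = x i then 1 else \<beta>" and y = y])
       (use assms x y in \<open>force+\<close>)
  finally show "0 \<le> fdet n (\<lambda>i j. toeplitz (\<lambda>k. f k + \<beta> * f (k - 1)) (x i) (y j))" .
qed

lemma tn_toeplitz_point:
  "tn (toeplitz (\<lambda>x::'a::linordered_idom. if x = s then 1 else 0))"
proof (rule tnI)
  fix n :: nat and x y
  assume x: "\<And>i j. i < j \<Longrightarrow> j < n \<Longrightarrow> x i < (x j :: 'a)"
    and y: "\<And>i j. i < j \<Longrightarrow> j < n \<Longrightarrow> y i < (y j :: 'a)"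
  have "0 \<le> fdet n (\<lambda>i j. if i < n \<and> j < n \<and> x i - y j = s then 1 else 0)"
  proof (rule fdet_monotone_matching_nonneg)
    fix i j i' j'
    assume 1: "i < n \<and> j < n \<and> x i - y j = s" "i' < n \<and> j' < n \<and> x i' - y j' = s" "i < i'"
    then have "y j < y j'" using x[of i i'] by (auto simp: algebra_simps)
    then show "j < j'" using y[of j' j] 1 by (metis less_asym linorder_neqE_nat order_less_irrefl)
  qed
  also have "\<dots> = fdet n (\<lambda>i j. toeplitz (\<lambda>x. if x = s then 1 else 0) (x i) (y j))"
    by (rule fdet_cong) (simp add: toeplitz_def)
  finally show "0 \<le> fdet n (\<lambda>i j. toeplitz (\<lambda>x. if x = s then 1 else 0) (x i) (y j))" .
qed

lemma tn_geometric_seq: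
  assumes "0 \<le> \<alpha>"
  shows "tn (toeplitz (\<lambda>k::int. if 0 \<le> k then \<alpha> ^ nat k else 0))"
proof (rule tn_geometric_convolution[OF tn_toeplitz_point[of 0] assms])
  fix k :: int
  show "(if 0 \<le> k then \<alpha> ^ nat k else 0)
      = \<alpha> * (if 0 \<le> k - 1 then \<alpha> ^ nat (k - 1) else 0) + (if k = 0 then 1 else 0)"
    by (cases "k \<le> 0") (auto simp: nat_diff_distrib Suc_diff_Suc simp flip: power_Suc)
qed auto

text \<open>A geometric sequence convolved with the constant sequence 1 on the non-negative
  integers: the discrete form of 1 - exp (-x).\<close>

lemma tn_seq_one_minus_power:
  assumes "0 \<le> \<beta>" "\<beta> \<le> 1"
  shows "tn (toeplitz (\<lambda>k::int. if 0 \<le> k then 1 - \<beta> ^ (nat k + 1) else 0))"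
proof -
  have "tn (toeplitz (\<lambda>k::int. (1 - \<beta>) * (if 0 \<le> k then \<beta> ^ nat k else 0)))"
    using tn_cmult[OF tn_geometric_seq[OF assms(1)], of "1 - \<beta>"] assms by (simp add: toeplitz_def)
  then show ?thesis
  proof (rule tn_geometric_convolution[where \<alpha> = 1])
    fix k :: int
    consider "k < 0" | "k = 0" | m where "k = int (Suc m)"
      by (metis not_less_iff_gr_or_eq zero_less_imp_eq_int gr0_implies_Suc)
    then show "(if 0 \<le> k then 1 - \<beta> ^ (nat k + 1) else 0)
        = 1 * (if 0 \<le> k - 1 then 1 - \<beta> ^ (nat (k - 1) + 1) else 0)
          + (1 - \<beta>) * (if 0 \<le> k then \<beta> ^ nat k else 0)"
      by cases (auto simp: nat_add_distrib algebra_simps)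
  qed auto
qed

text \<open>Convolution of geometric sequences with ratios \<gamma>, \<beta> and 1. The relation
  \<open>rel\<close> is satisfied by \<beta> = 1 - 2/N and \<gamma> = 1 - 3/N. It makes 1 - 3
  \<beta>^j + 2 \<gamma>^j vanish at j = 0 and j = 1, the discrete counterpart of a double zero at
  the origin; hence the exponents start at 2.\<close>

lemma tn_seq_two_powers:
  assumes "0 \<le> \<gamma>" "\<gamma> \<le> \<beta>" "\<beta> \<le> 1" and rel: "3 * \<beta> = 1 + 2 * \<gamma>"
  shows "tn (toeplitz (\<lambda>k::int. if 0 \<le> k then 1 - 3 * \<beta> ^ (nat k + 2) + 2 * \<gamma> ^ (nat k + 2) else 0))"
proof -
  have cases: "thesis" if "k < 0 \<Longrightarrow> thesis" "k = 0 \<Longrightarrow> thesis" "\<And>m. k = int (Suc m) \<Longrightarrow> thesis"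
    for k :: int and thesis
    using that by (metis not_less_iff_gr_or_eq zero_less_imp_eq_int gr0_implies_Suc)
  have "tn (toeplitz (\<lambda>k::int. (\<beta> - \<gamma>) * (if 0 \<le> k then \<gamma> ^ nat k else 0)))"
    using tn_cmult[OF tn_geometric_seq[OF assms(1)], of "\<beta> - \<gamma>"] assms by (simp add: toeplitz_def)
  then have "tn (toeplitz (\<lambda>k::int. if 0 \<le> k then \<beta> ^ (nat k + 1) - \<gamma> ^ (nat k + 1) else 0))"
  proof (rule tn_geometric_convolution[where \<alpha> = \<beta>])
    fix k :: int
    show "(if 0 \<le> k then \<beta> ^ (nat k + 1) - \<gamma> ^ (nat k + 1) else 0)
        = \<beta> * (if 0 \<le> k - 1 then \<beta> ^ (nat (k - 1) + 1) - \<gamma> ^ (nat (k - 1) + 1) else 0)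
          + (\<beta> - \<gamma>) * (if 0 \<le> k then \<gamma> ^ nat k else 0)"
      by (rule cases[of k]) (auto simp: nat_add_distrib algebra_simps)
  qed (use assms in auto)
  from tn_cmult[OF this, of "3 * (1 - \<beta>)"] assms
  have "tn (toeplitz (\<lambda>k::int. 3 * (1 - \<beta>) * (if 0 \<le> k then \<beta> ^ (nat k + 1) - \<gamma> ^ (nat k + 1) else 0)))"
    by (simp add: toeplitz_def)
  then show ?thesis
  proof (rule tn_geometric_convolution[where \<alpha> = 1])
    fix k :: int
    have \<beta>: "\<beta> = (1 + 2 * \<gamma>) / 3" using rel by simp
    have e: "3 * (1 - \<beta>) = 2 * (1 - \<gamma>)" using rel by simp
    have step: "3 * \<beta> ^ (m + 2) = 3 * \<beta> ^ (m + 3) + 3 * (1 - \<beta>) * \<beta> ^ (m + 2)"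
      "2 * \<gamma> ^ (m + 2) = 2 * \<gamma> ^ (m + 3) + 3 * (1 - \<beta>) * \<gamma> ^ (m + 2)" for m
      by (simp add: algebra_simps eval_nat_numeral) (simp only: e, simp add: algebra_simps eval_nat_numeral)
    have start: "1 - 3 * \<beta>\<^sup>2 + 2 * \<gamma>\<^sup>2 = 3 * (1 - \<beta>) * (\<beta> - \<gamma>)"
      unfolding \<beta> by (simp add: field_simps power2_eq_square)
    show "(if 0 \<le> k then 1 - 3 * \<beta> ^ (nat k + 2) + 2 * \<gamma> ^ (nat k + 2) else 0)
        = 1 * (if 0 \<le> k - 1 then 1 - 3 * \<beta> ^ (nat (k - 1) + 2) + 2 * \<gamma> ^ (nat (k - 1) + 2) else 0)
          + 3 * (1 - \<beta>) * (if 0 \<le> k then \<beta> ^ (nat k + 1) - \<gamma> ^ (nat k + 1) else 0)"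
    proof (rule cases[of k])
      assume "k = 0"
      then show ?thesis using start by (simp add: power2_eq_square)
    next
      fix m assume k: "k = int (Suc m)"
      show ?thesis using step[of m] unfolding k
        by (simp add: nat_add_distrib eval_nat_numeral right_diff_distrib)
    qed auto
  qed auto
qed

section \<open>From the integers to the real line by rescaled floors\<close>

lemma floor_scale_tendsto:
  "(\<lambda>m. (of_int (\<lfloor>real (m + 3) * x\<rfloor> - \<lfloor>real (m + 3) * y\<rfloor>)) / real (m + 3)) \<longlonglongrightarrow> x - y"
proof -
  have bounds: "x - 1 / N \<le> of_int \<lfloor>N * x\<rfloor> / N \<and> of_int \<lfloor>N * x\<rfloor> / N \<le> x" if "0 < N" for N x :: real
  proof -
    have "N * x - 1 \<le> of_int \<lfloor>N * x\<rfloor>" "of_int \<lfloor>N * x\<rfloor> \<le> N * x" by linarith+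
    then have "(N * x - 1) / N \<le> of_int \<lfloor>N * x\<rfloor> / N" "of_int \<lfloor>N * x\<rfloor> / N \<le> N * x / N"
      using that by (intro divide_right_mono; simp)+
    with that show ?thesis by (simp add: diff_divide_distrib)
  qed
  have *: "(\<lambda>m. of_int \<lfloor>real (m + 3) * x\<rfloor> / real (m + 3)) \<longlonglongrightarrow> x" for x :: real
  proof (rule tendsto_sandwich)
    show "\<forall>\<^sub>F m in sequentially. x - 1 / real (m + 3) \<le> of_int \<lfloor>real (m + 3) * x\<rfloor> / real (m + 3)"
      "\<forall>\<^sub>F m in sequentially. of_int \<lfloor>real (m + 3) * x\<rfloor> / real (m + 3) \<le> x"
      using bounds[of "real (_ + 3)" x] by (auto intro!: always_eventually simp del: of_nat_add)
    show "(\<lambda>m. x - 1 / real (m + 3)) \<longlonglongrightarrow> x" by real_asymp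
  qed auto
  show ?thesis using tendsto_diff[OF *[of x] *[of y]] by (simp add: diff_divide_distrib)
qed

text \<open>The offset \<open>r\<close> covers the shifted exponents of the discrete formulas;
  divided by the scale it disappears in the limit.\<close>

lemma exp_limit_floor:
  assumes "0 \<le> b" "y \<le> x"
  shows "(\<lambda>m. (1 - b / real (m + 3)) ^ (nat (\<lfloor>real (m + 3) * x\<rfloor> - \<lfloor>real (m + 3) * y\<rfloor>) + r))
    \<longlonglongrightarrow> exp (- b * (x - y))"
proof (rule Lim_transform_eventually)
  define k where "k m = \<lfloor>real (m + 3) * x\<rfloor> - \<lfloor>real (m + 3) * y\<rfloor>" for m :: nat
  have k0: "0 \<le> k m" for m using assms(2) by (simp add: k_def floor_mono mult_left_mono)
  have "(\<lambda>m. real (m + 3) * ln (1 - b / real (m + 3))) \<longlonglongrightarrow> - b" by real_asymp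
  moreover have "(\<lambda>m. of_int (k m) / real (m + 3) + real r / real (m + 3)) \<longlonglongrightarrow> (x - y) + 0"
    unfolding k_def by (intro tendsto_add floor_scale_tendsto) real_asymp
  ultimately have "(\<lambda>m. exp ((real (m + 3) * ln (1 - b / real (m + 3)))
      * (of_int (k m) / real (m + 3) + real r / real (m + 3)))) \<longlonglongrightarrow> exp (- b * (x - y + 0))"
    by (intro tendsto_exp tendsto_mult)
  then show "(\<lambda>m. exp ((real (m + 3) * ln (1 - b / real (m + 3)))
      * (of_int (k m) / real (m + 3) + real r / real (m + 3)))) \<longlonglongrightarrow> exp (- b * (x - y))"
    by simp
  have "\<forall>\<^sub>F m in sequentially. b < real (m + 3)" by real_asymp
  then show "\<forall>\<^sub>F m in sequentially. exp ((real (m + 3) * ln (1 - b / real (m + 3)))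
      * (of_int (k m) / real (m + 3) + real r / real (m + 3)))
    = (1 - b / real (m + 3)) ^ (nat (k m) + r)"
  proof eventually_elim
    case (elim m)
    then have pos: "0 < 1 - b / real (m + 3)" by simp
    have "(real (m + 3) * ln (1 - b / real (m + 3))) * (of_int (k m) / real (m + 3) + real r / real (m + 3))
        = real (nat (k m) + r) * ln (1 - b / real (m + 3))"
    proof -
      have "(N * l) * (k / N + r / N) = (k + r) * l" if "0 < N" for N l k r :: real
        using that by (simp add: field_simps)
      from this[of "real (m + 3)"] show ?thesis using k0[of m] by (simp del: of_nat_add) simp
    qed
    then show ?case using pos by (simp only: exp_of_nat_mult exp_ln)
  qed
qed

text \<open>Rescaled floors are monotone, so sequences pull back to totally non-negative kernels on
  the line, and minors pass to pointwise limits. For x < y the difference of floors is eventually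
  negative, hence outside the support. The scale starts at 3 to keep 1 - 3/N non-negative in the
  application.\<close>

lemma tn_toeplitz_floor_limit:
  assumes "\<And>m. tn (toeplitz (g m))" "\<And>m k. k < 0 \<Longrightarrow> g m k = 0" "\<And>t. t < 0 \<Longrightarrow> L t = 0"
    and "\<And>x y. y \<le> x \<Longrightarrow> (\<lambda>m. g m (\<lfloor>real (m + 3) * x\<rfloor> - \<lfloor>real (m + 3) * y\<rfloor>)) \<longlonglongrightarrow> L (x - y)"
  shows "tn (toeplitz (L :: real \<Rightarrow> real))"
proof (rule tn_limit)
  fix m :: nat
  show "tn (\<lambda>x y. toeplitz (g m) \<lfloor>real (m + 3) * x\<rfloor> \<lfloor>real (m + 3) * y\<rfloor>)"
    by (intro tn_comp_mono[OF assms(1)] monoI floor_mono mult_left_mono) auto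
next
  fix x y :: real
  show "(\<lambda>m. toeplitz (g m) \<lfloor>real (m + 3) * x\<rfloor> \<lfloor>real (m + 3) * y\<rfloor>) \<longlonglongrightarrow> toeplitz L x y"
  proof (cases "y \<le> x")
    case False
    have "\<forall>\<^sub>F m in sequentially. 1 < real (m + 3) * (y - x)" using False by real_asymp
    then have "\<forall>\<^sub>F m in sequentially. 0 = toeplitz (g m) \<lfloor>real (m + 3) * x\<rfloor> \<lfloor>real (m + 3) * y\<rfloor>"
    proof eventually_elim
      case (elim m)
      then have "\<lfloor>real (m + 3) * x\<rfloor> < \<lfloor>real (m + 3) * y\<rfloor>"
        by (simp only: right_diff_distrib) linarith
      then show ?case by (simp add: toeplitz_def assms(2))
    qed
    then show ?thesis
      using False by (intro Lim_transform_eventually[OF tendsto_const]) (simp add: toeplitz_def assms(3))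
  next
    case True
    then show ?thesis unfolding toeplitz_def by (rule assms(4))
  qed
qed

lemma tn_step: "tn (toeplitz (\<lambda>x::real. if 0 \<le> x then 1 else 0))"
  by (rule tn_toeplitz_floor_limit[of "\<lambda>_ k. if 0 \<le> k then 1 ^ nat k else 0"], rule tn_geometric_seq)
     (auto simp: floor_mono)

lemma tn_one_minus_exp: "tn (toeplitz (\<lambda>x::real. if 0 \<le> x then 1 - exp (- x) else 0))"
proof (rule tn_toeplitz_floor_limit)
  fix m :: nat
  show "tn (toeplitz (\<lambda>k::int. if 0 \<le> k then 1 - (1 - 1 / real (m + 3)) ^ (nat k + 1) else 0))"
    by (rule tn_seq_one_minus_power) auto
next
  fix x y :: real assume xy: "y \<le> x"
  have "(\<lambda>m. 1 - (1 - 1 / real (m + 3)) ^ (nat (\<lfloor>real (m + 3) * x\<rfloor> - \<lfloor>real (m + 3) * y\<rfloor>) + 1))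
      \<longlonglongrightarrow> 1 - exp (- 1 * (x - y))"
    by (intro tendsto_diff tendsto_const exp_limit_floor xy) auto
  then show "(\<lambda>m. if 0 \<le> \<lfloor>real (m + 3) * x\<rfloor> - \<lfloor>real (m + 3) * y\<rfloor> then 1 - (1 - 1 / real (m + 3))
      ^ (nat (\<lfloor>real (m + 3) * x\<rfloor> - \<lfloor>real (m + 3) * y\<rfloor>) + 1) else 0)
      \<longlonglongrightarrow> (if 0 \<le> x - y then 1 - exp (- (x - y)) else 0)"
    using xy by (simp add: floor_mono mult_left_mono)
qed auto

text \<open>Up to scaling this is the convolution of \<open>1\<close>, \<open>exp (- 2 * x)\<close> and \<open>exp (- 3 * x)\<close> on the half-line.
  It matters below that the exponents satisfy \<open>2 < 3 < 2 * 2\<close>: the quadratic part of \<open>F\<close> at \<open>c\<close> enters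
  \<open>F (c * (1 - 3 * exp (- 2 * x) + 2 * exp (- 3 * x)))\<close> only at order \<open>exp (- 4 * x)\<close>.\<close>

lemma tn_two_exps:
  "tn (toeplitz (\<lambda>x::real. if 0 \<le> x then 1 - 3 * exp (- 2 * x) + 2 * exp (- 3 * x) else 0))"
proof (rule tn_toeplitz_floor_limit)
  fix m :: nat
  show "tn (toeplitz (\<lambda>k::int. if 0 \<le> k then 1 - 3 * (1 - 2 / real (m + 3)) ^ (nat k + 2)
      + 2 * (1 - 3 / real (m + 3)) ^ (nat k + 2) else 0))"
    by (rule tn_seq_two_powers) (auto simp: field_simps)
next
  fix x y :: real assume xy: "y \<le> x"
  have "(\<lambda>m. 1 - 3 * (1 - 2 / real (m + 3)) ^ (nat (\<lfloor>real (m + 3) * x\<rfloor> - \<lfloor>real (m + 3) * y\<rfloor>) + 2)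
      + 2 * (1 - 3 / real (m + 3)) ^ (nat (\<lfloor>real (m + 3) * x\<rfloor> - \<lfloor>real (m + 3) * y\<rfloor>) + 2))
      \<longlonglongrightarrow> 1 - 3 * exp (- 2 * (x - y)) + 2 * exp (- 3 * (x - y))"
    by (intro tendsto_diff tendsto_add tendsto_mult tendsto_const exp_limit_floor xy) auto
  then show "(\<lambda>m. if 0 \<le> \<lfloor>real (m + 3) * x\<rfloor> - \<lfloor>real (m + 3) * y\<rfloor> then
      1 - 3 * (1 - 2 / real (m + 3)) ^ (nat (\<lfloor>real (m + 3) * x\<rfloor> - \<lfloor>real (m + 3) * y\<rfloor>) + 2)
      + 2 * (1 - 3 / real (m + 3)) ^ (nat (\<lfloor>real (m + 3) * x\<rfloor> - \<lfloor>real (m + 3) * y\<rfloor>) + 2) else 0)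
      \<longlonglongrightarrow> (if 0 \<le> x - y then 1 - 3 * exp (- 2 * (x - y)) + 2 * exp (- 3 * (x - y)) else 0)"
    using xy by (simp add: floor_mono mult_left_mono)
qed auto

section \<open>Integrable frequency functions by exponential damping\<close>

lemma integrable_exp_half_line:
  assumes "0 < (a::real)"
  shows "integrable lebesgue (\<lambda>x. indicator {0..} x * exp (- a * x))"
proof -
  have "(\<lambda>x. exp (- a * x)) absolutely_integrable_on {0..}"
    by (intro nonnegative_absolutely_integrable_1 integrable_on_exp_minus_to_infinity assms) auto
  then show ?thesis by (simp add: set_integrable_def)
qed

text \<open>Boundedness together with damping on a half-line gives integrability, while the
  exponential factor splits over rows and columns and does not affect total non-negativity. Since
  \<epsilon> is arbitrary, \<open>l\<close> itself can be approached.\<close>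

lemma pff_damped:
  assumes tn: "tn (toeplitz l)" and l0: "\<And>x. x < 0 \<Longrightarrow> l x = 0" and pos: "\<And>x. 0 < x \<Longrightarrow> 0 < l x"
    and le1: "\<And>x. l x \<le> 1" and meas: "l \<in> borel_measurable borel" and "0 < \<epsilon>" "0 < c"
  shows "polya_frequency_function (\<lambda>x. c * (exp (- \<epsilon> * x) * l x))"
    and "one_sided (\<lambda>x. c * (exp (- \<epsilon> * x) * l x))"
proof -
  have nonneg: "0 \<le> l x" for x using tn_nonneg[OF tn, of x 0] by (simp add: toeplitz_def)
  show "one_sided (\<lambda>x. c * (exp (- \<epsilon> * x) * l x))"
    unfolding one_sided_def using l0 by auto
  have "integrable lebesgue (\<lambda>x. c * (exp (- \<epsilon> * x) * l x))"
  proof (rule Bochner_Integration.integrable_bound)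
    show "integrable lebesgue (\<lambda>x. c * (indicator {0..} x * exp (- \<epsilon> * x)))"
      using integrable_exp_half_line[OF \<open>0 < \<epsilon>\<close>] by simp
    have "(\<lambda>x. c * (exp (- \<epsilon> * x) * l x)) \<in> borel_measurable borel"
      using meas by measurable
    then show "(\<lambda>x. c * (exp (- \<epsilon> * x) * l x)) \<in> borel_measurable lebesgue"
      by (intro measurable_completion) simp
    show "AE x in lebesgue. norm (c * (exp (- \<epsilon> * x) * l x))
        \<le> norm (c * (indicator {0..} x * exp (- \<epsilon> * x)))"
      using nonneg le1 l0 \<open>0 < c\<close>
      by (auto simp: indicator_def abs_mult not_le intro!: mult_left_le)
  qed
  moreover have "tn (toeplitz (\<lambda>x. c * (exp (- \<epsilon> * x) * l x)))"
    using tn_cmult[OF tn_toeplitz_twist[OF tn, of "- \<epsilon>"], of c] \<open>0 < c\<close> by (simp add: toeplitz_def)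
  moreover have "\<exists>x y. x \<noteq> y \<and> c * (exp (- \<epsilon> * x) * l x) \<noteq> 0 \<and> c * (exp (- \<epsilon> * y) * l y) \<noteq> 0"
    using pos[of 1] pos[of 2] \<open>0 < c\<close> by (intro exI[of _ 1] exI[of _ 2]) auto
  ultimately show "polya_frequency_function (\<lambda>x. c * (exp (- \<epsilon> * x) * l x))"
    unfolding polya_frequency_function_def using nonneg \<open>0 < c\<close> by auto
qed

lemma two_exps_factor:
  "1 - 3 * exp (- 2 * x) + 2 * exp (- 3 * x) = (1 - exp (- x))\<^sup>2 * (1 + 2 * exp (- x :: real))"
proof -
  have "exp (- 2 * x) = exp (- x) ^ 2" "exp (- 3 * x) = exp (- x) ^ 3"
    by (simp_all flip: exp_of_nat_mult)
  then show ?thesis by (simp only:) (simp add: algebra_simps power2_eq_square power3_eq_cube)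
qed

lemma pff_exp:
  assumes "0 < (c::real)"
  shows "polya_frequency_function (\<lambda>x. c * (exp (- 1 * x) * (if 0 \<le> x then 1 else 0)))"
    and "one_sided (\<lambda>x. c * (exp (- 1 * x) * (if 0 \<le> x then 1 else 0)))"
  using assms by (intro pff_damped tn_step; simp)+

lemma pff_one_minus_exp:
  assumes "0 < (c::real)" "0 < \<epsilon>"
  shows "polya_frequency_function (\<lambda>x. c * (exp (- \<epsilon> * x) * (if 0 \<le> x then 1 - exp (- x) else 0)))"
    and "one_sided (\<lambda>x. c * (exp (- \<epsilon> * x) * (if 0 \<le> x then 1 - exp (- x) else 0)))"
  using assms by (intro pff_damped tn_one_minus_exp; simp)+

lemma pff_two_exps:
  assumes "0 < (c::real)" "0 < \<epsilon>"
  shows "polya_frequency_function (\<lambda>x. c * (exp (- \<epsilon> * x) *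
      (if 0 \<le> x then 1 - 3 * exp (- 2 * x) + 2 * exp (- 3 * x) else 0)))"
    and "one_sided (\<lambda>x. c * (exp (- \<epsilon> * x) *
      (if 0 \<le> x then 1 - 3 * exp (- 2 * x) + 2 * exp (- 3 * x) else 0)))"
proof -
  have "1 - 3 * exp (- 2 * x) + 2 * exp (- 3 * x) \<le> 1" if "0 \<le> x" for x :: real
  proof -
    have "exp (- 3 * x) \<le> exp (- 2 * x)" using that by simp
    moreover have "0 \<le> exp (- 2 * x)" by simp
    ultimately show ?thesis by linarith
  qed
  moreover have "0 < 1 - 3 * exp (- 2 * x) + 2 * exp (- 3 * x)" if "0 < x" for x :: real
    unfolding two_exps_factor using that by (intro mult_pos_pos add_pos_pos) auto
  ultimately have *: "x \<in> {0..} \<Longrightarrow> 1 - 3 * exp (- 2 * x) + 2 * exp (- 3 * x) \<le> 1"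
    "x \<in> {0<..} \<Longrightarrow> 0 < 1 - 3 * exp (- 2 * x) + 2 * exp (- 3 * x)" for x :: real by auto
  show "polya_frequency_function (\<lambda>x. c * (exp (- \<epsilon> * x) *
      (if 0 \<le> x then 1 - 3 * exp (- 2 * x) + 2 * exp (- 3 * x) else 0)))"
    by (rule pff_damped(1)[OF tn_two_exps]) (use assms * in auto)
  show "one_sided (\<lambda>x. c * (exp (- \<epsilon> * x) *
      (if 0 \<le> x then 1 - 3 * exp (- 2 * x) + 2 * exp (- 3 * x) else 0)))"
    by (rule pff_damped(2)[OF tn_two_exps]) (use assms * in auto)
qed

section \<open>Finite totally non-negative sequences have real-rooted generating polynomials\<close>

lemma sum_skip:
  fixes g :: "nat \<Rightarrow> real"
  assumes "l < Suc s" "g l = 0"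
  shows "(\<Sum>j<Suc s. g j) = (\<Sum>j<s. g (if j < l then j else Suc j))"
proof -
  have "(\<Sum>j<Suc s. g j) = (\<Sum>j\<in>{..<Suc s} - {l}. g j)"
    using assms by (intro sum.mono_neutral_right) auto
  also have "\<dots> = (\<Sum>j<s. g (if j < l then j else Suc j))"
    by (rule sum.reindex_bij_witness[of _ "\<lambda>j. if j < l then j else Suc j" "\<lambda>j. if j < l then j else j - 1"])
       (use assms in auto)
  finally show ?thesis .
qed

text \<open>Appending the image as an extra column gives a singular matrix, whose expansion along that
  column has terms of one sign only. Hence the top minor vanishes, and a kernel vector of it can be
  used to remove one column.\<close>

lemma tn_variation_diminishing:
  fixes B :: "nat \<Rightarrow> nat \<Rightarrow> real"
  assumes "tn B" "\<And>i. i \<le> s \<Longrightarrow> 0 < (-1) ^ i * (\<Sum>j<s. B i j * c j)"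
  shows False
  using assms
proof (induction s arbitrary: B c)
  case 0
  from 0(2)[of 0] show False by simp
next
  case (Suc s)
  define y where "y i = (\<Sum>j<Suc s. B i j * c j)" for i
  define D where "D i = fdet (Suc s) (\<lambda>a b. B (if a < i then a else Suc a) b)" for i
  have D: "0 \<le> D i" for i
    unfolding D_def by (rule tnD[OF Suc.prems(1)]) auto
  have zero: "(\<Sum>i<Suc (Suc s). B i j * ((-1) ^ i * D i)) = 0" if "j < Suc s" for j
  proof -
    have "fdet (Suc (Suc s)) (\<lambda>a b. B a (if b = 0 then j else b - 1)) = 0"
      by (rule fdet_identical_cols[of 0 _ "Suc j"]) (use that in auto)
    then show ?thesis by (subst (asm) fdet_laplace_col[of 0]) (simp_all add: D_def)
  qed
  have "(\<Sum>i<Suc (Suc s). (-1) ^ i * y i * D i) = (\<Sum>j<Suc s. c j * (\<Sum>i<Suc (Suc s). B i j * ((-1) ^ i * D i)))"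
    unfolding y_def sum_distrib_left sum_distrib_right
    by (subst sum.swap) (intro sum.cong refl, simp add: mult_ac)
  also have "\<dots> = 0" using zero by (intro sum.neutral) simp
  finally have "\<forall>i\<in>{..<Suc (Suc s)}. (-1) ^ i * y i * D i = 0"
    using Suc.prems(2) D by (subst (asm) sum_nonneg_eq_0_iff) (auto simp: y_def less_imp_le)
  moreover have "(-1) ^ Suc s * y (Suc s) \<noteq> 0"
    using Suc.prems(2)[of "Suc s"] unfolding y_def by (metis le_refl less_irrefl)
  ultimately have "D (Suc s) = 0" by (metis lessI lessThan_iff mult_eq_0_iff)
  then have "fdet (Suc s) B = 0"
    unfolding D_def by (subst fdet_cong[of _ _ "\<lambda>a b. B (if a < Suc s then a else Suc a) b"]) auto
  then obtain v where v: "v \<in> carrier_vec (Suc s)" "v \<noteq> 0\<^sub>v (Suc s)"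
      "Matrix.mat (Suc s) (Suc s) (\<lambda>(i, j). B i j) *\<^sub>v v = 0\<^sub>v (Suc s)"
    unfolding fdet_def by (subst (asm) det_0_iff_vec_prod_zero[of _ "Suc s"]) auto
  then obtain l where l: "l < Suc s" "v $ l \<noteq> 0"
    by (metis eq_vecI carrier_vecD index_zero_vec)
  have ker: "(\<Sum>j<Suc s. B i j * v $ j) = 0" if "i < Suc s" for i
  proof -
    have "(\<Sum>j<Suc s. B i j * v $ j) = (Matrix.mat (Suc s) (Suc s) (\<lambda>(i, j). B i j) *\<^sub>v v) $ i"
      using that v(1) by (auto simp: scalar_prod_def atLeast0LessThan simp del: sum.lessThan_Suc intro!: sum.cong)
    then show ?thesis using v(3) that by simp
  qed
  \<comment> \<open>Coordinate \<open>l\<close> becomes 0. The kernel vector is annihilated by the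
    rows 0 to s, which are exactly the s + 1 rows that the induction hypothesis for s columns speaks
    about.\<close>
  define c' where "c' j = c j - c l / v $ l * v $ j" for j
  define skip where "skip j = (if j < l then j else Suc j)" for j
  show False
  proof (rule Suc.IH[of "\<lambda>i j. B i (skip j)" "\<lambda>j. c' (skip j)"])
    show "tn (\<lambda>i j. B i (skip j))"
      using tn_comp_mono[OF Suc.prems(1), of "\<lambda>x. x" skip] by (simp add: mono_def skip_def)
    fix i assume i: "i \<le> s"
    have "y i = (\<Sum>j<Suc s. B i j * c j) - c l / v $ l * (\<Sum>j<Suc s. B i j * v $ j)"
      using ker[of i] i by (simp add: y_def)
    also have "\<dots> = (\<Sum>j<Suc s. B i j * c' j)"
      by (simp only: c'_def sum_distrib_left sum_subtractf[symmetric]) (simp add: algebra_simps)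
    also have "\<dots> = (\<Sum>j<s. B i (skip j) * c' (skip j))"
      unfolding skip_def using l by (intro sum_skip) (auto simp: c'_def)
    finally show "0 < (-1) ^ i * (\<Sum>j<s. B i (skip j) * c' (skip j))"
      using Suc.prems(2)[of i] i by (simp add: y_def)
  qed
qed

text \<open>An input with s sign blocks cannot produce s + 1 alternating outputs. Adding up the
  columns of each block with weights \<open>\<bar>x j\<bar>\<close> gives a kernel \<open>B\<close>
  that is totally non-negative because the blocks follow one another, and turns the input into the
  vector of alternating signs.\<close>

lemma tn_toeplitz_sign_changes:
  fixes a :: "int \<Rightarrow> real" and x :: "nat \<Rightarrow> real" and \<beta> :: "nat \<Rightarrow> nat" and r :: "nat \<Rightarrow> int"
  assumes "tn (toeplitz a)" "mono \<beta>" "strict_mono r"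
    and \<beta>: "\<And>j. j < n \<Longrightarrow> \<beta> j < s" and sign: "\<And>j. j < n \<Longrightarrow> 0 \<le> (-1) ^ \<beta> j * x j"
    and out: "\<And>i. i \<le> s \<Longrightarrow> 0 < (-1) ^ i * (\<Sum>j<n. a (r i - int j) * x j)"
  shows False
proof -
  define T where "T l = {j. j < n \<and> \<beta> j = l}" for l
  have finT: "finite (T l)" for l by (simp add: T_def)
  define B where "B i l = (\<Sum>j\<in>T l. \<bar>x j\<bar> * a (r i - int j))" for i l
  have "tn B"
  proof (rule tnI)
    fix N :: nat and p q
    assume p: "\<And>i j. i < j \<Longrightarrow> j < N \<Longrightarrow> p i < (p j :: nat)" and q: "\<And>i j. i < j \<Longrightarrow> j < N \<Longrightarrow> q i < (q j :: nat)"
    \<comment> \<open>Here columns are added up, so \<open>tn_row_sum\<close> is applied to the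
      transposed kernel.\<close>
    have K: "tn (\<lambda>t u. toeplitz a (r u) (int t))"
      using tn_comp_mono[OF tn_transpose[OF assms(1)], of int r] assms(3)
      by (simp add: mono_def strict_mono_less_eq)
    have "0 \<le> fdet N (\<lambda>i j. \<Sum>t\<in>T (q i). \<bar>x t\<bar> * toeplitz a (r (p j)) (int t))"
    proof (rule tn_row_sum[OF K, where T = "\<lambda>i. T (q i)" and w = "\<lambda>_ t. \<bar>x t\<bar>" and y = p])
      fix i j u t assume "i < j" "j < N" "u \<in> T (q i)" "t \<in> T (q j)"
      then have "\<beta> u < \<beta> t" using q[of i j] by (simp add: T_def)
      then show "u \<le> t" using monoD[OF assms(2), of t u] by (meson leD le_cases)
    qed (use p finT in auto)
    also have "\<dots> = fdet N (\<lambda>i j. B (p j) (q i))"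
      by (simp add: B_def toeplitz_def)
    also have "\<dots> = fdet N (\<lambda>i j. B (p i) (q j))" by (rule fdet_transpose)
    finally show "0 \<le> fdet N (\<lambda>i j. B (p i) (q j))" .
  qed
  moreover have "(\<Sum>l<s. B i l * (-1) ^ l) = (\<Sum>j<n. a (r i - int j) * x j)" for i
  proof -
    have "(\<Sum>j<n. a (r i - int j) * x j) = (\<Sum>l<s. \<Sum>j | j \<in> {..<n} \<and> \<beta> j = l. a (r i - int j) * x j)"
      by (rule sum.group[symmetric]) (use \<beta> in auto)
    also have "\<dots> = (\<Sum>l<s. B i l * (-1) ^ l)"
      unfolding B_def sum_distrib_right
    proof (intro sum.cong)
      fix l j assume "j \<in> T l"
      then have "0 \<le> (-1) ^ l * x j" using sign[of j] by (auto simp: T_def)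
      then have "x j = (-1) ^ l * \<bar>x j\<bar>" by (cases "even l") auto
      then show "a (r i - int j) * x j = \<bar>x j\<bar> * a (r i - int j) * (-1) ^ l" by (simp add: mult_ac)
    qed (auto simp: T_def)
    finally show ?thesis ..
  qed
  ultimately show False
    using tn_variation_diminishing[of B s "\<lambda>l. (-1) ^ l"] out by simp
qed

lemma sin_plus_nat_pi: "sin (real j * pi + t) = (-1) ^ j * sin t"
  by (induction j) (simp_all add: algebra_simps sin_add)

text \<open>If \<open>e\<^bsup>-i\<theta>\<^esup>\<close> is a root, then a large multiple of a sinusoid of frequency \<open>\<theta>\<close> is annihilated by
  the convolution, so that adding a small sinusoid of frequency \<open>\<theta>' > \<theta>\<close> gives an input whose output
  oscillates faster than the input does.\<close>

lemma tn_polynomial_no_unimodular_root: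
  fixes a :: "int \<Rightarrow> real" and m :: nat
  defines "Q \<equiv> \<lambda>t. \<Sum>k\<le>m. of_real (a (int k)) * cis (- (real k * t))"
  assumes tn: "tn (toeplitz a)" and supp: "\<And>k. k < 0 \<Longrightarrow> a k = 0" "\<And>k. int m < k \<Longrightarrow> a k = 0"
    and \<theta>: "0 < \<theta>" "\<theta> < \<theta>'" "\<theta>' < pi" and root: "Q \<theta> = 0" and nonroot: "Q \<theta>' \<noteq> 0"
  shows False
proof -
  \<comment> \<open>Only countably many phases make some sin (k \<theta> + \<phi>) vanish; \<phi> is
    taken outside of them, so that every sample has a definite sign.\<close>
  have "countable ((\<lambda>(j, k). real_of_int j * pi - real k * \<theta>) ` (UNIV :: (int \<times> nat) set))" by simp
  moreover have "uncountable {0<..<pi}" by (simp add: uncountable_open_interval)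
  ultimately obtain \<phi> where \<phi>: "0 < \<phi>" "\<phi> < pi" "\<phi> \<notin> range (\<lambda>(j, k). real_of_int j * pi - real k * \<theta>)"
    by (metis countable_subset greaterThanLessThan_iff subsetI)
  define \<beta> where "\<beta> k = nat \<lfloor>(real k * \<theta> + \<phi>) / pi\<rfloor>" for k :: nat
  have \<beta>_real: "real (\<beta> k) = of_int \<lfloor>(real k * \<theta> + \<phi>) / pi\<rfloor>" for k
    using \<theta> \<phi> by (simp add: \<beta>_def)
  have sin_pos: "0 < (-1) ^ \<beta> k * sin (real k * \<theta> + \<phi>)" for k
  proof -
    define t where "t = real k * \<theta> + \<phi> - real (\<beta> k) * pi"
    have "real (\<beta> k) \<le> (real k * \<theta> + \<phi>) / pi" "(real k * \<theta> + \<phi>) / pi < real (\<beta> k) + 1"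
      unfolding \<beta>_real by linarith+
    then have "0 \<le> t" "t < pi" by (simp_all add: t_def field_simps)
    moreover have "t \<noteq> 0"
    proof
      assume "t = 0"
      then have "\<phi> = (\<lambda>(j, k). real_of_int j * pi - real k * \<theta>) (int (\<beta> k), k)" by (simp add: t_def)
      then show False using \<phi>(3) by blast
    qed
    ultimately have "0 < sin t" by (intro sin_gt_zero) auto
    moreover have "sin (real k * \<theta> + \<phi>) = (-1) ^ \<beta> k * sin t"
      using sin_plus_nat_pi[of "\<beta> k" t] by (simp add: t_def)
    ultimately show ?thesis by (simp flip: mult.assoc power_add)
  qed
  \<comment> \<open>Convolution with \<open>a\<close> multiplies a sinusoid of frequency \<theta>'
    by the factor \<open>Q \<theta>'\<close>; dividing by it normalises the output to sin (u
    \<theta>').\<close>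
  define e where "e k = Im (cis (real k * \<theta>') / Q \<theta>')" for k
  \<comment> \<open>On a window of length n the input has about n \<theta> / pi sign blocks and the
    output about n \<theta>' / pi alternations. The difference has to outweigh the part lost at the
    boundary and the rounding.\<close>
  have "\<exists>n::nat. real n * (1 - \<theta> / \<theta>') > (real (2 * m) + 2) * pi / \<theta>' + 2"
    using \<theta> by (intro ex_less_of_nat_mult) (simp add: field_simps)
  then obtain n :: nat where n: "real n * (1 - \<theta> / \<theta>') > (real (2 * m) + 2) * pi / \<theta>' + 2" ..
  define M where "M = (\<Sum>k<n. \<bar>e k\<bar> / \<bar>sin (real k * \<theta> + \<phi>)\<bar>)"
  define x where "x k = M * sin (real k * \<theta> + \<phi>) + e k" for k
  \<comment> \<open>The first integer inside a half-period of sin (u \<theta>'). It exists because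
    \<theta>' < pi makes each half-period longer than 1. The shift by 2 m is even, so it preserves
    signs, and it moves the samples beyond m.\<close>
  define r where "r l = \<lfloor>real (l + 2 * m) * pi / \<theta>'\<rfloor> + 1" for l
  define s where "s = \<beta> n"
  have x_sign: "0 \<le> (-1) ^ \<beta> k * x k" if "k < n" for k
  proof -
    let ?s = "(-1) ^ \<beta> k * sin (real k * \<theta> + \<phi>)"
    have abs: "\<bar>sin (real k * \<theta> + \<phi>)\<bar> = ?s" using sin_pos[of k] 
    proof -
      have "\<bar>sin (real k * \<theta> + \<phi>)\<bar> = \<bar>?s\<bar>" by (simp add: abs_mult)
      then show ?thesis using sin_pos[of k] by linarith
    qed
    have "\<bar>e k\<bar> / \<bar>sin (real k * \<theta> + \<phi>)\<bar> \<le> M"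
      unfolding M_def using that by (intro member_le_sum[of k "{..<n}" "\<lambda>k. \<bar>e k\<bar> / \<bar>sin (real k * \<theta> + \<phi>)\<bar>"]) auto
    then have "\<bar>e k\<bar> \<le> M * ?s" unfolding abs pos_divide_le_eq[OF sin_pos] .
    moreover have "\<bar>e k\<bar> = \<bar>(-1) ^ \<beta> k * e k\<bar>" by (simp add: abs_mult)
    ultimately have "0 \<le> M * ?s + (-1) ^ \<beta> k * e k" by linarith
    then show ?thesis by (simp add: x_def algebra_simps)
  qed
  \<comment> \<open>For m \<le> u < n the convolution reaches no index outside the window, so
    truncating the input is not felt; the part of frequency \<theta> is annihilated.\<close>
  have conv: "(\<Sum>j<n. a (u - int j) * x j) = sin (of_int u * \<theta>')" if u: "int m \<le> u" "u < int n" for u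
  proof -
    have "(\<Sum>j<n. a (u - int j) * x j) = (\<Sum>j | int j \<le> u \<and> u - int j \<le> int m. a (u - int j) * x j)"
    proof (rule sum.mono_neutral_right)
      show "{j. int j \<le> u \<and> u - int j \<le> int m} \<subseteq> {..<n}" using u by auto
      show "\<forall>j\<in>{..<n} - {j. int j \<le> u \<and> u - int j \<le> int m}. a (u - int j) * x j = 0"
      proof
        fix j assume "j \<in> {..<n} - {j. int j \<le> u \<and> u - int j \<le> int m}"
        then have "u - int j < 0 \<or> int m < u - int j" by auto
        then show "a (u - int j) * x j = 0" using supp by auto
      qed
    qed auto
    also have "\<dots> = (\<Sum>k\<le>m. a (int k) * x (nat (u - int k)))"
      by (rule sum.reindex_bij_witness[of _ "\<lambda>k. nat (u - int k)" "\<lambda>j. nat (u - int j)"]) (use u in auto)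
    also have "\<dots> = (\<Sum>k\<le>m. Im (of_real (a (int k)) *
        (of_real M * cis (of_int u * \<theta> + \<phi>) * cis (- (real k * \<theta>))
          + cis (of_int u * \<theta>') / Q \<theta>' * cis (- (real k * \<theta>')))))"
    proof (rule sum.cong)
      fix k assume "k \<in> {..m}"
      then have real: "real (nat (u - int k)) = of_int u - real k" using u by simp
      have cis_shift: "cis (of_int u * t + p) * cis (- (real k * t)) = cis ((of_int u - real k) * t + p)" for t p
        by (simp add: cis_mult algebra_simps)
      have lin: "Im (of_real q * (of_real M * z + w)) = q * (M * Im z + Im w)" for q and z w :: complex
        by simp
      have "of_real M * cis (of_int u * \<theta> + \<phi>) * cis (- (real k * \<theta>))
          + cis (of_int u * \<theta>') / Q \<theta>' * cis (- (real k * \<theta>'))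
        = of_real M * cis ((of_int u - real k) * \<theta> + \<phi>) + cis ((of_int u - real k) * \<theta>') / Q \<theta>'"
        using cis_shift[of \<theta> \<phi>] cis_shift[of \<theta>' 0] by (simp add: mult.assoc)
      then show "a (int k) * x (nat (u - int k)) = Im (of_real (a (int k)) *
        (of_real M * cis (of_int u * \<theta> + \<phi>) * cis (- (real k * \<theta>))
          + cis (of_int u * \<theta>') / Q \<theta>' * cis (- (real k * \<theta>'))))"
        by (simp only: x_def e_def real lin cis.sel)
    qed simp
    also have "\<dots> = Im (of_real M * cis (of_int u * \<theta> + \<phi>) * Q \<theta> + cis (of_int u * \<theta>') / Q \<theta>' * Q \<theta>')"
      unfolding Im_sum[symmetric] Q_def
      by (simp only: sum_distrib_left sum.distrib[symmetric]) (simp add: algebra_simps)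
    also have "\<dots> = sin (of_int u * \<theta>')" using root nonroot by simp
    finally show ?thesis .
  qed
  show False
  proof (rule tn_toeplitz_sign_changes[OF tn, of \<beta> r n "s + 1" x])
    show "mono \<beta>"
      unfolding \<beta>_def using \<theta> by (intro monoI nat_mono floor_mono divide_right_mono add_right_mono mult_right_mono) auto
    then show "\<beta> j < s + 1" if "j < n" for j
      using that monoD[of \<beta> j n] by (simp add: s_def)
    show "strict_mono r"
    proof (rule strict_monoI_Suc)
      fix l
      have "real (l + 2 * m) * pi / \<theta>' + 1 \<le> real (Suc l + 2 * m) * pi / \<theta>'"
        using \<theta> by (simp add: field_simps)
      then show "r l < r (Suc l)" unfolding r_def by linarith
    qed
    show "0 \<le> (-1) ^ \<beta> j * x j" if "j < n" for j by (rule x_sign[OF that])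
    fix i assume i: "i \<le> s + 1"
    have r1: "real (i + 2 * m) * pi / \<theta>' < of_int (r i)" "of_int (r i) \<le> real (i + 2 * m) * pi / \<theta>' + 1"
      unfolding r_def by linarith+
    have "real i \<le> real n * \<theta> / pi + 2"
    proof -
      have "real i \<le> real (\<beta> n) + 1" using i by (simp add: s_def)
      also have "real (\<beta> n) \<le> (real n * \<theta> + \<phi>) / pi" unfolding \<beta>_real by linarith
      also have "\<dots> \<le> real n * \<theta> / pi + 1" using \<phi> by (simp add: field_simps)
      finally show ?thesis by simp
    qed
    then have "real (i + 2 * m) * pi / \<theta>' \<le> (real n * \<theta> / pi + 2 + real (2 * m)) * pi / \<theta>'"
      using \<theta> by (intro divide_right_mono mult_right_mono) auto
    also have "\<dots> = real n * (\<theta> / \<theta>') + (real (2 * m) + 2) * pi / \<theta>'"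
      using \<theta> by (simp add: field_simps)
    finally have "of_int (r i) < real n" using r1(2) n by (simp add: algebra_simps)
    then have upper: "r i < int n" by linarith
    have "real m \<le> real (i + 2 * m) * 1" by simp
    also have "\<dots> \<le> real (i + 2 * m) * (pi / \<theta>')" using \<theta> by (intro mult_left_mono) auto
    finally have lower: "int m \<le> r i" using r1(1) by simp
    define t where "t = of_int (r i) * \<theta>' - real (i + 2 * m) * pi"
    have "0 < t" "t < pi" using r1 \<theta> by (auto simp: t_def field_simps)
    then have "0 < sin t" by (rule sin_gt_zero)
    moreover have "sin (of_int (r i) * \<theta>') = (-1) ^ i * sin t"
      using sin_plus_nat_pi[of "i + 2 * m" t] by (simp add: t_def power_add)
    ultimately show "0 < (-1) ^ i * (\<Sum>j<n. a (r i - int j) * x j)"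
      unfolding conv[OF lower upper] by (simp flip: mult.assoc power_add)
  qed
qed

text \<open>Conjugation puts a non-real root into the lower half-plane, and twisting the sequence by
  powers of its modulus moves it to the unit circle. A larger angle on the same circle at which the
  polynomial does not vanish exists because the roots are finite in number.\<close>

lemma tn_polynomial_real_roots:
  fixes a :: "int \<Rightarrow> real" and m :: nat
  assumes tn: "tn (toeplitz a)" and supp: "\<And>k. k < 0 \<Longrightarrow> a k = 0" "\<And>k. int m < k \<Longrightarrow> a k = 0"
    and root: "(\<Sum>k\<le>m. complex_of_real (a (int k)) * z ^ k) = 0" and nz: "i \<le> m" "a (int i) \<noteq> 0"
  shows "Im z = 0"
proof (rule ccontr)
  assume "Im z \<noteq> 0"
  have "cnj (\<Sum>k\<le>m. complex_of_real (a (int k)) * z ^ k) = (\<Sum>k\<le>m. complex_of_real (a (int k)) * cnj z ^ k)"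
    by simp
  with root \<open>Im z \<noteq> 0\<close> obtain w where w: "Im w < 0" "(\<Sum>k\<le>m. complex_of_real (a (int k)) * w ^ k) = 0"
    by (cases "Im z < 0") (auto intro: that[of z] that[of "cnj z"])
  define r where "r = cmod w"
  define \<theta> where "\<theta> = - Arg w"
  have "0 < r" using w(1) by (auto simp: r_def)
  have \<theta>: "0 < \<theta>" "\<theta> < pi" using w(1) Arg_neg_iff[of w] mpi_less_Arg[of w] by (auto simp: \<theta>_def)
  have pow: "of_real (r powi int k * a (int k)) * cis (- (real k * t))
      = of_real (a (int k)) * (rcis r (- t)) ^ k" for k t

  proof -
    have "cis (- (real k * t)) = cis (- t) ^ k" using Complex.DeMoivre[of "- t" k] by simp
    then show ?thesis by (simp add: rcis_def power_mult_distrib mult_ac)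
  qed
  define p where "p = (\<Sum>k\<le>m. monom (complex_of_real (a (int k))) k)"
  have poly_p: "poly p x = (\<Sum>k\<le>m. of_real (a (int k)) * x ^ k)" for x
    by (simp add: p_def poly_sum poly_monom)
  have "coeff p i = of_real (a (int i))" using nz(1) by (simp add: p_def coeff_sum)
  then have "p \<noteq> 0" using nz(2) by auto
  have "inj_on (\<lambda>t. rcis r (- t)) {\<theta><..<pi}"
  proof (rule inj_onI)
    fix s t assume st: "s \<in> {\<theta><..<pi}" "t \<in> {\<theta><..<pi}" "rcis r (- s) = rcis r (- t)"
    then have "cos s = cos t" using \<open>0 < r\<close> by (auto simp: rcis_def cis.ctr complex_eq_iff)
    then show "s = t" using st \<theta> by (auto simp: cos_inj_pi)
  qed
  then have "infinite ((\<lambda>t. rcis r (- t)) ` {\<theta><..<pi})"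
    using \<theta> by (simp add: finite_image_iff)
  then have "\<not> (\<lambda>t. rcis r (- t)) ` {\<theta><..<pi} \<subseteq> {x. poly p x = 0}"
    using poly_roots_finite[OF \<open>p \<noteq> 0\<close>] finite_subset by blast
  then obtain \<theta>' where "\<theta>' \<in> {\<theta><..<pi}" "poly p (rcis r (- \<theta>')) \<noteq> 0" by blast
  then have \<theta>': "\<theta> < \<theta>'" "\<theta>' < pi" "poly p (rcis r (- \<theta>')) \<noteq> 0" by auto
  show False
  proof (rule tn_polynomial_no_unimodular_root[OF tn_toeplitz_twist_int[OF tn \<open>0 < r\<close>], of m \<theta> \<theta>'])
    show "(\<Sum>k\<le>m. of_real (r powi int k * a (int k)) * cis (- (real k * \<theta>))) = 0"
      unfolding pow using w(2) by (simp add: \<theta>_def r_def rcis_cmod_Arg)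
    show "(\<Sum>k\<le>m. of_real (r powi int k * a (int k)) * cis (- (real k * \<theta>'))) \<noteq> 0"
      unfolding pow using \<theta>'(3) by (simp add: poly_p)
  qed (use supp \<theta> \<theta>' in auto)
qed

section \<open>Variance of the generating polynomial\<close>

definition poly_var :: "real poly \<Rightarrow> real" where
  "poly_var p = poly p 1 * (poly (pderiv (pderiv p)) 1 + poly (pderiv p) 1) - (poly (pderiv p) 1)\<^sup>2"

text \<open>Additivity of the variance for independent summands, with denominators cleared.\<close>

lemma poly_var_mult: "poly_var (p * q) = poly_var p * (poly q 1)\<^sup>2 + poly_var q * (poly p 1)\<^sup>2"
  by (simp add: poly_var_def pderiv_mult pderiv_add power2_eq_square algebra_simps)

text \<open>\<open>poly_var p / (poly p 1)\<^sup>2\<close> is the variance of the distribution with generating function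
  \<open>p / poly p 1\<close>. If all roots are real and non-positive, this is a sum of \<open>degree p\<close> independent
  Bernoulli variables.\<close>

lemma poly_var_real_rooted:
  assumes "\<And>z. poly (map_poly complex_of_real p) z = 0 \<Longrightarrow> Im z = 0 \<and> Re z \<le> 0"
  shows "4 * poly_var p \<le> real (degree p) * (poly p 1)\<^sup>2"
  using assms
proof (induction "degree p" arbitrary: p)
  case 0
  then obtain c where "p = [:c:]" by (metis degree_0_id)
  then show ?case by (simp add: poly_var_def)
next
  case (Suc n)
  interpret h: map_poly_inj_idom_hom "complex_of_real" ..
  have "degree (map_poly complex_of_real p) \<noteq> 0" using Suc(2) by simp
  then have "\<not> constant (poly (map_poly complex_of_real p))" by (simp add: constant_degree)
  then obtain z where z: "poly (map_poly complex_of_real p) z = 0"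
    using fundamental_theorem_of_algebra by blast
  define x where "x = Re z"
  have zx: "z = of_real x" "x \<le> 0" using Suc(3)[OF z] by (auto simp: x_def complex_eq_iff)
  then have "poly p x = 0" using z by simp
  then obtain q where p: "p = [:- x, 1:] * q" by (auto simp: poly_eq_0_iff_dvd elim: dvdE)
  have "q \<noteq> 0" using Suc(2) p by auto
  then have "degree p = Suc (degree q)" unfolding p by (subst degree_mult_eq) auto
  then have deg: "n = degree q" using Suc(2) by simp
  have "4 * poly_var q \<le> real (degree q) * (poly q 1)\<^sup>2"
  proof (rule Suc(1)[OF deg])
    fix w assume "poly (map_poly complex_of_real q) w = 0"
    then have "poly (map_poly complex_of_real p) w = 0" unfolding p by (simp only: h.hom_mult poly_mult) simp
    then show "Im w = 0 \<and> Re w \<le> 0" by (rule Suc(3))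
  qed
  then have "4 * poly_var q * (poly [:- x, 1:] 1)\<^sup>2 \<le> real (degree q) * (poly q 1)\<^sup>2 * (poly [:- x, 1:] 1)\<^sup>2"
    by (rule mult_right_mono) simp
  moreover have "4 * poly_var [:- x, 1:] * (poly q 1)\<^sup>2 \<le> (poly [:- x, 1:] 1)\<^sup>2 * (poly q 1)\<^sup>2"
  proof (rule mult_right_mono)
    \<comment> \<open>The Bernoulli bound p (1 - p) \<le> 1/4 with denominators cleared: the linear
      factor has \<open>poly_var\<close> equal to -x, to be compared with (1 - x)^2 / 4.\<close>
    have "0 \<le> (1 + x)\<^sup>2" by simp
    then show "4 * poly_var [:- x, 1:] \<le> (poly [:- x, 1:] 1)\<^sup>2"
      by (simp add: poly_var_def pderiv_pCons power2_eq_square algebra_simps)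
  qed simp
  moreover have "poly p 1 = poly [:- x, 1:] 1 * poly q 1" unfolding p by (rule poly_mult)
  moreover have "real (degree p) = real (degree q) + 1" using Suc(2) deg by simp
  moreover have "4 * (vl * w + vq * u) \<le> (d + 1) * (u * w)"
    if "4 * vq * u \<le> d * w * u" "4 * vl * w \<le> u * w" for vq vl u w d :: real
    using that by (simp add: algebra_simps)
  ultimately show ?case
    by (simp only: p poly_var_mult power_mult_distrib)
qed

text \<open>The double sum is twice \<open>poly_var\<close> of the generating polynomial. The roots
  of that polynomial are real, and they are not positive because the coefficients are non-negative
  and not all zero.\<close>

lemma tn_sequence_variance:
  fixes a :: "int \<Rightarrow> real" and m :: nat
  assumes tn: "tn (toeplitz a)" and supp: "\<And>k. k < 0 \<Longrightarrow> a k = 0" "\<And>k. int m < k \<Longrightarrow> a k = 0"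
  shows "2 * (\<Sum>j\<le>m. \<Sum>k\<le>m. a (int j) * a (int k) * (real j - real k)\<^sup>2) \<le> real m * (\<Sum>k\<le>m. a (int k))\<^sup>2"
proof -
  have nonneg: "0 \<le> a k" for k using tn_nonneg[OF tn, of k 0] by (simp add: toeplitz_def)
  define p where "p = (\<Sum>k\<le>m. monom (a (int k)) k)"
  have map_p: "poly (map_poly complex_of_real p) z = (\<Sum>k\<le>m. complex_of_real (a (int k)) * z ^ k)" for z
  proof -
    interpret h: map_poly_inj_idom_hom "complex_of_real" ..
    show ?thesis by (simp add: p_def h.hom_sum poly_sum map_poly_monom poly_monom)
  qed
  have p0: "poly p 1 = (\<Sum>k\<le>m. a (int k))" by (simp add: p_def poly_sum poly_monom)
  have p1: "poly (pderiv p) 1 = (\<Sum>k\<le>m. real k * a (int k))"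
    by (simp add: p_def pderiv_sum pderiv_monom poly_sum poly_monom)
  have p2: "poly (pderiv (pderiv p)) 1 + poly (pderiv p) 1 = (\<Sum>k\<le>m. (real k)\<^sup>2 * a (int k))"
  proof -
    have "real k * (real (k - 1) * a (int k)) + real k * a (int k) = (real k)\<^sup>2 * a (int k)" for k
      by (cases k) (auto simp: power2_eq_square algebra_simps)
    then show ?thesis
      by (simp add: p_def pderiv_sum pderiv_monom poly_sum poly_monom mult_ac flip: sum.distrib)
  qed
  have "(\<Sum>j\<le>m. \<Sum>k\<le>m. a (int j) * a (int k) * (real j - real k)\<^sup>2)
      = (\<Sum>j\<le>m. \<Sum>k\<le>m. a (int k) * ((real j)\<^sup>2 * a (int j)) + a (int j) * ((real k)\<^sup>2 * a (int k))
          - 2 * ((real j * a (int j)) * (real k * a (int k))))"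
    by (intro sum.cong refl) (simp add: power2_eq_square algebra_simps)
  also have "\<dots> = 2 * poly_var p"
  proof -
    have "(\<Sum>j\<le>m. \<Sum>k\<le>m. u k * v j) = (\<Sum>k\<le>m. u k) * (\<Sum>k\<le>m. v k)"
      "(\<Sum>j\<le>m. \<Sum>k\<le>m. u j * v k) = (\<Sum>k\<le>m. u k) * (\<Sum>k\<le>m. v k)"
      "(\<Sum>j\<le>m. \<Sum>k\<le>m. 2 * (u j * v k)) = 2 * ((\<Sum>k\<le>m. u k) * (\<Sum>k\<le>m. v k))" for u v :: "nat \<Rightarrow> real"
      by (simp_all only: sum_distrib_left[symmetric] sum_distrib_right[symmetric])
    then show ?thesis
      unfolding poly_var_def p2 unfolding p0 p1 by (simp only: sum.distrib sum_subtractf) (simp add: power2_eq_square)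
  qed
  finally have var: "(\<Sum>j\<le>m. \<Sum>k\<le>m. a (int j) * a (int k) * (real j - real k)\<^sup>2) = 2 * poly_var p" .
  show ?thesis
  proof (cases "\<exists>i\<le>m. a (int i) \<noteq> 0")
    case False
    then show ?thesis by simp
  next
    case True
    then obtain i where i: "i \<le> m" "a (int i) \<noteq> 0" by blast
    have "4 * poly_var p \<le> real (degree p) * (poly p 1)\<^sup>2"
    proof (rule poly_var_real_rooted)
      fix z assume "poly (map_poly complex_of_real p) z = 0"
      then have root: "(\<Sum>k\<le>m. complex_of_real (a (int k)) * z ^ k) = 0" by (simp add: map_p)
      have im: "Im z = 0" by (rule tn_polynomial_real_roots[OF tn supp root i])
      then have z: "z = of_real (Re z)" by (simp add: complex_eq_iff)
      have "(\<Sum>k\<le>m. a (int k) * Re z ^ k) = 0"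
        using root by (subst (asm) z) (simp flip: of_real_power of_real_mult of_real_sum)
      moreover have "0 < (\<Sum>k\<le>m. a (int k) * Re z ^ k)" if "0 < Re z"
        using that nonneg i less_le[of 0 "a (int i)"] by (intro sum_pos2[of _ i]) auto
      ultimately show "Im z = 0 \<and> Re z \<le> 0" using im by force
    qed
    also have "\<dots> \<le> real m * (poly p 1)\<^sup>2"
    proof -
      have "degree p \<le> m" unfolding p_def by (intro degree_sum_le) (auto intro: order_trans[OF degree_monom_le])
      then show ?thesis by (intro mult_right_mono) auto
    qed
    finally show ?thesis unfolding var p0 by simp
  qed
qed

section \<open>Compactly supported totally non-negative functions\<close>

text \<open>The slope at \<open>j\<close> bounds the earlier slopes from below and the later ones
  from above; adding up each group gives the chord inequality.\<close>

lemma concave_sequence_interpolation: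
  fixes b :: "nat \<Rightarrow> real"
  assumes conc: "\<And>k. k + 2 \<le> N \<Longrightarrow> b k + b (k + 2) \<le> 2 * b (k + 1)" and "j \<le> N"
  shows "(real N - real j) * b 0 + real j * b N \<le> real N * b j"
proof (cases "j = N")
  case False
  define d where "d i = b (Suc i) - b i" for i
  have dec: "d i' \<le> d i" if "i \<le> i'" "i' < N" for i i'
    using that
  proof (induction rule: dec_induct)
    case (step k)
    then show ?case using conc[of k] by (simp add: d_def)
  qed simp
  have tele: "b n - b m = (\<Sum>i = m..<n. d i)" if "m \<le> n" for m n
    unfolding d_def using that by (rule sum_Suc_diff'[symmetric])
  have "real j * d j \<le> b j - b 0"
    using tele[of 0 j] sum_bounded_below[of "{0..<j}" "d j" d] dec assms(2) False by auto
  then have "(real N - real j) * (real j * d j) \<le> (real N - real j) * (b j - b 0)"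
    using assms(2) by (intro mult_left_mono) auto
  moreover have "b N - b j \<le> (real N - real j) * d j"
    using tele[of j N] sum_bounded_above[of "{j..<N}" d "d j"] dec assms(2) by (auto simp: of_nat_diff)
  then have "real j * (b N - b j) \<le> real j * ((real N - real j) * d j)"
    by (intro mult_left_mono) auto
  ultimately show ?thesis by (simp add: algebra_simps)
qed simp

lemma tn_sequence_log_concave:
  fixes a :: "int \<Rightarrow> real"
  assumes tn: "tn (toeplitz a)" and "i \<le> j" "j \<le> k" and pos: "0 < a i" "0 < a k"
  shows "0 < a j" and "of_int (k - j) * ln (a i) + of_int (j - i) * ln (a k) \<le> of_int (k - i) * ln (a j)"
proof -
  have nonneg: "0 \<le> a k" for k using tn_nonneg[OF tn, of k 0] by (simp add: toeplitz_def)
  have pos': "0 < a l" if "i \<le> l" "l \<le> k" for l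
    using tn_toeplitz_wright[OF tn that] pos nonneg[of l] by (metis less_le mult_pos_pos mult_zero_left not_le)
  then show "0 < a j" using assms by simp
  define N where "N = nat (k - i)"
  have "(real N - real (nat (j - i))) * ln (a (i + int 0)) + real (nat (j - i)) * ln (a (i + int N))
      \<le> real N * ln (a (i + int (nat (j - i))))"
  proof (rule concave_sequence_interpolation)
    fix l assume l: "l + 2 \<le> N"
    have p: "0 < a (i + int l)" "0 < a (i + int (l + 1))" "0 < a (i + int (l + 2))"
      using l assms by (auto intro!: pos' simp: N_def)
    have "a (i + int l) * a (i + int (l + 2)) \<le> a (i + int (l + 1)) * a (i + int (l + 1))"
      using tn_toeplitz_wright[OF tn, of "i + int l" "i + int (l + 1)" "i + int (l + 2)"]
      by (simp add: algebra_simps)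
    then have "ln (a (i + int l) * a (i + int (l + 2))) \<le> ln (a (i + int (l + 1)) * a (i + int (l + 1)))"
      using p by (subst ln_le_cancel_iff) (auto intro!: mult_pos_pos)
    then show "ln (a (i + int l)) + ln (a (i + int (l + 2))) \<le> 2 * ln (a (i + int (l + 1)))"
      using p by (simp add: ln_mult)
  qed (use assms in \<open>simp add: N_def\<close>)
  then show "of_int (k - j) * ln (a i) + of_int (j - i) * ln (a k) \<le> of_int (k - i) * ln (a j)"
    using assms by (simp add: N_def)
qed

text \<open>The comparison of linear with quadratic growth needs bounds on the samples that are
  uniform in the mesh. They come from three fixed values of \<open>f\<close> through the chord
  inequality for logarithms, which gives lower bounds by interpolation and upper bounds by
  extrapolation.\<close>

lemma no_compactly_supported_tn:
  fixes f :: "real \<Rightarrow> real"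
  assumes tn: "\<And>h. 0 < h \<Longrightarrow> tn (toeplitz (\<lambda>k::int. f (h * of_int k)))"
    and pos: "0 < f 0" "0 < f q" "0 < q" and supp: "\<And>x. R < \<bar>x\<bar> \<Longrightarrow> f x = 0"
  shows False
proof -
  \<comment> \<open>Extrapolation into the inside of (0, q) has to pass through an interior point,
    so the midpoint serves as a third anchor.\<close>
  have half: "0 < f (q / 2)"
    using tn_sequence_log_concave(1)[OF tn[of "q / 2"], of 0 1 2] pos by simp
  define L where "L = \<bar>ln (f 0)\<bar> + \<bar>ln (f (q / 2))\<bar> + \<bar>ln (f q)\<bar>"
  have L: "ln (f 0) \<le> L" "- L \<le> ln (f 0)" "ln (f (q / 2)) \<le> L" "- L \<le> ln (f (q / 2))" "ln (f q) \<le> L" "- L \<le> ln (f q)"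
    "0 \<le> L" by (auto simp: L_def)
  have arch: "\<exists>n::nat. x < real n \<and> 0 < n" for x
  proof -
    obtain n :: nat where "x < real n" using reals_Archimedean2 by blast
    then have "x < real (Suc n)" by simp
    then show ?thesis by blast
  qed
  obtain C where C: "R / q < real (C :: nat)" "0 < C" using arch by blast
  \<comment> \<open>The exponent bounds the total weight of the anchors relative to the weight of
    the sample: at most 3 between 0 and q, and growing linearly with the distance outside, which is
    at most C times q.\<close>
  define K where "K = exp ((3 + 2 * real C) * L)"
  define \<mu> where "\<mu> = exp (- L)"
  \<comment> \<open>This excludes the final estimate, in which n^4 \<mu>^2 is at most half of 8 n C
    (9 n C K)^2, that is 324 n^3 C^3 K^2.\<close>
  obtain n where n: "324 * real C ^ 3 * K\<^sup>2 / \<mu>\<^sup>2 < real (n :: nat)" "0 < n" using arch by blast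
  define P where "P = n * C"
  have P: "n \<le> P" "real P = real n * real C" "0 < P" using n C by (simp_all add: P_def)
  define b where "b k = f (q / (4 * real n) * of_int k)" for k :: int
  have tnb: "tn (toeplitz b)" unfolding b_def using n pos by (intro tn) auto
  have nonneg: "0 \<le> b k" for k using tn_nonneg[OF tnb, of k 0] by (simp add: toeplitz_def)
  have b_vals: "b 0 = f 0" "b (2 * int n) = f (q / 2)" "b (4 * int n) = f q"
    using n by (simp_all add: b_def field_simps)
  note lc = tn_sequence_log_concave[OF tnb]
  have lower: "\<mu> \<le> b k" if k: "0 \<le> k" "k \<le> 4 * int n" for k
  proof -
    have p: "0 < b k" by (rule lc(1)[of 0 k "4 * int n"]) (use k pos b_vals in auto)
    have "of_int (4 * int n - k) * ln (b 0) + of_int k * ln (b (4 * int n)) \<le> of_int (4 * int n) * ln (b k)"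
      using lc(2)[of 0 k "4 * int n"] k pos b_vals by simp
    moreover have "of_int (4 * int n - k) * (- L) \<le> of_int (4 * int n - k) * ln (b 0)"
      using k L b_vals by (intro mult_left_mono) auto
    moreover have "of_int k * (- L) \<le> of_int k * ln (b (4 * int n))"
      using k L b_vals by (intro mult_left_mono) auto
    ultimately have "4 * real n * (- L) \<le> 4 * real n * ln (b k)" by (simp add: algebra_simps)
    then have "- L \<le> ln (b k)" by (rule mult_left_le_imp_le) (use n in simp)
    then show ?thesis unfolding \<mu>_def using p by (simp add: ln_ge_iff)
  qed
  have upper: "b k \<le> K" if k: "\<bar>k\<bar> \<le> 4 * int P" for k
  proof (cases "0 < b k")
    case False
    moreover have "0 < K" by (simp add: K_def)
    ultimately show ?thesis by linarith
  next
    case p: True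
    have kC: "\<bar>real_of_int k\<bar> \<le> 4 * real P"
    proof -
      have "real_of_int \<bar>k\<bar> \<le> real_of_int (4 * int P)" using k by (simp only: of_int_le_iff)
      then show ?thesis by simp
    qed
    have scaled: "b k \<le> K"
      if "0 < N" "N * ln (b k) \<le> u * l + v * l'" "0 \<le> u" "0 \<le> v" "l \<le> L" "l' \<le> L" "u + v \<le> N * 3 + N * real C * 2"
      for N u v l l'
    proof -
      have "u * l + v * l' \<le> u * L + v * L" using that by (intro add_mono mult_left_mono)
      also have "\<dots> = (u + v) * L" by (simp add: algebra_simps)
      also have "\<dots> \<le> N * (3 + 2 * real C) * L" using that L by (intro mult_right_mono) (simp_all add: algebra_simps)
      finally have "N * ln (b k) \<le> N * ((3 + 2 * real C) * L)" using that(2) by (simp only: mult.assoc)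
      then have "ln (b k) \<le> (3 + 2 * real C) * L" by (rule mult_left_le_imp_le) (rule that)
      then show ?thesis unfolding K_def using p by (metis exp_le_cancel_iff exp_ln)
    qed
    have nC: "0 < real n" "real n \<le> real P" using n P(1) by simp_all
    consider "k < 0" | "0 \<le> k" "k \<le> 2 * int n" | "2 * int n < k" "k \<le> 4 * int n" | "4 * int n < k" by linarith
    then show ?thesis
    proof cases
      case 1
      then have kr: "real_of_int k < 0" by linarith+
      from 1 have "of_int (4 * int n) * ln (b k) + of_int (- k) * ln (b (4 * int n)) \<le> of_int (4 * int n - k) * ln (b 0)"
        using lc(2)[of k 0 "4 * int n"] p pos b_vals by simp
      then have "4 * real n * ln (b k) \<le> (4 * real n - of_int k) * ln (f 0) + (- of_int k) * (- ln (f q))"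
        using b_vals by simp
      then show ?thesis
        by (rule scaled[rotated]) (use kr L nC kC in \<open>simp_all flip: P(2)\<close>)
    next
      case 2
      then have kr: "0 \<le> real_of_int k" "real_of_int k \<le> 2 * real n" by linarith+
      from 2 have "of_int (2 * int n) * ln (b k) + of_int (2 * int n - k) * ln (b (4 * int n))
          \<le> of_int (4 * int n - k) * ln (b (2 * int n))"
        using lc(2)[of k "2 * int n" "4 * int n"] p pos b_vals by simp
      then have "2 * real n * ln (b k) \<le> (4 * real n - of_int k) * ln (f (q / 2)) + (2 * real n - of_int k) * (- ln (f q))"
        using b_vals by (simp add: algebra_simps)
      then show ?thesis
        by (rule scaled[rotated]) (use kr L nC in \<open>simp_all flip: P(2)\<close>)
    next
      case 3
      then have kr: "2 * real n < real_of_int k" "real_of_int k \<le> 4 * real n" by linarith+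
      from 3 have "of_int (k - 2 * int n) * ln (b 0) + of_int (2 * int n) * ln (b k) \<le> of_int k * ln (b (2 * int n))"
        using lc(2)[of 0 "2 * int n" k] p pos b_vals by simp
      then have "2 * real n * ln (b k) \<le> of_int k * ln (f (q / 2)) + (of_int k - 2 * real n) * (- ln (f 0))"
        using b_vals by (simp add: algebra_simps)
      then show ?thesis
        by (rule scaled[rotated]) (use kr L nC in \<open>simp_all flip: P(2)\<close>)
    next
      case 4
      then have kr: "4 * real n < real_of_int k" by linarith+
      from 4 have "of_int (k - 4 * int n) * ln (b 0) + of_int (4 * int n) * ln (b k) \<le> of_int k * ln (b (4 * int n))"
        using lc(2)[of 0 "4 * int n" k] p pos b_vals by simp
      then have "4 * real n * ln (b k) \<le> of_int k * ln (f q) + (of_int k - 4 * real n) * (- ln (f 0))"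
        using b_vals by (simp add: algebra_simps)
      then show ?thesis
        by (rule scaled[rotated]) (use kr L nC kC in \<open>simp_all flip: P(2)\<close>)
    qed
  qed
  \<comment> \<open>The indices from -4 P to 4 P contain the support, since 4 P steps of the mesh
    cover the length q C > R. The shift by 4 P makes them start at 0.\<close>
  define m where "m = 8 * P"
  define a where "a k = b (k - 4 * int P)" for k
  have tna: "tn (toeplitz a)"
  proof -
    have "a = (\<lambda>k. b (k + - (4 * int P)))" by (simp add: a_def fun_eq_iff)
    then show ?thesis using tn_toeplitz_shift[OF tnb, of "- (4 * int P)"] by simp
  qed
  have b0: "b k = 0" if "4 * int P < \<bar>k\<bar>" for k
    unfolding b_def
  proof (rule supp)
    have "4 * real P < \<bar>real_of_int k\<bar>"
    proof -
      have "real_of_int (4 * int P) < real_of_int \<bar>k\<bar>" using that by (simp only: of_int_less_iff)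
      then show ?thesis by simp
    qed
    have "R < q * real C" using C pos by (simp add: field_simps)
    then have "R * (4 * real n) < (q * real C) * (4 * real n)" using n by (intro mult_strict_right_mono) auto
    also have "\<dots> \<le> q * \<bar>real_of_int k\<bar>"
      using mult_left_mono[OF less_imp_le[OF \<open>4 * real P < \<bar>real_of_int k\<bar>\<close>], of q] pos by (simp add: P(2) mult_ac)
    finally show "R < \<bar>q / (4 * real n) * of_int k\<bar>" using n pos by (simp add: abs_mult field_simps)
  qed
  have var: "2 * (\<Sum>j\<le>m. \<Sum>k\<le>m. a (int j) * a (int k) * (real j - real k)\<^sup>2) \<le> real m * (\<Sum>k\<le>m. a (int k))\<^sup>2"
    by (rule tn_sequence_variance[OF tna]) (auto simp: a_def m_def intro!: b0)
  have nonnega: "0 \<le> a k" for k by (simp add: a_def nonneg)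
  have "(\<Sum>k\<le>m. a (int k)) \<le> (\<Sum>k\<le>m. K)"
    by (intro sum_mono) (auto simp: a_def m_def intro!: upper)
  also have "\<dots> \<le> 9 * real n * real C * K"
  proof -
    have "real (m + 1) \<le> 9 * real n * real C" using P(3) by (simp add: m_def mult.assoc flip: P(2))
    then show ?thesis by (simp add: K_def)
  qed
  finally have S0: "(\<Sum>k\<le>m. a (int k)) \<le> 9 * real n * real C * K" .
  \<comment> \<open>\<open>J\<close> and \<open>J'\<close> sample the first and the last quarter of
    [0, q]: n points each, of weight at least \<mu>, and at mutual distance at least n.\<close>
  define J where "J = {4 * P..<4 * P + n}"
  define J' where "J' = {4 * P + 3 * n..<4 * P + 4 * n}"
  have JJ: "J \<subseteq> {..m}" "J' \<subseteq> {..m}" using P(1) by (auto simp: J_def J'_def m_def)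
  have "(real n) ^ 4 * \<mu>\<^sup>2 = (\<Sum>j\<in>J. \<Sum>k\<in>J'. \<mu> * \<mu> * (real n)\<^sup>2)"
    by (simp add: J_def J'_def power2_eq_square eval_nat_numeral)
  also have "\<dots> \<le> (\<Sum>j\<in>J. \<Sum>k\<in>J'. a (int j) * a (int k) * (real j - real k)\<^sup>2)"
  proof (intro sum_mono mult_mono)
    fix j k assume jk: "j \<in> J" "k \<in> J'"
    show "\<mu> \<le> a (int j)" "\<mu> \<le> a (int k)"
      unfolding a_def by (rule lower; use jk in \<open>auto simp: J_def J'_def\<close>)+
    have "real n \<le> real k - real j" using jk by (auto simp: J_def J'_def)
    then show "(real n)\<^sup>2 \<le> (real j - real k)\<^sup>2" by (subst power2_commute) (intro power_mono; simp)
  qed (auto simp: nonnega \<mu>_def)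
  also have "\<dots> \<le> (\<Sum>j\<le>m. \<Sum>k\<le>m. a (int j) * a (int k) * (real j - real k)\<^sup>2)"
    by (rule order_trans[OF sum_mono[OF sum_mono2] sum_mono2]) (use JJ in \<open>auto simp: nonnega intro!: sum_nonneg\<close>)
  finally have "2 * ((real n) ^ 4 * \<mu>\<^sup>2) \<le> real m * (\<Sum>k\<le>m. a (int k))\<^sup>2" using var by simp
  also have "\<dots> \<le> real m * (9 * real n * real C * K)\<^sup>2"
    using S0 by (intro mult_left_mono power_mono sum_nonneg) (auto simp: nonnega)
  also have "\<dots> = 2 * ((324 * real C ^ 3 * K\<^sup>2) * real n ^ 3)"
    by (simp add: m_def P(2) power2_eq_square eval_nat_numeral)
  finally have "real n ^ 3 * (real n * \<mu>\<^sup>2) \<le> real n ^ 3 * (324 * real C ^ 3 * K\<^sup>2)"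
    by (simp add: eval_nat_numeral mult_ac)
  then have "real n * \<mu>\<^sup>2 \<le> 324 * real C ^ 3 * K\<^sup>2" using n by simp
  moreover have "324 * real C ^ 3 * K\<^sup>2 < real n * \<mu>\<^sup>2"
    using n(1) by (simp add: \<mu>_def field_simps)
  ultimately show False by linarith
qed

section \<open>Minors away from the diagonal\<close>

text \<open>The condition \<open>y j < x i\<close> keeps the minors off the diagonal and the zeros
  beyond it, so that asymptotic expansions at infinity can be manipulated term by term.\<close>

definition pos_tn :: "nat \<Rightarrow> (real \<Rightarrow> real) \<Rightarrow> bool" where
  "pos_tn n f \<longleftrightarrow> (\<forall>x y. (\<forall>i j. i < j \<longrightarrow> j < n \<longrightarrow> x i < x j) \<longrightarrow> (\<forall>i j. i < j \<longrightarrow> j < n \<longrightarrow> y i < y j) \<longrightarrow>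
     (\<forall>i<n. \<forall>j<n. y j < x i) \<longrightarrow> 0 \<le> fdet n (\<lambda>i j. f (x i - y j)))"

lemma pos_tn_1: "pos_tn (Suc 0) f \<Longrightarrow> 0 < t \<Longrightarrow> 0 \<le> f t"
  unfolding pos_tn_def by (drule spec[of _ "\<lambda>_. t"], drule spec[of _ "\<lambda>_. 0"]) (simp add: fdet_1[unfolded One_nat_def])

lemma pos_tn_twist:
  assumes "pos_tn n f"
  shows "pos_tn n (\<lambda>t. exp (a * t) * f t)"
  unfolding pos_tn_def
proof (intro allI impI)
  fix x y :: "nat \<Rightarrow> real"
  assume "\<forall>i j. i < j \<longrightarrow> j < n \<longrightarrow> x i < x j" "\<forall>i j. i < j \<longrightarrow> j < n \<longrightarrow> y i < y j" "\<forall>i<n. \<forall>j<n. y j < x i"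
  then have "0 \<le> fdet n (\<lambda>i j. f (x i - y j))" using assms unfolding pos_tn_def by blast
  then have "0 \<le> fdet n (\<lambda>i j. exp (a * x i) * exp (- a * y j) * f (x i - y j))"
    by (subst fdet_scale) (auto intro!: mult_nonneg_nonneg prod_nonneg)
  then show "0 \<le> fdet n (\<lambda>i j. exp (a * (x i - y j)) * f (x i - y j))"
    by (simp add: right_diff_distrib flip: exp_add)
qed

text \<open>Subtract the last row from the others, then expand along the first column.\<close>

lemma fdet_bordered:
  assumes "\<And>i. i \<le> n \<Longrightarrow> A i 0 = (c::real)" "\<And>j. j \<le> n \<Longrightarrow> A n j = c"
  shows "fdet (Suc n) A = c * fdet n (\<lambda>i j. c - A i (Suc j))"
proof -
  define L where "L i j = (if i = j then 1 else if j = n then - 1 else (0::real))" for i j :: nat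
  define A' where "A' i k = (if i = n then c else A i k - c)" for i k
  have row: "(\<Sum>j<Suc n. L i j * A j k) = A' i k" if "i < Suc n" "k < Suc n" for i k
  proof (cases "i = n")
    case True
    have "(\<Sum>j<Suc n. L i j * A j k) = (\<Sum>j<Suc n. if j = n then A j k else 0)"
      by (rule sum.cong) (auto simp: L_def True)
    then show ?thesis using that assms(2)[of k] True by (simp add: A'_def)
  next
    case False
    have "(\<Sum>j<Suc n. L i j * A j k)
        = (\<Sum>j<Suc n. (if j = i then A j k else 0) + (if j = n then - A j k else 0))"
      by (rule sum.cong) (auto simp: L_def False)
    also have "\<dots> = A i k - A n k" using that False by (subst sum.distrib) simp
    finally show ?thesis using that assms(2)[of k] False by (simp add: A'_def)
  qed
  have "fdet (Suc n) A = fdet (Suc n) L * fdet (Suc n) A"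
    by (subst fdet_unit_upper) (auto simp: L_def)
  also have "\<dots> = fdet (Suc n) A'"
    unfolding fdet_mult[symmetric] by (rule fdet_cong) (rule row)
  also have "\<dots> = (\<Sum>i<Suc n. A' i 0 * ((-1) ^ (i + 0) *
      fdet (Suc n - 1) (\<lambda>a b. A' (if a < i then a else Suc a) (if b < 0 then b else Suc b))))"
    by (rule fdet_laplace_col) simp
  also have "\<dots> = (\<Sum>i<Suc n. if i = n then c * ((-1) ^ n * fdet n (\<lambda>a b. A' (if a < n then a else Suc a) (Suc b))) else 0)"
    by (rule sum.cong) (use assms(1) in \<open>auto simp: A'_def\<close>)
  also have "\<dots> = c * ((-1) ^ n * fdet n (\<lambda>a b. A a (Suc b) - c))"
    by (simp add: A'_def cong: fdet_cong)
  also have "(-1) ^ n * fdet n (\<lambda>a b. A a (Suc b) - c) = fdet n (\<lambda>i j. c - A i (Suc j))"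
    using fdet_scale[of n "\<lambda>_. -1" "\<lambda>_. 1" "\<lambda>a b. A a (Suc b) - c"] by simp
  finally show ?thesis .
qed

text \<open>Send the last row point to \<open>\<infinity>\<close> and the first column point to \<open>-\<infinity>\<close>.\<close>

lemma pos_tn_limit_difference:
  assumes "pos_tn (Suc n) f" and lim: "(f \<longlongrightarrow> f0) at_top" and "0 < f0"
  shows "pos_tn n (\<lambda>t. f0 - f t)"
  unfolding pos_tn_def
proof (intro allI impI)
  fix x y :: "nat \<Rightarrow> real"
  assume x: "\<forall>i j. i < j \<longrightarrow> j < n \<longrightarrow> x i < x j" and y: "\<forall>i j. i < j \<longrightarrow> j < n \<longrightarrow> y i < y j"
    and xy: "\<forall>i<n. \<forall>j<n. y j < x i"
  define X where "X T i = (if i < n then x i else T)" for T :: real and i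
  define Y where "Y T j = (case j of 0 \<Rightarrow> - T | Suc j \<Rightarrow> y j)" for T :: real and j
  define B where "B i j = (case j of 0 \<Rightarrow> f0 | Suc j \<Rightarrow> if i < n then f (x i - y j) else f0)" for i j :: nat
  have ev: "\<forall>\<^sub>F T in at_top. 0 < T \<and> (\<forall>i\<in>{..<n}. \<bar>x i\<bar> < T \<and> \<bar>y i\<bar> < T)"
    by (intro eventually_conj eventually_gt_at_top eventually_ball_finite ballI) auto
  then have "\<forall>\<^sub>F T in at_top. 0 \<le> fdet (Suc n) (\<lambda>i j. f (X T i - Y T j))"
  proof eventually_elim
    case (elim T)
    then have "0 < T" "i < n \<Longrightarrow> \<bar>x i\<bar> < T" "i < n \<Longrightarrow> \<bar>y i\<bar> < T" for i by auto
    then have T: "0 < T" "i < n \<Longrightarrow> x i < T" "i < n \<Longrightarrow> - T < x i" "i < n \<Longrightarrow> y i < T" "i < n \<Longrightarrow> - T < y i" for i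
      by (smt (verit))+
    have "X T i < X T j" if "i < j" "j < Suc n" for i j
      using that x T by (auto simp: X_def)
    moreover have "Y T i < Y T j" if "i < j" "j < Suc n" for i j
      using that y T by (auto simp: Y_def split: nat.splits)
    moreover have "Y T j < X T i" if "i < Suc n" "j < Suc n" for i j
      using that xy T by (auto simp: X_def Y_def split: nat.splits)
    ultimately show ?case by (intro assms(1)[unfolded pos_tn_def, rule_format]) auto
  qed
  moreover have "((\<lambda>T. fdet (Suc n) (\<lambda>i j. f (X T i - Y T j))) \<longlongrightarrow> fdet (Suc n) B) at_top"
  proof (rule fdet_tendsto)
    fix i j assume ij: "i < Suc n" "j < Suc n"
    have "filterlim (\<lambda>T. X T i - Y T j) at_top at_top" if edge: "i = n \<or> j = 0"
    proof -
      have *: "filterlim (\<lambda>T::real. T - - T) at_top at_top"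
        using filterlim_at_top_add_at_top[OF filterlim_ident filterlim_ident] by simp
      have **: "filterlim (\<lambda>T::real. a - - T) at_top at_top" for a
        using filterlim_tendsto_add_at_top[OF tendsto_const filterlim_ident, of a] by simp
      have ***: "filterlim (\<lambda>T::real. T - a) at_top at_top" for a
        using filterlim_tendsto_add_at_top[OF tendsto_const filterlim_ident, of "- a"] by simp
      consider "i < n" "j = 0" | "i = n" "j = 0" | j' where "i = n" "j = Suc j'"
        using edge ij by (cases j) (auto simp: less_Suc_eq)
      then show ?thesis
        by cases (simp_all only: X_def Y_def nat.case if_True if_False less_irrefl * ** ***)
    qed
    from filterlim_compose[OF lim this]
    have "((\<lambda>T. f (X T i - Y T j)) \<longlongrightarrow> f0) at_top" if "i = n \<or> j = 0" using that .
    then show "((\<lambda>T. f (X T i - Y T j)) \<longlongrightarrow> B i j) at_top"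
      using ij by (cases "i = n \<or> j = 0") (auto simp: X_def Y_def B_def split: nat.splits)
  qed
  ultimately have "0 \<le> fdet (Suc n) B"
    by (intro tendsto_lowerbound[of _ _ at_top]) auto
  also have "fdet (Suc n) B = f0 * fdet n (\<lambda>i j. f0 - B i (Suc j))"
    by (rule fdet_bordered) (auto simp: B_def split: nat.splits)
  also have "fdet n (\<lambda>i j. f0 - B i (Suc j)) = fdet n (\<lambda>i j. f0 - f (x i - y j))"
    by (rule fdet_cong) (simp add: B_def)
  finally show "0 \<le> fdet n (\<lambda>i j. f0 - f (x i - y j))" using \<open>0 < f0\<close> by (simp add: zero_le_mult_iff)
qed

section \<open>Functions preserving total non-negativity of sampled frequency functions\<close>

locale grid_preserver =
  fixes F :: "real \<Rightarrow> real"
  assumes F_nonneg: "\<And>x. 0 \<le> x \<Longrightarrow> 0 \<le> F x" and F_0: "F 0 = 0"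
    and preserves: "\<And>\<Lambda> h. polya_frequency_function \<Lambda> \<Longrightarrow> one_sided \<Lambda> \<Longrightarrow> 0 < h \<Longrightarrow>
      tn (toeplitz (\<lambda>k::int. F (\<Lambda> (h * of_int k))))"
begin

lemma tn_geometric:
  assumes "0 < c" "0 < h"
  shows "tn (toeplitz (\<lambda>k::int. if 0 \<le> k then F (c * exp (- (h * of_int k))) else 0))"
proof -
  have "tn (toeplitz (\<lambda>k::int. F (c * (exp (- 1 * (h * of_int k)) * (if 0 \<le> h * of_int k then 1 else 0)))))"
    by (rule preserves[OF pff_exp[OF assms(1)] assms(2)])
  also have "(\<lambda>k::int. F (c * (exp (- 1 * (h * of_int k)) * (if 0 \<le> h * of_int k then 1 else 0))))
      = (\<lambda>k. if 0 \<le> k then F (c * exp (- (h * of_int k))) else 0)"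
    using assms by (auto simp: F_0 zero_le_mult_iff)
  finally show ?thesis .
qed

lemma log_concave:
  assumes "0 < c" "0 < h"
  shows "F c * F (c * exp (- (2 * h))) \<le> F (c * exp (- h)) ^ 2"
  using tn_toeplitz_wright[OF tn_geometric[OF assms], of 0 1 2] by (simp add: power2_eq_square mult_ac)

text \<open>The sequence \<open>c (\<alpha>\<^sup>k - \<beta>\<^sup>k)\<close> with \<open>\<alpha>\<^sup>2 + \<alpha> \<beta> + \<beta>\<^sup>2 = 1\<close> and \<open>\<alpha> + \<beta> = s\<close> takes the values
  \<open>x\<close>, \<open>x s\<close>, \<open>x\<close> at \<open>k = 1, 2, 3\<close>.\<close>

lemma mono_step:
  assumes "0 < x" "1 < s" "s \<le> 11 / 10"
  shows "F x \<le> F (x * s)"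
proof -
  \<comment> \<open>With \<alpha> + \<beta> = s the quadratic condition becomes \<alpha> \<beta> =
    s^2 - 1, and d^2 = s^2 - 4 (s^2 - 1). The bound s \<le> 11/10 keeps d real and positive, and s >
    1 yields \<alpha> < 1 and \<beta> > 0.\<close>
  define d where "d = sqrt (4 - 3 * s\<^sup>2)"
  have "s\<^sup>2 \<le> (11 / 10)\<^sup>2" using assms by (intro power_mono) auto
  then have d: "0 < d" "d\<^sup>2 = 4 - 3 * s\<^sup>2" by (simp_all add: d_def power2_eq_square)
  have "s < s\<^sup>2" using assms by (simp add: power2_eq_square)
  then have "d\<^sup>2 < (2 - s)\<^sup>2" unfolding d(2) by (simp add: power2_eq_square algebra_simps)
  then have d2: "d < 2 - s" using assms by (elim power2_less_imp_less) auto
  have "d\<^sup>2 < s\<^sup>2" using d(2) assms \<open>s < s\<^sup>2\<close> by linarith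
  then have ds: "d < s" using assms by (elim power2_less_imp_less) auto
  define \<alpha> where "\<alpha> = (s + d) / 2"
  define \<beta> where "\<beta> = (s - d) / 2"
  have ab: "0 < \<beta>" "\<beta> < \<alpha>" "\<alpha> < 1" using d d2 ds by (simp_all add: \<alpha>_def \<beta>_def)
  have dbl: "2 * \<alpha> = s + d" "2 * \<beta> = s - d" by (simp_all add: \<alpha>_def \<beta>_def)
  then have sum: "\<alpha> + \<beta> = s" by linarith
  have "4 * (\<alpha> * \<beta>) = (2 * \<alpha>) * (2 * \<beta>)" by simp
  also have "\<dots> = s\<^sup>2 - d\<^sup>2" unfolding dbl by (simp add: power2_eq_square algebra_simps)
  finally have "\<alpha> * \<beta> = s\<^sup>2 - 1" using d(2) by linarith
  moreover have "\<alpha>\<^sup>2 + \<alpha> * \<beta> + \<beta>\<^sup>2 = (\<alpha> + \<beta>)\<^sup>2 - \<alpha> * \<beta>"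
    by (simp add: power2_eq_square algebra_simps)
  ultimately have quad: "\<alpha>\<^sup>2 + \<alpha> * \<beta> + \<beta>\<^sup>2 = 1" by (simp add: sum)
  \<comment> \<open>Chosen so that exp (- \<epsilon> h) = \<alpha> and exp (- h) = \<beta> /
    \<alpha>; then \<alpha> < 1 is what makes the damping \<epsilon> positive.\<close>
  define h where "h = ln (\<alpha> / \<beta>)"
  define \<epsilon> where "\<epsilon> = - ln \<alpha> / h"
  define c where "c = x / (\<alpha> - \<beta>)"
  have h: "0 < h" using ab by (simp add: h_def)
  have \<epsilon>: "0 < \<epsilon>" using ab h by (simp add: \<epsilon>_def divide_neg_pos)
  have c: "0 < c" using ab assms by (simp add: c_def)
  define \<Lambda> where "\<Lambda> t = c * (exp (- \<epsilon> * t) * (if 0 \<le> t then 1 - exp (- t) else 0))" for t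
  have tn: "tn (toeplitz (\<lambda>k::int. F (\<Lambda> (h * of_int k))))"
    unfolding \<Lambda>_def by (rule preserves[OF pff_one_minus_exp[OF c \<epsilon>] h])
  have "\<epsilon> * h = - ln \<alpha>" using h by (simp add: \<epsilon>_def)
  then have exps: "exp (- \<epsilon> * (h * of_int (int k))) = \<alpha> ^ k" "exp (- (h * of_int (int k))) = (\<beta> / \<alpha>) ^ k" for k
  proof -
    have "- \<epsilon> * (h * of_int (int k)) = real k * - (\<epsilon> * h)" by (simp add: algebra_simps)
    also have "\<dots> = real k * ln \<alpha>" by (simp add: \<open>\<epsilon> * h = _\<close>)
    finally have "- \<epsilon> * (h * of_int (int k)) = real k * ln \<alpha>" .
    then show "exp (- \<epsilon> * (h * of_int (int k))) = \<alpha> ^ k" using ab by (simp only: exp_of_nat_mult exp_ln)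
    have "h = - ln (\<beta> / \<alpha>)" using ab by (simp add: h_def ln_div)
    then have "- (h * of_int (int k)) = real k * ln (\<beta> / \<alpha>)" by simp
    then show "exp (- (h * of_int (int k))) = (\<beta> / \<alpha>) ^ k" using ab by (simp only: exp_of_nat_mult exp_ln divide_pos_pos)
  qed
  have val: "\<Lambda> (h * of_int (int k)) = c * (\<alpha> ^ k - \<beta> ^ k)" for k
  proof -
    have "\<alpha> ^ k * (1 - (\<beta> / \<alpha>) ^ k) = \<alpha> ^ k - \<beta> ^ k"
      using ab by (simp add: power_divide right_diff_distrib)
    then show ?thesis using h unfolding \<Lambda>_def exps by simp
  qed
  have L: "\<Lambda> (h * of_int 1) = x" "\<Lambda> (h * of_int 2) = x * s" "\<Lambda> (h * of_int 3) = x"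
  proof -
    have "\<Lambda> (h * of_int (int 1)) = x" unfolding val using ab by (simp add: c_def)
    then show "\<Lambda> (h * of_int 1) = x" by simp
    have "c * (\<alpha>\<^sup>2 - \<beta>\<^sup>2) = c * (\<alpha> - \<beta>) * (\<alpha> + \<beta>)" by (simp add: power2_eq_square algebra_simps)
    then have "\<Lambda> (h * of_int (int 2)) = x * s" unfolding val using ab by (simp add: c_def sum)
    then show "\<Lambda> (h * of_int 2) = x * s" by simp
    have "c * (\<alpha> ^ 3 - \<beta> ^ 3) = c * (\<alpha> - \<beta>) * (\<alpha>\<^sup>2 + \<alpha> * \<beta> + \<beta>\<^sup>2)"
      by (simp add: power2_eq_square power3_eq_cube algebra_simps)
    then have "\<Lambda> (h * of_int (int 3)) = x" unfolding val using ab by (simp add: c_def quad)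
    then show "\<Lambda> (h * of_int 3) = x" by simp
  qed
  have "F (\<Lambda> (h * of_int 1)) * F (\<Lambda> (h * of_int 3)) \<le> F (\<Lambda> (h * of_int 2)) * F (\<Lambda> (h * of_int (1 + 3 - 2)))"
    by (rule tn_toeplitz_wright[OF tn, of 1 2 3]) auto
  moreover have "(1::int) + 3 - 2 = 2" by simp
  ultimately have "F x * F x \<le> F (x * s) * F (x * s)" by (simp only: L)
  then have "(F x)\<^sup>2 \<le> (F (x * s))\<^sup>2" by (simp only: power2_eq_square)
  then show ?thesis by (rule power2_le_imp_le) (use F_nonneg[of "x * s"] assms in auto)
qed

lemma F_mono:
  assumes "0 < x" "x \<le> y"
  shows "F x \<le> F y"
proof (cases "x = y")
  case False
  then have "1 < y / x" using assms by simp
  define l where "l = ln (y / x)"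
  have l: "0 < l" using \<open>1 < y / x\<close> by (simp add: l_def)
  \<comment> \<open>\<open>mono_step\<close> covers only ratios up to 11/10, so the ratio y / x is
    split into n equal factors. An exponent of at most 1/20 keeps each factor within that
    range.\<close>
  obtain n :: nat where n: "20 * l < real n" using reals_Archimedean2 by blast
  then have n0: "0 < n" using l by (cases n) auto
  define s where "s = exp (l / real n)"
  have u: "0 < l / real n" "l / real n \<le> 1 / 20" using n n0 l by (simp_all add: field_simps)
  then have "l / real n \<le> 1" by linarith
  with u have "s \<le> 1 + l / real n + (l / real n)\<^sup>2" unfolding s_def by (intro exp_bound) auto
  also have "(l / real n)\<^sup>2 \<le> (1 / 20)\<^sup>2" using u by (intro power_mono) auto
  finally have "s \<le> 11 / 10" using u(2) by (simp add: power2_eq_square)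
  moreover have "1 < s" using u by (simp add: s_def)
  ultimately have s: "1 < s" "s \<le> 11 / 10" by auto
  have "F x \<le> F (x * s ^ k)" for k
  proof (induction k)
    case (Suc k)
    also have "F (x * s ^ k) \<le> F (x * s ^ k * s)" using assms s by (intro mono_step) auto
    finally show ?case by (simp add: mult_ac)
  qed simp
  moreover have "s ^ n = y / x"
  proof -
    have "s ^ n = exp (real n * (l / real n))" by (simp only: s_def exp_of_nat_mult)
    also have "\<dots> = y / x" using n0 assms by (simp add: l_def)
    finally show ?thesis .
  qed
  ultimately have "F x \<le> F (x * (y / x))" by metis
  then show ?thesis using assms by simp
qed simp

text \<open>By monotonicity a zero at \<open>x\<close> forces zeros on all of (0, x], so that F (2 y
  exp (-t)) on the half-line would have compact support. The factor 2 provides two points of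
  positivity, t = 0 and t = ln 2.\<close>

lemma positive_everywhere:
  assumes "0 < y" "0 < F y" "0 < x"
  shows "0 < F x"
proof (rule ccontr)
  assume "\<not> 0 < F x"
  then have "F x = 0" using F_nonneg[of x] assms by simp
  have "0 < F (2 * y)" using F_mono[of y "2 * y"] assms by simp
  show False
  proof (rule no_compactly_supported_tn[of "\<lambda>t. if 0 \<le> t then F (2 * y * exp (- t)) else 0" "ln 2" "\<bar>ln (2 * y / x)\<bar>"])
    fix h :: real assume "0 < h"
    then have "(\<lambda>k::int. if 0 \<le> h * real_of_int k then F (2 * y * exp (- (h * real_of_int k))) else 0)
        = (\<lambda>k. if 0 \<le> k then F (2 * y * exp (- (h * of_int k))) else 0)"
      by (auto simp: zero_le_mult_iff)
    then show "tn (toeplitz (\<lambda>k::int. if 0 \<le> h * real_of_int k then F (2 * y * exp (- (h * real_of_int k))) else 0))"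
      using tn_geometric[of "2 * y" h] \<open>0 < h\<close> assms by simp
  next
    fix t :: real assume t: "\<bar>ln (2 * y / x)\<bar> < \<bar>t\<bar>"
    show "(if 0 \<le> t then F (2 * y * exp (- t)) else 0) = 0"
    proof (cases "0 \<le> t")
      case True
      then have "ln (2 * y / x) \<le> t" using t by linarith
      then have "2 * y / x \<le> exp t" using assms by (metis exp_le_cancel_iff exp_ln divide_pos_pos mult_pos_pos zero_less_numeral)
      then have "2 * y * exp (- t) \<le> x" using assms by (simp add: exp_minus field_simps)
      then have "F (2 * y * exp (- t)) \<le> F x" using assms by (intro F_mono) auto
      then show ?thesis using F_nonneg[of "2 * y * exp (- t)"] \<open>F x = 0\<close> assms by simp
    qed simp
  qed (use assms \<open>0 < F (2 * y)\<close> in \<open>simp_all add: exp_minus\<close>)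
qed

end

section \<open>Positive preservers in logarithmic coordinates\<close>

locale positive_grid_preserver = grid_preserver +
  assumes F_pos: "0 < x \<Longrightarrow> 0 < F x"
begin

definition psi :: "real \<Rightarrow> real" where
  "psi t = ln (F (exp t))"

lemma F_eq: "0 < x \<Longrightarrow> F x = exp (psi (ln x))"
  by (simp add: psi_def F_pos)

lemma psi_mono: "u \<le> v \<Longrightarrow> psi u \<le> psi v"
  unfolding psi_def by (subst ln_le_cancel_iff) (auto intro!: F_mono F_pos)

text \<open>Log-concavity of sequences compares only points of one grid. Here \<open>v\<close> is
  rounded down to a grid point \<open>v'\<close> counted from \<open>z\<close>; monotonicity gives
  \<open>psi v' \<le> psi v\<close>, and the rounding error tends to 0 with the mesh, so no
  continuity is presupposed.\<close>

lemma psi_concave: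
  assumes "u < v" "v < z"
  shows "(z - v) * psi u + (v - u) * psi z \<le> (z - u) * psi v"
proof -
  have bound: "(z - v) * psi u + (v - u) * psi z - (z - u) * (psi z - psi u) / real (Suc m) \<le> (z - u) * psi v" for m
  proof -
    define N where "N = Suc m"
    define h where "h = (z - u) / real N"
    define j where "j = \<lceil>(z - v) / h\<rceil>"
    have h: "0 < h" "h * real N = z - u" using assms by (simp_all add: h_def N_def)
    have "0 < (z - v) / h" using assms h by simp
    then have j0: "0 \<le> j" unfolding j_def by linarith
    have "(z - v) / h \<le> real N" using assms h by (simp add: pos_divide_le_eq mult.commute)
    then have jN: "j \<le> int N" unfolding j_def by linarith
    define v' where "v' = z - h * of_int j"
    have "(z - v) / h \<le> of_int j" "of_int j \<le> (z - v) / h + 1" unfolding j_def by linarith+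
    moreover have "z - v \<le> h * J \<and> h * J \<le> z - v + h" if "(z - v) / h \<le> J" "J \<le> (z - v) / h + 1" for J
      using that h(1) by (simp add: field_simps)
    ultimately have v': "v' \<le> v" "v - v' \<le> h" by (force simp: v'_def)+
    let ?b = "\<lambda>k::int. if 0 \<le> k then F (exp z * exp (- (h * of_int k))) else 0"
    have lnb: "ln (?b k) = psi (z - h * of_int k)" "0 < ?b k" if "0 \<le> k" for k
      using that by (auto simp: psi_def F_pos simp flip: exp_add)
    have "of_int (int N - j) * ln (?b 0) + of_int (j - 0) * ln (?b (int N)) \<le> of_int (int N - 0) * ln (?b j)"
      using tn_sequence_log_concave(2)[OF tn_geometric[of "exp z" h], of 0 j "int N"] h j0 jN by (simp add: F_pos)
    then have "(real N - of_int j) * psi z + of_int j * psi u \<le> real N * psi v'"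
      using j0 jN lnb(1)[of 0] lnb(1)[of "int N"] lnb(1)[of j] h(2) by (simp add: v'_def)
    then have "h * ((real N - of_int j) * psi z + of_int j * psi u) \<le> h * (real N * psi v')"
      using h by (intro mult_left_mono) auto
    moreover have "h * (real N * psi v') = (z - u) * psi v'" by (simp only: h(2) mult.assoc[symmetric])
    moreover have "(z - u) * psi v' \<le> (z - u) * psi v"
      using psi_mono[OF v'(1)] assms by (intro mult_left_mono) auto
    moreover have "h * ((real N - of_int j) * psi z + of_int j * psi u)
        = (h * real N) * psi z - (h * of_int j) * (psi z - psi u)"
      by (simp add: algebra_simps)
    moreover have "h * of_int j = z - v'" by (simp add: v'_def)
    ultimately have "(z - u) * psi z - (z - v') * (psi z - psi u) \<le> (z - u) * psi v" by (simp only: h(2))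
    moreover have "(z - v') * (psi z - psi u) \<le> (z - v + h) * (psi z - psi u)"
      using v' psi_mono[of u z] assms by (intro mult_right_mono) auto
    ultimately have "(z - u) * psi z - (z - v + h) * (psi z - psi u) \<le> (z - u) * psi v" by linarith
    then show ?thesis by (simp add: h_def N_def algebra_simps)
  qed
  have "(\<lambda>m. (z - v) * psi u + (v - u) * psi z - (z - u) * (psi z - psi u) / real (Suc m))
      \<longlonglongrightarrow> (z - v) * psi u + (v - u) * psi z - 0"
    by (intro tendsto_diff tendsto_const LIMSEQ_Suc[OF lim_const_over_n])
  then have "(\<lambda>m. (z - v) * psi u + (v - u) * psi z - (z - u) * (psi z - psi u) / real (Suc m))
      \<longlonglongrightarrow> (z - v) * psi u + (v - u) * psi z" by simp
  then show ?thesis by (rule LIMSEQ_le_const2) (use bound in blast)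
qed

lemma isCont_F:
  assumes "0 < x"
  shows "isCont F x"
proof -
  have "convex_on UNIV (\<lambda>t. - psi t)"
  proof (rule convex_on_linorderI)
    fix t x y :: real assume t: "0 < t" "t < 1" "x < y"
    define w where "w = (1 - t) * x + t * y"
    have w: "y - w = (1 - t) * (y - x)" "w - x = t * (y - x)" by (simp_all add: w_def algebra_simps)
    then have "x < w" "w < y" using t by (metis diff_gt_0_iff_gt mult_pos_pos)+
    from psi_concave[OF this] have "(y - x) * ((1 - t) * psi x + t * psi y) \<le> (y - x) * psi w"
      unfolding w by (simp add: algebra_simps)
    then have "(1 - t) * psi x + t * psi y \<le> psi w" by (rule mult_left_le_imp_le) (use t in simp)
    then show "- psi ((1 - t) *\<^sub>R x + t *\<^sub>R y) \<le> (1 - t) * - psi x + t * - psi y"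
      by (simp add: w_def)
  qed auto
  then have "continuous_on UNIV (\<lambda>t. - psi t)" by (intro convex_on_continuous) auto
  then have "continuous_on UNIV (\<lambda>t. - (- psi t))" by (rule continuous_on_minus)
  then have "isCont psi t" for t by (simp add: continuous_on_eq_continuous_at)
  then have "isCont (\<lambda>y. psi (ln y)) x" using assms by (intro isCont_o2[OF isCont_ln]) auto
  then have "isCont (\<lambda>y. exp (psi (ln y))) x" by (rule isCont_exp')
  moreover have "\<forall>\<^sub>F y in nhds x. F y = exp (psi (ln y))"
    using eventually_nhds_in_open[of "{0<..}" x] assms by (auto elim!: eventually_mono simp: F_eq)
  ultimately show ?thesis by (subst isCont_cong) auto
qed

text \<open>If \<open>F\<close> is constant on \<open>{x..}\<close> but \<open>F z < F x\<close> for some \<open>z < x\<close>, then a geometric sequence is mapped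
  to \<open>1, 1, 1, r\<close> with \<open>r < 1\<close>, up to scaling.\<close>

lemma constant_if_not_strict:
  assumes "0 < x" "x < y" "F x = F y" "0 < z"
  shows "F z = F x"
proof -
  have right: "F w = F x" if "x \<le> w" for w
  proof (cases "w \<le> y")
    case True
    then show ?thesis using that assms F_mono[of x w] F_mono[of w y] by simp
  next
    case False
    \<comment> \<open>A concave function that is flat between two points cannot rise to the right of
      them.\<close>
    have "(ln w - ln y) * psi (ln x) + (ln y - ln x) * psi (ln w) \<le> (ln w - ln x) * psi (ln y)"
      using assms False by (intro psi_concave) auto
    moreover have "psi (ln y) = psi (ln x)" using assms by (simp add: psi_def)
    ultimately have "(ln y - ln x) * psi (ln w) \<le> (ln y - ln x) * psi (ln x)" by (simp add: algebra_simps)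
    then have "psi (ln w) \<le> psi (ln x)" by (rule mult_left_le_imp_le) (use assms in simp)
    moreover have "psi (ln x) \<le> psi (ln w)" using assms that by (intro psi_mono) simp
    ultimately show ?thesis using assms that by (simp add: F_eq)
  qed
  show ?thesis
  proof (cases "x \<le> z")
    case False
    define q where "q = z / x"
    have q: "0 < q" "q < 1" using assms False by (simp_all add: q_def)
    \<comment> \<open>With this start the geometric sequence reaches x at k = 2 and z at k = 3, the
      earlier terms being at least x.\<close>
    define c where "c = x / q\<^sup>2"
    have c: "0 < c" using assms q by (simp add: c_def)
    define b where "b k = (if 0 \<le> k then F (c * exp (- (- ln q * of_int k))) else 0)" for k :: int
    have tn: "tn (toeplitz b)" unfolding b_def by (rule tn_geometric) (use c q in auto)
    have bk: "b (int k) = F (c * q ^ k)" for k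
    proof -
      have "exp (- (- ln q * of_int (int k))) = exp (real k * ln q)" by (simp add: mult.commute)
      also have "\<dots> = q ^ k" using q by (simp only: exp_of_nat_mult exp_ln)
      finally show ?thesis by (simp add: b_def)
    qed
    have c2: "c * q\<^sup>2 = x" using q by (simp add: c_def)
    have "c * q ^ 3 = c * q\<^sup>2 * q" by (simp add: power2_eq_square power3_eq_cube)
    then have c3: "c * q ^ 3 = z" unfolding c2 using assms by (simp add: q_def)
    have "c * q\<^sup>2 \<le> c * q ^ 1" "c * q ^ 2 \<le> c * q ^ 0"
      using c q by (intro mult_left_mono power_decreasing; simp)+
    then have "F (c * q ^ 1) = F x" "F (c * q ^ 0) = F x" unfolding c2 by (blast intro: right)+
    then have vals: "b 0 = F x" "b 1 = F x" "b 2 = F x" "b 3 = F z"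
      using bk[of 0] bk[of 1] bk[of 2] bk[of 3] by (simp_all add: c2 c3)
    have neg: "b (- 1) = 0" by (simp add: b_def)
    \<comment> \<open>The rows are shifted by 1 so that the diagonal entry is \<open>b 1\<close> and
      the lower left corner is \<open>b 3\<close>; the upper right corner \<open>b (- 1)\<close> is
      0.\<close>
    have "0 \<le> fdet 3 (\<lambda>i j. toeplitz b (int i + 1) (int j))" by (rule tnD[OF tn]) auto
    also have "\<dots> = F x * (F x * F x - F x * F x) - F x * (F x * F x - F x * F z)"
      using vals neg by (simp add: fdet_3 toeplitz_def)
    finally have "F x * F x * F x \<le> F x * F x * F z" by (simp add: algebra_simps)
    then have "F x \<le> F z" using F_pos[OF assms(1)] by simp
    then show ?thesis using F_mono[of z x] assms False by simp
  qed (rule right)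
qed

text \<open>Removal of the damping: \<epsilon> and the grid mesh are both 1 / (m + 3) and tend to 0
  together. Off the diagonal the arguments of \<open>F\<close> converge to a positive number, where
  \<open>F\<close> is continuous.\<close>

lemma pos_tn_compose:
  assumes pff: "\<And>\<epsilon>. 0 < \<epsilon> \<Longrightarrow> polya_frequency_function (\<lambda>x. c * (exp (- \<epsilon> * x) * (if 0 \<le> x then l x else 0)))"
      "\<And>\<epsilon>. 0 < \<epsilon> \<Longrightarrow> one_sided (\<lambda>x. c * (exp (- \<epsilon> * x) * (if 0 \<le> x then l x else 0)))"
    and l: "\<And>t. 0 < t \<Longrightarrow> 0 < l t" "\<And>t. 0 < t \<Longrightarrow> isCont l t" and "0 < c"
  shows "pos_tn n (\<lambda>t. F (c * l t))"
  unfolding pos_tn_def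
proof (intro allI impI)
  fix x y :: "nat \<Rightarrow> real"
  assume x: "\<forall>i j. i < j \<longrightarrow> j < n \<longrightarrow> x i < x j" and y: "\<forall>i j. i < j \<longrightarrow> j < n \<longrightarrow> y i < y j"
    and xy: "\<forall>i<n. \<forall>j<n. y j < x i"
  define r where "r m s t = real_of_int (\<lfloor>real (m + 3) * s\<rfloor> - \<lfloor>real (m + 3) * t\<rfloor>) / real (m + 3)" for m :: nat and s t
  define \<Lambda> where "\<Lambda> m u = c * (exp (- (1 / real (m + 3)) * u) * (if 0 \<le> u then l u else 0))" for m :: nat and u
  have "tn (\<lambda>s t. F (\<Lambda> m (r m s t)))" for m
  proof -
    have "tn (toeplitz (\<lambda>k::int. F (\<Lambda> m (1 / real (m + 3) * of_int k))))"
      unfolding \<Lambda>_def by (intro preserves pff) auto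
    from tn_comp_mono[OF this, of "\<lambda>s. \<lfloor>real (m + 3) * s\<rfloor>" "\<lambda>s. \<lfloor>real (m + 3) * s\<rfloor>"]
    show ?thesis by (simp add: r_def toeplitz_def mono_def floor_mono mult_left_mono)
  qed
  then have "0 \<le> fdet n (\<lambda>i j. F (\<Lambda> m (r m (x i) (y j))))" for m
    by (rule tnD) (use x y in auto)
  moreover have "(\<lambda>m. fdet n (\<lambda>i j. F (\<Lambda> m (r m (x i) (y j))))) \<longlonglongrightarrow> fdet n (\<lambda>i j. F (c * l (x i - y j)))"
  proof (rule fdet_tendsto)
    fix i j assume "i < n" "j < n"
    then have pos: "0 < x i - y j" using xy by simp
    have rlim: "(\<lambda>m. r m (x i) (y j)) \<longlonglongrightarrow> x i - y j" unfolding r_def by (rule floor_scale_tendsto)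
    then have rpos: "\<forall>\<^sub>F m in sequentially. 0 < r m (x i) (y j)" using pos by (rule order_tendstoD)
    have "(\<lambda>m. 1 / real (m + 3)) \<longlonglongrightarrow> 0" by real_asymp
    then have "(\<lambda>m. c * (exp (- (1 / real (m + 3)) * r m (x i) (y j)) * l (r m (x i) (y j))))
        \<longlonglongrightarrow> c * (exp (- 0 * (x i - y j)) * l (x i - y j))"
      by (intro tendsto_mult tendsto_const tendsto_exp tendsto_minus rlim isCont_tendsto_compose[OF l(2)[OF pos] rlim])
    then have "(\<lambda>m. \<Lambda> m (r m (x i) (y j))) \<longlonglongrightarrow> c * (exp (- 0 * (x i - y j)) * l (x i - y j))"
    proof (rule Lim_transform_eventually)
      show "\<forall>\<^sub>F m in sequentially. c * (exp (- (1 / real (m + 3)) * r m (x i) (y j)) * l (r m (x i) (y j)))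
          = \<Lambda> m (r m (x i) (y j))"
        using rpos by eventually_elim (simp add: \<Lambda>_def)
    qed
    then have "(\<lambda>m. \<Lambda> m (r m (x i) (y j))) \<longlonglongrightarrow> c * l (x i - y j)" by simp
    then show "(\<lambda>m. F (\<Lambda> m (r m (x i) (y j)))) \<longlonglongrightarrow> F (c * l (x i - y j))"
      by (rule isCont_tendsto_compose[rotated]) (intro isCont_F mult_pos_pos \<open>0 < c\<close> l(1) pos)
  qed
  ultimately show "0 \<le> fdet n (\<lambda>i j. F (c * l (x i - y j)))"
    by (intro LIMSEQ_le_const) auto
qed

lemma pos_tn_one_minus_exp:
  assumes "0 < c"
  shows "pos_tn n (\<lambda>t. F (c * (1 - exp (- t))))"
  by (rule pos_tn_compose[OF pff_one_minus_exp[OF assms]]) (use assms in \<open>auto intro!: continuous_intros\<close>)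

lemma pos_tn_two_exps:
  assumes "0 < c"
  shows "pos_tn n (\<lambda>t. F (c * (1 - 3 * exp (- 2 * t) + 2 * exp (- 3 * t))))"
proof (rule pos_tn_compose[OF pff_two_exps[OF assms]])
  show "0 < 1 - 3 * exp (- 2 * t) + 2 * exp (- 3 * t)" if "0 < t" for t :: real
    unfolding two_exps_factor using that by (intro mult_pos_pos add_pos_pos) auto
qed (use assms in \<open>auto intro!: continuous_intros\<close>)

end

section \<open>Strictly increasing preservers are linear\<close>

locale strict_grid_preserver = positive_grid_preserver +
  assumes F_strict: "0 < x \<Longrightarrow> x < y \<Longrightarrow> F x < F y"
begin

lemma psi_strict: "u < v \<Longrightarrow> psi u < psi v"
  unfolding psi_def by (subst ln_less_cancel_iff) (auto intro!: F_strict F_pos)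

text \<open>\<open>p\<close> is the left derivative of \<open>psi\<close> at \<open>ln c\<close>.\<close>

lemma left_derivative:
  assumes "0 < c"
  obtains p where "0 < p" "\<And>y. 0 < y \<Longrightarrow> y < 1 \<Longrightarrow> F (c * y) \<le> F c * y powr p"
    "((\<lambda>t. exp t * (F c - F (c * (1 - exp (- t))))) \<longlongrightarrow> p * F c) at_top"
proof -
  define S where "S u = (psi (ln c) - psi (ln c - u)) / u" for u
  \<comment> \<open>By concavity the slope on the right of \<open>ln c\<close> is a lower bound for
    all slopes on the left. It is positive by strict monotonicity, and this is what makes
    \<open>p\<close> positive.\<close>
  define \<sigma> where "\<sigma> = psi (ln c + 1) - psi (ln c)"
  have \<sigma>: "0 < \<sigma>" using psi_strict[of "ln c" "ln c + 1"] by (simp add: \<sigma>_def)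
  have S_ge: "\<sigma> \<le> S u" if "0 < u" for u
    using psi_concave[of "ln c - u" "ln c" "ln c + 1"] that by (simp add: S_def \<sigma>_def field_simps)
  have S_mono: "S u \<le> S u'" if "0 < u" "u \<le> u'" for u u'
    using psi_concave[of "ln c - u'" "ln c - u" "ln c"] that by (cases "u = u'") (auto simp: S_def field_simps)
  define p where "p = Inf (S ` {0<..})"
  have bdd: "bdd_below (S ` {0<..})" using S_ge by (auto intro!: bdd_belowI)
  have p_le: "p \<le> S u" if "0 < u" for u
    unfolding p_def using that bdd by (intro cInf_lower) auto
  have "\<sigma> \<le> p" unfolding p_def by (rule cInf_greatest) (use S_ge in \<open>auto simp: image_iff intro: exI[of _ 1]\<close>)
  then have p: "0 < p" using \<sigma> by linarith
  have S_lim: "(S \<longlongrightarrow> p) (at_right 0)"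
  proof (rule tendstoI)
    fix e :: real assume "0 < e"
    then have "Inf (S ` {0<..}) < p + e" by (simp add: p_def)
    then obtain u0 where u0: "0 < u0" "S u0 < p + e" using cInf_lessD[of "S ` {0<..}" "p + e"] by auto
    have "\<forall>\<^sub>F u in at_right 0. u \<in> {0<..<u0}" using u0 by (intro eventually_at_right_real)
    then show "\<forall>\<^sub>F u in at_right 0. dist (S u) p < e"
    proof eventually_elim
      case (elim u)
      then have "p \<le> S u" "S u \<le> S u0" using p_le S_mono by auto
      then show ?case using u0 by (simp add: dist_real_def)
    qed
  qed
  have F_S: "F (c * exp (- u)) = F c * exp (- (u * S u))" if "0 < u" for u
  proof -
    have "c * exp (- u) = exp (ln c - u)" using assms by (simp add: exp_diff exp_minus divide_inverse)
    then have "F (c * exp (- u)) = exp (psi (ln c - u))" by (simp add: psi_def F_pos)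
    also have "psi (ln c - u) = psi (ln c) - u * S u" using that by (simp add: S_def)
    also have "exp (psi (ln c) - u * S u) = F c * exp (- (u * S u))"
      using assms F_eq[of c] by (simp add: exp_diff exp_minus divide_inverse)
    finally show ?thesis .
  qed
  show thesis
  proof (rule that[OF p])
    fix y :: real assume y: "0 < y" "y < 1"
    have "F (c * y) = F c * exp (- ((- ln y) * S (- ln y)))"
      using F_S[of "- ln y"] y by simp
    also have "\<dots> \<le> F c * exp (- ((- ln y) * p))"
      using y p_le[of "- ln y"] F_pos[OF assms] by (intro mult_left_mono) (auto intro!: mult_left_mono_neg)
    also have "exp (- ((- ln y) * p)) = y powr p" using y by (simp add: powr_def mult.commute)
    finally show "F (c * y) \<le> F c * y powr p" .
  next
    \<comment> \<open>The change of variable exp (- u) = 1 - exp (- t), which transports the slope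
      of \<open>psi\<close> at \<open>ln c\<close> to the increment of \<open>F\<close> at
      \<open>c\<close>.\<close>
    define u where "u t = - ln (1 - exp (- t))" for t :: real
    have u_lim: "filterlim u (at_right 0) at_top" unfolding u_def by real_asymp
    have ue: "((\<lambda>t. u t * exp t) \<longlongrightarrow> 1) at_top" unfolding u_def by real_asymp
    have Su: "((\<lambda>t. S (u t)) \<longlongrightarrow> p) at_top" by (rule filterlim_compose[OF S_lim u_lim])
    have upos: "0 < u t" if "0 < t" for t using that by (simp add: u_def)
    have "((\<lambda>t. u t * S (u t)) \<longlongrightarrow> 0 * p) at_top"
      using u_lim by (intro tendsto_mult Su) (simp add: filterlim_at)
    then have "((\<lambda>t. u t * S (u t)) \<longlongrightarrow> 0) at_top" by simp
    moreover have "\<forall>\<^sub>F t in at_top. u t * S (u t) \<in> {0<..} \<and> u t * S (u t) \<noteq> 0"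
      using eventually_gt_at_top[of "0::real"]
    proof eventually_elim
      case (elim t)
      have "0 < u t * S (u t)" using upos[OF elim] S_ge[OF upos[OF elim]] \<sigma> by (intro mult_pos_pos) auto
      then show ?case by (metis greaterThan_iff less_irrefl)
    qed
    ultimately have v_lim: "filterlim (\<lambda>t. u t * S (u t)) (at_right 0) at_top"
      unfolding filterlim_at by blast
    \<comment> \<open>With v = u S the rescaled increment is F c times the product of (1 - exp (-
      v)) / v, the slope S, and u exp t; the three factors tend to 1, p and 1.\<close>
    have "((\<lambda>v::real. (1 - exp (- v)) / v) \<longlongrightarrow> 1) (at_right 0)" by real_asymp
    from filterlim_compose[OF this v_lim]
    have "((\<lambda>t. F c * ((1 - exp (- (u t * S (u t)))) / (u t * S (u t)) * S (u t) * (u t * exp t))) \<longlongrightarrow> F c * (1 * p * 1)) at_top"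
      by (intro tendsto_mult tendsto_const Su ue)
    moreover have "\<forall>\<^sub>F t in at_top. F c * ((1 - exp (- (u t * S (u t)))) / (u t * S (u t)) * S (u t) * (u t * exp t))
        = exp t * (F c - F (c * (1 - exp (- t))))"
      using eventually_gt_at_top[of 0]
    proof eventually_elim
      case (elim t)
      have "exp (- u t) = 1 - exp (- t)" using elim by (simp add: u_def)
      then have "F (c * (1 - exp (- t))) = F c * exp (- (u t * S (u t)))"
        using F_S[OF upos[OF elim]] by simp
      moreover have "u t \<noteq> 0" "S (u t) \<noteq> 0" using upos[OF elim] S_ge[OF upos[OF elim]] \<sigma> by auto
      ultimately show ?case by (simp add: field_simps)
    qed
    ultimately have "((\<lambda>t. exp t * (F c - F (c * (1 - exp (- t))))) \<longlongrightarrow> F c * (1 * p * 1)) at_top"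
      by (rule Lim_transform_eventually)
    then show "((\<lambda>t. exp t * (F c - F (c * (1 - exp (- t))))) \<longlongrightarrow> p * F c) at_top"
      by (simp add: mult.commute)
  qed
qed

lemma affine_below:
  assumes "0 < c"
  obtains \<kappa> where "0 < \<kappa>" "\<And>y. 0 < y \<Longrightarrow> y < 1 \<Longrightarrow> F (c * y) = F c - \<kappa> * (1 - y)"
proof -
  obtain p where p: "0 < p" and upper: "\<And>y. 0 < y \<Longrightarrow> y < 1 \<Longrightarrow> F (c * y) \<le> F c * y powr p"
    and lim: "((\<lambda>t. exp t * (F c - F (c * (1 - exp (- t))))) \<longlongrightarrow> p * F c) at_top"
    using left_derivative[OF assms] by blast
  define \<kappa> where "\<kappa> = p * F c"
  have Fc: "0 < F c" by (rule F_pos[OF assms])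
  then have \<kappa>: "0 < \<kappa>" using p by (simp add: \<kappa>_def)
  \<comment> \<open>Two rounds of \<open>pos_tn_limit_difference\<close>: from order 3 to 2 by
    removing \<open>F c\<close>, from order 2 to 1 by removing \<kappa>.\<close>
  have tangent: "F c - F (c * y) \<le> \<kappa> * (1 - y)" if y: "0 < y" "y < 1" for y
  proof -
    have "isCont F c" by (rule isCont_F[OF assms])
    moreover have "((\<lambda>t. c * (1 - exp (- t))) \<longlongrightarrow> c) at_top" by real_asymp
    ultimately have "((\<lambda>t. F (c * (1 - exp (- t)))) \<longlongrightarrow> F c) at_top" by (rule isCont_tendsto_compose)
    then have "pos_tn 2 (\<lambda>t. F c - F (c * (1 - exp (- t))))"
      using pos_tn_limit_difference[of 2] pos_tn_one_minus_exp[OF assms] Fc by blast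
    from pos_tn_twist[OF this, of 1]
    have "pos_tn (Suc 1) (\<lambda>t. exp t * (F c - F (c * (1 - exp (- t)))))" by (simp add: numeral_2_eq_2)
    then have "pos_tn 1 (\<lambda>t. \<kappa> - exp t * (F c - F (c * (1 - exp (- t)))))"
      by (rule pos_tn_limit_difference) (use lim \<kappa> in \<open>simp_all add: \<kappa>_def\<close>)
    note pos_tn_1[OF this[unfolded One_nat_def]]
    from this[of "- ln (1 - y)"] y show ?thesis by (simp add: exp_minus field_simps)
  qed
  define l where "l t = 1 - 3 * exp (- 2 * t) + 2 * exp (- 3 * t)" for t :: real
  define g where "g t = F c - F (c * l t)" for t
  have l01: "0 < l t" "l t < 1" if "0 < t" for t
  proof -
    show "0 < l t" unfolding l_def two_exps_factor using that by (intro mult_pos_pos add_pos_pos) auto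
    have "exp (- 3 * t) < exp (- 2 * t)" "0 < exp (- 2 * t)" using that by auto
    then show "l t < 1" unfolding l_def by linarith
  qed
  have g_le: "g t \<le> \<kappa> * (3 * exp (- 2 * t) - 2 * exp (- 3 * t))" if "0 < t" for t
    using tangent[OF l01[OF that]] by (simp add: g_def l_def algebra_simps)
  have g_ge: "F c * (1 - (1 - 3 * exp (- 2 * t) + 2 * exp (- 3 * t)) powr p) \<le> g t" if "0 < t" for t
    using upper[OF l01[OF that]] by (simp add: g_def l_def algebra_simps)
  have ev: "\<forall>\<^sub>F t in at_top. (0::real) < t" by (rule eventually_gt_at_top)
  \<comment> \<open>The bounds \<open>g_le\<close> and \<open>g_ge\<close> differ only by terms of
    order exp (- 4 t), because the quadratic term of the power is already of that size. Squeezing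
    \<open>g\<close> between them determines its two leading coefficients 3 \<kappa> and -2
    \<kappa>.\<close>
  have lim3: "((\<lambda>t. exp (2 * t) * g t) \<longlongrightarrow> 3 * \<kappa>) at_top"
  proof (rule tendsto_sandwich)
    show "((\<lambda>t. exp (2 * t) * (F c * (1 - (1 - 3 * exp (- 2 * t) + 2 * exp (- 3 * t)) powr p))) \<longlongrightarrow> 3 * \<kappa>) at_top"
      using p Fc unfolding \<kappa>_def by real_asymp
    show "((\<lambda>t. exp (2 * t) * (\<kappa> * (3 * exp (- 2 * t) - 2 * exp (- 3 * t)))) \<longlongrightarrow> 3 * \<kappa>) at_top"
      using \<kappa> by real_asymp
    show "\<forall>\<^sub>F t in at_top. exp (2 * t) * (F c * (1 - (1 - 3 * exp (- 2 * t) + 2 * exp (- 3 * t)) powr p)) \<le> exp (2 * t) * g t"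
      using ev by eventually_elim (intro mult_left_mono g_ge exp_ge_zero)
    show "\<forall>\<^sub>F t in at_top. exp (2 * t) * g t \<le> exp (2 * t) * (\<kappa> * (3 * exp (- 2 * t) - 2 * exp (- 3 * t)))"
      using ev by eventually_elim (intro mult_left_mono g_le exp_ge_zero)
  qed
  have lim2: "((\<lambda>t. exp t * (3 * \<kappa> - exp (2 * t) * g t)) \<longlongrightarrow> 2 * \<kappa>) at_top"
  proof (rule tendsto_sandwich)
    show "((\<lambda>t. exp t * (3 * \<kappa> - exp (2 * t) * (\<kappa> * (3 * exp (- 2 * t) - 2 * exp (- 3 * t))))) \<longlongrightarrow> 2 * \<kappa>) at_top"
      using \<kappa> by real_asymp
    show "((\<lambda>t. exp t * (3 * \<kappa> - exp (2 * t) * (F c * (1 - (1 - 3 * exp (- 2 * t) + 2 * exp (- 3 * t)) powr p)))) \<longlongrightarrow> 2 * \<kappa>) at_top"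
      using p Fc unfolding \<kappa>_def by real_asymp
    show "\<forall>\<^sub>F t in at_top. exp t * (3 * \<kappa> - exp (2 * t) * (\<kappa> * (3 * exp (- 2 * t) - 2 * exp (- 3 * t)))) \<le> exp t * (3 * \<kappa> - exp (2 * t) * g t)"
      using ev by eventually_elim (intro mult_left_mono diff_left_mono g_le exp_ge_zero)
    show "\<forall>\<^sub>F t in at_top. exp t * (3 * \<kappa> - exp (2 * t) * g t)
        \<le> exp t * (3 * \<kappa> - exp (2 * t) * (F c * (1 - (1 - 3 * exp (- 2 * t) + 2 * exp (- 3 * t)) powr p)))"
      using ev by eventually_elim (intro mult_left_mono diff_left_mono g_ge exp_ge_zero)
  qed
  have "isCont F c" by (rule isCont_F[OF assms])
  moreover have "((\<lambda>t. c * l t) \<longlongrightarrow> c) at_top" unfolding l_def by real_asymp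
  ultimately have "((\<lambda>t. F (c * l t)) \<longlongrightarrow> F c) at_top" by (rule isCont_tendsto_compose)
  \<comment> \<open>Three rounds starting from order 4, one more than for \<open>tangent\<close>;
    the remainder therefore appears with the opposite sign.\<close>
  then have "pos_tn 3 g"
    unfolding g_def using pos_tn_limit_difference[of 3] pos_tn_two_exps[OF assms] Fc by (auto simp: l_def)
  from pos_tn_twist[OF this, of 2] have "pos_tn (Suc 2) (\<lambda>t. exp (2 * t) * g t)" by (simp add: numeral_3_eq_3 numeral_2_eq_2)
  then have "pos_tn 2 (\<lambda>t. 3 * \<kappa> - exp (2 * t) * g t)"
    by (rule pos_tn_limit_difference) (use lim3 \<kappa> in auto)
  from pos_tn_twist[OF this, of 1] have "pos_tn (Suc 1) (\<lambda>t. exp t * (3 * \<kappa> - exp (2 * t) * g t))"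
    by (simp add: numeral_2_eq_2)
  then have "pos_tn 1 (\<lambda>t. 2 * \<kappa> - exp t * (3 * \<kappa> - exp (2 * t) * g t))"
    by (rule pos_tn_limit_difference) (use lim2 \<kappa> in auto)
  note cotangent = pos_tn_1[OF this[unfolded One_nat_def]]
  show thesis
  proof (rule that[OF \<kappa>])
    fix y :: real assume y: "0 < y" "y < 1"
    \<comment> \<open>The cubic takes the value 1 at w = 0 and 0 at w = 1, so every y in (0, 1)
      occurs as some \<open>l t\<close>.\<close>
    have "\<exists>w. 0 \<le> w \<and> w \<le> 1 \<and> 1 - 3 * w\<^sup>2 + 2 * w ^ 3 = y"
      by (rule IVT2) (use y in \<open>auto intro!: continuous_intros\<close>)
    then obtain w where w: "0 \<le> w" "w \<le> 1" "1 - 3 * w\<^sup>2 + 2 * w ^ 3 = y" by blast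
    have "w \<noteq> 0" "w \<noteq> 1" using w(3) y by auto
    then have w01: "0 < w" "w < 1" using w(1,2) by linarith+
    define t where "t = - ln w"
    have t: "0 < t" "exp (- t) = w" using w01 by (simp_all add: t_def)
    have et: "exp t = 1 / w" 
    proof -
      have "exp t * exp (- t) = 1" by (simp flip: exp_add)
      then show ?thesis using t(2) w01 by (simp add: field_simps)
    qed
    have e2: "exp (2 * t) = 1 / w\<^sup>2" 
    proof -
      have "exp (2 * t) = exp t * exp t" by (simp flip: exp_add)
      then show ?thesis by (simp add: et power2_eq_square)
    qed
    have "exp (- 2 * t) = w\<^sup>2" "exp (- 3 * t) = w ^ 3"
      using exp_of_nat_mult[of 2 "- t"] exp_of_nat_mult[of 3 "- t"] t(2) by simp_all
    then have lt: "l t = y" using w(3) by (simp add: l_def)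
    have "0 \<le> 2 * \<kappa> - (3 * \<kappa> - g t / w\<^sup>2) / w" using cotangent[OF t(1)] by (simp add: et e2)
    then have "0 \<le> (2 * \<kappa> - (3 * \<kappa> - g t / w\<^sup>2) / w) * w ^ 3" using w01 by simp
    also have "\<dots> = 2 * \<kappa> * w ^ 3 - 3 * \<kappa> * w\<^sup>2 + g t"
      using w01 by (simp add: field_simps power2_eq_square power3_eq_cube)
    also have "\<dots> = g t - \<kappa> * (1 - y)" unfolding w(3)[symmetric] by (simp add: algebra_simps)
    finally have "\<kappa> * (1 - y) \<le> F c - F (c * y)" by (simp add: g_def lt)
    with tangent[OF y] show "F (c * y) = F c - \<kappa> * (1 - y)" by linarith
  qed
qed

text \<open>The intercept \<open>A\<close> of the affine function is excluded from both sides: a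
  negative one by non-negativity of \<open>F\<close> near 0, a positive one by log-concavity. As c
  is arbitrary, x and 1 can be compared in either order.\<close>

lemma linear:
  assumes "0 < x"
  shows "F x = F 1 * x"
proof -
  have ratio: "F (c * y) = F c * y" if "0 < c" "0 < y" "y < 1" for c y
  proof -
    obtain \<kappa> where \<kappa>: "0 < \<kappa>" and aff: "\<And>y. 0 < y \<Longrightarrow> y < 1 \<Longrightarrow> F (c * y) = F c - \<kappa> * (1 - y)"
      using affine_below[OF \<open>0 < c\<close>] by blast
    define A where "A = F c - \<kappa>"
    have affA: "F (c * y) = A + \<kappa> * y" if "0 < y" "y < 1" for y
      using aff[OF that] by (simp add: A_def algebra_simps)
    have "0 \<le> A"
    proof (rule field_le_epsilon)
      fix e :: real assume "0 < e"
      define y where "y = min (1 / 2) (e / \<kappa>)"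
      have y: "0 < y" "y < 1" "\<kappa> * y \<le> e" using \<open>0 < e\<close> \<kappa> by (auto simp: y_def min_def field_simps)
      have "0 \<le> F (c * y)" using y \<open>0 < c\<close> by (intro F_nonneg) simp
      then show "0 \<le> A + e" using affA[OF y(1,2)] y(3) by linarith
    qed
    moreover have "A \<le> 0"
    proof -
      \<comment> \<open>The geometric progression starts at \<open>c * (1/2)\<close> because
        \<open>affA\<close> speaks of y < 1. At 1/2, 1/4, 1/8 the two sides of the inequality differ
        by A \<kappa> / 8.\<close>
      have e: "exp (- ln 2) = (1 / 2 :: real)" "exp (- (2 * ln 2)) = (1 / 4 :: real)"
        by (simp_all add: exp_minus exp_double inverse_eq_divide)
      have c: "c * (1/2) * (1/4) = c * (1/8)" "c * (1/2) * (1/2) = c * (1/4)" "0 < c * (1/2)" "0 < ln (2 :: real)"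
        using \<open>0 < c\<close> by simp_all
      from log_concave[OF c(3,4)] have "F (c * (1/2)) * F (c * (1/8)) \<le> (F (c * (1/4)))\<^sup>2"
        by (simp only: e c(1,2))
      moreover have "F (c * (1/2)) = A + \<kappa> * (1/2)" "F (c * (1/4)) = A + \<kappa> * (1/4)"
        "F (c * (1/8)) = A + \<kappa> * (1/8)" by (rule affA; simp)+
      ultimately have "(A + \<kappa> * (1/2)) * (A + \<kappa> * (1/8)) \<le> (A + \<kappa> * (1/4))\<^sup>2" by simp
      then have "A * \<kappa> \<le> 0" by (simp add: power2_eq_square algebra_simps)
      then show ?thesis using \<kappa> by (simp add: mult_le_0_iff)
    qed
    ultimately have "A = 0" by simp
    then show ?thesis using affA[OF that(2,3)] by (simp add: A_def)
  qed
  show ?thesis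
  proof (cases x "1 :: real" rule: linorder_cases)
    case less
    then show ?thesis using ratio[of 1 x] assms by simp
  next
    case greater
    then show ?thesis using ratio[of x "1 / x"] assms by (simp add: field_simps)
  qed simp
qed

end

context grid_preserver
begin

theorem classification:
  "(\<forall>x>0. F x = 0) \<or> (\<exists>c>0. \<forall>x>0. F x = c) \<or> (\<exists>c>0. \<forall>x>0. F x = c * x)"
proof (cases "\<exists>y>0. 0 < F y")
  case False
  then have "F x = 0" if "0 < x" for x using F_nonneg[of x] that by force
  then show ?thesis by blast
next
  case True
  interpret positive_grid_preserver F
    by unfold_locales (use True positive_everywhere in blast)
  show ?thesis
  proof (cases "\<exists>x y. 0 < x \<and> x < y \<and> F x = F y")
    case True
    then obtain x y where "0 < x" "x < y" "F x = F y" by blast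
    then have "\<forall>z>0. F z = F x" "0 < F x" using constant_if_not_strict F_pos by blast+
    then show ?thesis by blast
  next
    case False
    interpret strict_grid_preserver F
      by unfold_locales (use False F_mono in \<open>force simp: less_le\<close>)
    have "\<forall>x>0. F x = F 1 * x" using linear by blast
    moreover have "0 < F 1" by (rule F_pos) simp
    ultimately show ?thesis by blast
  qed
qed

end

section \<open>The three characterizations\<close>

lemma tn_zero: "tn (\<lambda>(x::'a::linordered_idom) y. 0)"
  using tn_cmult[OF tn_toeplitz_point[of "0::'a"], of 0] by simp

text \<open>A closed ray is a translate of the unit step, and an open ray is a limit of closed rays
  shrinking towards the end point from the right.\<close>

lemma tn_upper_set:
  fixes S :: "real set"
  assumes up: "\<And>x y. x \<in> S \<Longrightarrow> x \<le> y \<Longrightarrow> y \<in> S" and "S \<noteq> {}" "bdd_below S"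
  shows "tn (toeplitz (indicator S))"
proof -
  have closed_ray: "tn (toeplitz (\<lambda>x::real. if s \<le> x then 1 else 0))" for s
    using tn_toeplitz_shift[OF tn_step, of "- s"] by simp
  define s where "s = Inf S"
  have lower: "s \<le> x" if "x \<in> S" for x unfolding s_def by (rule cInf_lower[OF that assms(3)])
  have above: "x \<in> S" if "s < x" for x
    using cInf_lessD[OF assms(2), of x] that up unfolding s_def by (meson less_imp_le)
  show ?thesis
  proof (cases "s \<in> S")
    case True
    have "x \<in> S \<longleftrightarrow> s \<le> x" for x using up[OF True] lower by blast
    then have "indicator S = (\<lambda>x::real. if s \<le> x then 1 else (0::real))"
      by (simp add: indicator_def fun_eq_iff)
    then show ?thesis using closed_ray by simp
  next
    case False
    show ?thesis
    proof (rule tn_limit[of "\<lambda>m. toeplitz (\<lambda>x. if s + 1 / real (Suc m) \<le> x then 1 else 0)"])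
      fix x y :: real
      define u where "u = x - y"
      have "(\<lambda>m. if s + 1 / real (Suc m) \<le> u then 1 else 0 :: real) \<longlonglongrightarrow> indicator S u"
      proof (cases "s < u")
        case True
        have "(\<lambda>m. s + 1 / real (Suc m)) \<longlonglongrightarrow> s + 0" by (intro tendsto_intros LIMSEQ_Suc[OF lim_const_over_n])
        then have "\<forall>\<^sub>F m in sequentially. s + 1 / real (Suc m) < u" by (rule order_tendstoD) (use True in simp)
        then have "\<forall>\<^sub>F m in sequentially. indicator S u = (if s + 1 / real (Suc m) \<le> u then 1 else 0 :: real)"
          by eventually_elim (use above[OF True] in simp)
        then show ?thesis by (rule Lim_transform_eventually[OF tendsto_const])
      next
        case False
        have "u \<notin> S" using lower[of u] False \<open>s \<notin> S\<close> by (cases "u = s") auto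
        moreover have "\<not> s + 1 / real (Suc m) \<le> u" for m
        proof -
          have "0 < 1 / real (Suc m)" by simp
          then show ?thesis using False by linarith
        qed
        ultimately show ?thesis by simp
      qed
      then show "(\<lambda>m. toeplitz (\<lambda>x. if s + 1 / real (Suc m) \<le> x then 1 else 0) x y) \<longlonglongrightarrow> toeplitz (indicator S) x y"
        by (simp only: toeplitz_def u_def)
    qed (rule closed_ray)
  qed
qed

lemma tn_support_left_bounded:
  fixes f :: "real \<Rightarrow> real"
  assumes tn: "tn (toeplitz f)" and left: "\<And>x. x < x0 \<Longrightarrow> f x = 0"
  shows "tn (toeplitz (\<lambda>x. indicator {0<..} (f x)))"
proof -
  have nonneg: "0 \<le> f x" for x using tn_nonneg[OF tn, of x 0] by (simp add: toeplitz_def)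
  define S where "S = {x. 0 < f x}"
  have ind: "(\<lambda>x. indicator {0<..} (f x)) = (indicator S :: real \<Rightarrow> real)"
    by (auto simp: S_def indicator_def fun_eq_iff)
  have convex: "v \<in> S" if "u \<in> S" "z \<in> S" "u \<le> v" "v \<le> z" for u v z
  proof -
    have "0 < f u * f z" using that by (simp add: S_def)
    then have "f v \<noteq> 0" using tn_toeplitz_wright[OF tn that(3,4)] by auto
    then show ?thesis using nonneg[of v] by (simp add: S_def less_le)
  qed
  consider "S = {}" | s where "S = {s}" | u z where "u \<in> S" "z \<in> S" "u < z"
    by (metis all_not_in_conv insertI1 linorder_neqE singletonD subsetI subset_singletonD subset_singleton_iff)
  then show ?thesis
  proof cases
    case 1
    then show ?thesis unfolding ind using tn_zero[where 'a = real] by (simp add: toeplitz_def)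
  next
    case 2
    then have "(indicator S :: real \<Rightarrow> real) = (\<lambda>x. if x = s then 1 else 0)"
      by (auto simp: indicator_def fun_eq_iff)
    then show ?thesis unfolding ind using tn_toeplitz_point[of s] by simp
  next
    case 3
    show ?thesis unfolding ind
    proof (rule tn_upper_set)
      fix x y assume x: "x \<in> S" "x \<le> y"
      show "y \<in> S"
      proof (rule ccontr)
        assume y: "y \<notin> S"
        have bound: "w < y" if "w \<in> S" for w using convex[of x w y] x y that by (meson leI)
        show False
        \<comment> \<open>A gap at \<open>y\<close> beyond a support point confines the support
          between \<open>x0\<close> and \<open>y\<close>. Translation by \<open>u\<close> places one
          of the two known points of positivity at 0.\<close>
        proof (rule no_compactly_supported_tn[of "\<lambda>t. f (t + u)" "z - u" "\<bar>x0 - u\<bar> + \<bar>y - u\<bar>"])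
          show "tn (toeplitz (\<lambda>k::int. f (h * of_int k + u)))" if "0 < h" for h
            using tn_toeplitz_grid[OF tn_toeplitz_shift[OF tn, of u], of h] that by simp
          show "f (t + u) = 0" if "\<bar>x0 - u\<bar> + \<bar>y - u\<bar> < \<bar>t\<bar>" for t
          proof (cases "t < 0")
            case True
            then show ?thesis using that by (intro left) linarith
          next
            case False
            then have "y < t + u" using that by linarith
            then have "t + u \<notin> S" using bound[of "t + u"] by auto
            then show ?thesis using nonneg[of "t + u"] by (simp add: S_def)
          qed
        qed (use 3 in \<open>auto simp: S_def\<close>)
      qed
    next
      show "bdd_below S" using left by (intro bdd_belowI[of _ x0]) (force simp: S_def not_less)
    qed (use 3 in auto)
  qed
qed

lemma tn_support_one_sided:
  fixes f :: "real \<Rightarrow> real"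
  assumes tn: "tn (toeplitz f)" and "one_sided f"
  shows "tn (toeplitz (\<lambda>x. indicator {0<..} (f x)))"
proof -
  obtain x0 where "(\<forall>x<x0. f x = 0) \<or> (\<forall>x>x0. f x = 0)" using assms(2) by (auto simp: one_sided_def)
  then show ?thesis
  proof
    assume "\<forall>x<x0. f x = 0"
    then show ?thesis by (intro tn_support_left_bounded[OF tn]) auto
  next
    assume "\<forall>x>x0. f x = 0"
    then have "tn (toeplitz (\<lambda>x. indicator {0<..} (f (- x))))"
      by (intro tn_support_left_bounded[OF tn_toeplitz_reflect[OF tn], of "- x0"]) auto
    from tn_toeplitz_reflect[OF this] show ?thesis by simp
  qed
qed

text \<open>Applied to both half-lines: on the negative one it forces \<open>F 0 = 0\<close>, on the
  other it rules out that \<open>F\<close> is a positive constant on the positive numbers.\<close>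

lemma integrable_constant_on_long_set:
  fixes f :: "real \<Rightarrow> real"
  assumes int: "integrable lebesgue f" and "\<And>x. x \<in> S \<Longrightarrow> f x = c" and S: "S \<in> sets lebesgue"
    and long: "\<And>n::nat. \<exists>a. {a..a + real n} \<subseteq> S"
  shows "c = 0"
proof (rule ccontr)
  assume "c \<noteq> 0"
  have "integrable lebesgue (\<lambda>x. indicator S x *\<^sub>R f x)" by (rule integrable_mult_indicator[OF S int])
  also have "(\<lambda>x. indicator S x *\<^sub>R f x) = (\<lambda>x. c * indicator S x)"
    using assms(2) by (auto simp: indicator_def fun_eq_iff)
  finally have "integrable lebesgue (indicator S :: real \<Rightarrow> real)" using \<open>c \<noteq> 0\<close> by simp
  then have fin: "S \<in> lmeasurable" using S by (simp add: integrable_indicator_iff fmeasurable_def)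
  obtain n :: nat where n: "measure lebesgue S < real n" using reals_Archimedean2 by blast
  obtain a where "{a..a + real n} \<subseteq> S" using long by blast
  then have "measure lebesgue {a..a + real n} \<le> measure lebesgue S"
    by (rule measure_mono_fmeasurable) (use fin in auto)
  then show False using n by simp
qed

text \<open>The generating polynomial is a multiple of 1 + z + z^2, whose roots are not real; a
  minor of order 3 already detects this.\<close>

lemma not_tn_three_ones:
  fixes a :: "int \<Rightarrow> real"
  assumes "0 < c" "\<And>k. a k = (if 0 \<le> k \<and> k \<le> 2 then c else 0)"
  shows "\<not> tn (toeplitz a)"
proof
  assume "tn (toeplitz a)"
  then have "0 \<le> fdet 3 (\<lambda>i j. toeplitz a (int i + 1) (int j))" by (rule tnD) auto
  also have "\<dots> = - (c * c * c)" by (simp add: fdet_3 toeplitz_def assms(2))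
  finally have "c * c * c \<le> 0" by simp
  moreover have "0 < c * c * c" using assms(1) by simp
  ultimately show False by linarith
qed

text \<open>The coefficients of (1 + z)^2. Unlike functions on the line, sequences may have finite
  support with more than one point, and the indicator of this support is the sequence excluded by
  \<open>not_tn_three_ones\<close>.\<close>

lemma tn_one_two_one: "tn (toeplitz (\<lambda>k::int. if k = 0 \<or> k = 2 then 1 else if k = 1 then 2 else 0))"
proof -
  define d where "d k = (if k = 0 then 1 else 0 :: real)" for k :: int
  have "tn (toeplitz (\<lambda>k. d k + 1 * d (k - 1)))"
    using tn_toeplitz_point[of "0::int"] by (intro tn_binomial_convolution) (simp_all add: d_def)
  from tn_binomial_convolution[OF this, of 1]
  have "tn (toeplitz (\<lambda>k. d k + 1 * d (k - 1) + 1 * (d (k - 1) + 1 * d (k - 1 - 1))))" by simp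
  also have "(\<lambda>k. d k + 1 * d (k - 1) + 1 * (d (k - 1) + 1 * d (k - 1 - 1)))
      = (\<lambda>k. if k = 0 \<or> k = 2 then 1 else if k = 1 then 2 else 0)"
    by (auto simp: d_def fun_eq_iff)
  finally show ?thesis .
qed

lemma one_sided_cmult: "one_sided f \<Longrightarrow> one_sided (\<lambda>x. c * f x)"
  by (force simp: one_sided_def)

section \<open>Assembling the three equivalences\<close>

theorem polya_frequency_function_transforms:
  assumes F: "F \<in> {0..} \<rightarrow> {0..}"
  shows "(\<forall>\<Lambda>. polya_frequency_function \<Lambda> \<and> one_sided \<Lambda> \<longrightarrow>
      polya_frequency_function (F \<circ> \<Lambda>) \<and> one_sided (F \<circ> \<Lambda>))
    \<longleftrightarrow> (\<exists>c>0. \<forall>x\<ge>0. F x = c * x)" (is "?L \<longleftrightarrow> ?R")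
proof
  assume ?L
  then have pres: "polya_frequency_function (F \<circ> \<Lambda>)"
    if "polya_frequency_function \<Lambda>" "one_sided \<Lambda>" for \<Lambda> using that by blast
  define E where "E x = 1 * (exp (- 1 * x) * (if 0 \<le> x then 1 else 0))" for x :: real
  have E: "polya_frequency_function (F \<circ> E)"
    unfolding E_def by (rule pres[OF pff_exp]) simp_all
  then have int: "integrable lebesgue (F \<circ> E)" by (simp add: polya_frequency_function_def)
  have F0: "F 0 = 0"
  proof (rule integrable_constant_on_long_set[OF int, of "{..<0}"])
    show "\<exists>a. {a..a + real n} \<subseteq> {..<0}" for n by (rule exI[of _ "- real n - 1"]) auto
  qed (auto simp: E_def)
  interpret grid_preserver F
  proof
    fix \<Lambda> :: "real \<Rightarrow> real" and h :: real
    assume "polya_frequency_function \<Lambda>" "one_sided \<Lambda>" "0 < h"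
    then have "tn (toeplitz (F \<circ> \<Lambda>))" using pres[of \<Lambda>] by (simp add: polya_frequency_function_def)
    from tn_toeplitz_grid[OF this, of h] \<open>0 < h\<close>
    show "tn (toeplitz (\<lambda>k::int. F (\<Lambda> (h * of_int k))))" by simp
  qed (use F F0 in auto)
  have not_const: "\<not> (\<forall>x>0. F x = c)" for c
  proof
    assume c: "\<forall>x>0. F x = c"
    have "c = 0"
    proof (rule integrable_constant_on_long_set[OF int, of "{0..}"])
      show "\<exists>a. {a..a + real n} \<subseteq> {0..}" for n by (rule exI[of _ 0]) auto
    qed (use c in \<open>auto simp: E_def\<close>)
    then have "(F \<circ> E) x = 0" for x using c F0 by (simp add: E_def)
    then show False using E by (simp add: polya_frequency_function_def)
  qed
  then have "\<exists>c>0. \<forall>x>0. F x = c * x" using classification by blast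
  then show ?R using F0 by (metis less_eq_real_def mult_zero_right)
next
  assume ?R
  then obtain c where c: "0 < c" "\<And>x. 0 \<le> x \<Longrightarrow> F x = c * x" by blast
  show ?L
  proof (intro allI impI)
    fix \<Lambda> :: "real \<Rightarrow> real" assume \<Lambda>: "polya_frequency_function \<Lambda> \<and> one_sided \<Lambda>"
    then have "F \<circ> \<Lambda> = (\<lambda>x. c * \<Lambda> x)" by (auto simp: polya_frequency_function_def c(2))
    moreover have "polya_frequency_function (\<lambda>x. c * \<Lambda> x)"
      using \<Lambda> c(1) tn_cmult[of "toeplitz \<Lambda>" c] by (auto simp: polya_frequency_function_def toeplitz_def)
    ultimately show "polya_frequency_function (F \<circ> \<Lambda>) \<and> one_sided (F \<circ> \<Lambda>)"
      using \<Lambda> one_sided_cmult[of \<Lambda> c] by simp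
  qed
qed

theorem toeplitz_kernel_transforms:
  assumes F: "F \<in> {0..} \<rightarrow> {0..}"
  shows "(\<forall>K. totally_nonneg_on UNIV K \<and> one_sided_measurable_toeplitz_kernel K \<longrightarrow>
      totally_nonneg_on UNIV (\<lambda>x y. F (K x y)) \<and>
      one_sided_measurable_toeplitz_kernel (\<lambda>x y. F (K x y)))
    \<longleftrightarrow> ((\<forall>x\<ge>0. F x = 0) \<or>
      (\<exists>c>0. (\<forall>x\<ge>0. F x = c * x) \<or> (\<forall>x\<ge>0. F x = c * indicator {0<..} x)))" (is "?L \<longleftrightarrow> ?R")
proof
  assume L: ?L
  define d where "d x = (if x = 0 then 1 else 0 :: real)" for x :: real
  have "one_sided d" unfolding one_sided_def d_def by (intro exI[of _ 0]) auto
  moreover have "d \<in> borel_measurable lebesgue"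
    unfolding d_def by (intro measurable_completion) simp
  moreover have "tn (toeplitz d)" unfolding d_def by (rule tn_toeplitz_point)
  ultimately have "one_sided_measurable_toeplitz_kernel (\<lambda>x y. F (toeplitz d x y))"
    using L unfolding one_sided_measurable_toeplitz_kernel_def by blast
  then obtain f where f: "(\<lambda>x y. F (toeplitz d x y)) = toeplitz f" "one_sided f"
    unfolding one_sided_measurable_toeplitz_kernel_def by blast
  have fx: "f x = F (d x)" for x using fun_cong[OF fun_cong[OF f(1)], of x 0] by (simp add: toeplitz_def)
  obtain x0 where "(\<forall>x<x0. f x = 0) \<or> (\<forall>x>x0. f x = 0)" using f(2) by (auto simp: one_sided_def)
  \<comment> \<open>One of the two points lies on the side where \<open>f\<close> vanishes. Both
    differ from 0, so the value of \<open>f\<close> there is \<open>F 0\<close>.\<close>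
  then have "f (min x0 0 - 1) = 0 \<or> f (max x0 0 + 1) = 0" by auto
  then have F0: "F 0 = 0" by (auto simp: fx d_def min_def max_def split: if_splits)
  interpret grid_preserver F
  proof
    fix \<Lambda> :: "real \<Rightarrow> real" and h :: real
    assume \<Lambda>: "polya_frequency_function \<Lambda>" "one_sided \<Lambda>" "0 < h"
    then have "tn (toeplitz \<Lambda>)" "one_sided_measurable_toeplitz_kernel (toeplitz \<Lambda>)"
      by (auto simp: polya_frequency_function_def one_sided_measurable_toeplitz_kernel_def)
    then have "tn (\<lambda>x y. F (toeplitz \<Lambda> x y))" using L by blast
    then have "tn (toeplitz (\<lambda>x. F (\<Lambda> x)))" by (simp add: toeplitz_def)
    from tn_toeplitz_grid[OF this, of h] \<open>0 < h\<close>
    show "tn (toeplitz (\<lambda>k::int. F (\<Lambda> (h * of_int k))))" by simp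
  qed (use F F0 in auto)
  have ge0: "(\<forall>x\<ge>0. P x) \<longleftrightarrow> P 0 \<and> (\<forall>x>0. P x)" for P :: "real \<Rightarrow> bool"
    by (metis less_eq_real_def)
  from classification show ?R by (auto simp: ge0 F0)
next
  assume R: ?R
  show ?L
  proof (intro allI impI)
    fix K :: "real \<Rightarrow> real \<Rightarrow> real"
    assume K: "tn K \<and> one_sided_measurable_toeplitz_kernel K"
    then obtain f where f: "K = toeplitz f" "f \<in> borel_measurable lebesgue" "one_sided f"
      unfolding one_sided_measurable_toeplitz_kernel_def by blast
    have tn: "tn (toeplitz f)" using K f by simp
    have nonneg: "0 \<le> f x" for x using tn_nonneg[OF tn, of x 0] by (simp add: toeplitz_def)
    have goal: "tn (\<lambda>x y. F (K x y)) \<and> one_sided_measurable_toeplitz_kernel (\<lambda>x y. F (K x y))"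
      if "\<And>x. 0 \<le> x \<Longrightarrow> F x = c * g x" "0 \<le> c" "tn (toeplitz (\<lambda>x. g (f x)))"
        "(\<lambda>x. g (f x)) \<in> borel_measurable lebesgue" "one_sided (\<lambda>x. g (f x))" for c g
    proof -
      have "(\<lambda>x y. F (K x y)) = toeplitz (\<lambda>x. c * g (f x))"
        using that(1) nonneg by (simp add: f(1) toeplitz_def)
      moreover have "tn (toeplitz (\<lambda>x. c * g (f x)))"
        using tn_cmult[OF that(3,2)] by (simp add: toeplitz_def)
      moreover have "one_sided_measurable_toeplitz_kernel (toeplitz (\<lambda>x. c * g (f x)))"
        unfolding one_sided_measurable_toeplitz_kernel_def
        using that(4) one_sided_cmult[OF that(5)] by (intro exI[of _ "\<lambda>x. c * g (f x)"]) auto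
      ultimately show ?thesis by simp
    qed
    from R consider "\<forall>x\<ge>0. F x = 0" | c where "0 < c" "\<forall>x\<ge>0. F x = c * x"
      | c where "0 < c" "\<forall>x\<ge>0. F x = c * indicator {0<..} x" by blast
    then show "tn (\<lambda>x y. F (K x y)) \<and> one_sided_measurable_toeplitz_kernel (\<lambda>x y. F (K x y))"
    proof cases
      case 1
      then show ?thesis by (intro goal[of 0 "\<lambda>x. x"]) (use tn f in auto)
    next
      case (2 c)
      then show ?thesis by (intro goal[of c "\<lambda>x. x"]) (use tn f in auto)
    next
      case (3 c)
      show ?thesis
      proof (rule goal[of c "indicator {0<..}"])
        show "(\<lambda>x. indicator {0<..} (f x)) \<in> borel_measurable lebesgue"
          by (rule measurable_compose[OF f(2)]) simp
        show "one_sided (\<lambda>x. indicator {0<..} (f x))" using f(3) by (force simp: one_sided_def)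
      qed (use 3 tn_support_one_sided[OF tn f(3)] in auto)
    qed
  qed
qed

theorem polya_frequency_sequence_transforms:
  assumes F: "F \<in> {0..} \<rightarrow> {0..}"
  shows "(\<forall>a. polya_frequency_sequence a \<and> one_sided a \<longrightarrow>
      polya_frequency_sequence (F \<circ> a) \<and> one_sided (F \<circ> a))
    \<longleftrightarrow> ((\<forall>x\<ge>0. F x = 0) \<or> (\<exists>c>0. \<forall>x\<ge>0. F x = c * x))" (is "?L \<longleftrightarrow> ?R")
proof
  assume L: ?L
  define d where "d k = (if k = 0 then 1 else 0 :: real)" for k :: int
  have "one_sided d" unfolding one_sided_def d_def by (intro exI[of _ 0]) auto
  moreover have "tn (toeplitz d)" unfolding d_def by (rule tn_toeplitz_point)
  ultimately have "one_sided (F \<circ> d)" using L by (simp add: polya_frequency_sequence_def)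
  then obtain k0 where "(\<forall>k<k0. F (d k) = 0) \<or> (\<forall>k>k0. F (d k) = 0)" by (auto simp: one_sided_def)
  then have "F (d (min k0 0 - 1)) = 0 \<or> F (d (max k0 0 + 1)) = 0" by auto
  then have F0: "F 0 = 0" by (auto simp: d_def min_def max_def split: if_splits)
  interpret grid_preserver F
  proof
    fix \<Lambda> :: "real \<Rightarrow> real" and h :: real
    assume \<Lambda>: "polya_frequency_function \<Lambda>" "one_sided \<Lambda>" "0 < h"
    define a where "a k = \<Lambda> (h * of_int k)" for k :: int
    have "polya_frequency_sequence a"
      using \<Lambda> tn_toeplitz_grid[of \<Lambda> h]
      by (simp add: polya_frequency_sequence_def polya_frequency_function_def a_def[abs_def])
    moreover have "one_sided a"
    proof -
      obtain x0 where "(\<forall>x<x0. \<Lambda> x = 0) \<or> (\<forall>x>x0. \<Lambda> x = 0)" using \<Lambda>(2) by (auto simp: one_sided_def)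
      moreover have "h * of_int k < x0" if "k < \<lfloor>x0 / h\<rfloor>" for k
      proof -
        have "of_int k < x0 / h" using that by linarith
        then show ?thesis using \<Lambda>(3) by (simp add: field_simps)
      qed
      moreover have "x0 < h * of_int k" if "\<lceil>x0 / h\<rceil> < k" for k
      proof -
        have "x0 / h < of_int k" using that by linarith
        then show ?thesis using \<Lambda>(3) by (simp add: field_simps)
      qed
      ultimately show ?thesis unfolding one_sided_def a_def by metis
    qed
    ultimately have "tn (toeplitz (F \<circ> a))" using L by (simp add: polya_frequency_sequence_def)
    then show "tn (toeplitz (\<lambda>k::int. F (\<Lambda> (h * of_int k))))" by (simp add: a_def comp_def)
  qed (use F F0 in auto)
  have not_const: "\<not> (\<forall>x>0. F x = c)" if "0 < c" for c
  proof
    assume c: "\<forall>x>0. F x = c"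
    define b where "b k = (if k = 0 \<or> k = 2 then 1 else if k = 1 then 2 else 0 :: real)" for k :: int
    have "one_sided b" unfolding one_sided_def b_def by (intro exI[of _ 0]) auto
    moreover have "tn (toeplitz b)" using tn_one_two_one by (simp add: b_def[abs_def])
    ultimately have "tn (toeplitz (F \<circ> b))" using L by (simp add: polya_frequency_sequence_def)
    moreover have "\<not> tn (toeplitz (F \<circ> b))"
      by (rule not_tn_three_ones[OF that]) (use c F0 in \<open>auto simp: b_def\<close>)
    ultimately show False by blast
  qed
  have ge0: "(\<forall>x\<ge>0. P x) \<longleftrightarrow> P 0 \<and> (\<forall>x>0. P x)" for P :: "real \<Rightarrow> bool"
    by (metis less_eq_real_def)
  from classification not_const show ?R by (auto simp: ge0 F0)
next
  assume R: ?R
  then obtain c where c: "0 \<le> c" "\<And>x. 0 \<le> x \<Longrightarrow> F x = c * x"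
    by (metis less_imp_le mult_zero_left order_refl)
  show ?L
  proof (intro allI impI)
    fix a :: "int \<Rightarrow> real" assume a: "polya_frequency_sequence a \<and> one_sided a"
    then have tn: "tn (toeplitz a)" by (simp add: polya_frequency_sequence_def)
    have nonneg: "0 \<le> a k" for k using tn_nonneg[OF tn, of k 0] by (simp add: toeplitz_def)
    then have "F \<circ> a = (\<lambda>k. c * a k)" by (auto simp: c(2))
    then show "polya_frequency_sequence (F \<circ> a) \<and> one_sided (F \<circ> a)"
      using a tn_cmult[OF tn c(1)] one_sided_cmult[of a c]
      by (simp add: polya_frequency_sequence_def toeplitz_def)
  qed
qed

theorem theorem1p7:
  fixes F :: "real \<Rightarrow> real"
  assumes "F \<in> {0..} \<rightarrow> {0..}"
  shows
    "((\<forall>\<Lambda>. polya_frequency_function \<Lambda> \<and> one_sided \<Lambda> \<longrightarrow>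
          polya_frequency_function (F \<circ> \<Lambda>) \<and> one_sided (F \<circ> \<Lambda>))
      \<longleftrightarrow> (\<exists>c>0. \<forall>x\<ge>0. F x = c * x))
     \<and>
     ((\<forall>K. totally_nonneg_on UNIV K \<and> one_sided_measurable_toeplitz_kernel K \<longrightarrow>
          totally_nonneg_on UNIV (\<lambda>x y. F (K x y)) \<and>
          one_sided_measurable_toeplitz_kernel (\<lambda>x y. F (K x y)))
      \<longleftrightarrow> ((\<forall>x\<ge>0. F x = 0) \<or>
           (\<exists>c>0. (\<forall>x\<ge>0. F x = c * x) \<or> (\<forall>x\<ge>0. F x = c * indicator {0<..} x))))
     \<and>
     ((\<forall>a. polya_frequency_sequence a \<and> one_sided a \<longrightarrow>
          polya_frequency_sequence (F \<circ> a) \<and> one_sided (F \<circ> a))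
      \<longleftrightarrow> ((\<forall>x\<ge>0. F x = 0) \<or> (\<exists>c>0. \<forall>x\<ge>0. F x = c * x)))"
  using polya_frequency_function_transforms[OF assms] toeplitz_kernel_transforms[OF assms]
    polya_frequency_sequence_transforms[OF assms] by blast

end
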